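(* Let $K$ be a field of characteristic $0$ and let $n,m\ge 1$ be integers. Then $\beta(n,m)\le mn^4$; that is, the invariant ring $R(n,m)$ is generated as a $K$-algebra by invariants of degree $\le mn^4$.
   Context: $\mathrm{Mat}_{n,n}$ is the space of $n\times n$ matrices over $K$. The group $G=\mathrm{SL}_n\times \mathrm{SL}_n$ acts on $V=\mathrm{Mat}_{n,n}^m$ by $(A,B)\cdot(X_1,\dots,X_m)=(AX_1B^{-1},\dots,AX_mB^{-1})$. $R(n,m)=K[V]^G$ is the graded ring of $G$-invariant polynomial functions on $V$. $\beta(n,m)$ is the smallest nonnegative integer $d$ such that $R(n,m)$ is generated by invariants of degree $\le d$. *)

theory Defs
  imports
    "HOL-Library.FuncSet"
    "Jordan_Normal_Form.Determinant"
    "Jordan_Normal_Form.Gauss_Jordan_Elimination"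
begin

definition special_linear :: "nat \<Rightarrow> 'k::field mat set" where
  "special_linear n = {A \<in> carrier_mat n n. det A = 1}"

text \<open>The \<open>m\<close>-tuples of \<open>n \<times> n\<close> matrices. Tuples are extensional functions on \<open>{..<m}\<close>, and
  functions on \<open>V\<close> are in turn extensional, so that equality of tuples and of functions
  on \<open>V\<close> is equality of HOL functions.\<close>

definition mat_tuples :: "nat \<Rightarrow> nat \<Rightarrow> (nat \<Rightarrow> 'k mat) set" where
  "mat_tuples n m = {..<m} \<rightarrow>\<^sub>E carrier_mat n n"

definition left_right_act ::
    "nat \<Rightarrow> 'k::field mat \<times> 'k mat \<Rightarrow> (nat \<Rightarrow> 'k mat) \<Rightarrow> nat \<Rightarrow> 'k mat" where
  "left_right_act m = (\<lambda>(A, B) X. \<lambda>k\<in>{..<m}. A * X k * the (mat_inverse B))"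

lemma mat_inverse_special_linear:
  assumes "B \<in> special_linear n"
  shows "the (mat_inverse B) \<in> carrier_mat n n"
    and "B * the (mat_inverse B) = 1\<^sub>m n" and "the (mat_inverse B) * B = 1\<^sub>m n"
proof -
  have B: "B \<in> carrier_mat n n" and "det B \<noteq> 0"
    using assms by (auto simp: special_linear_def)
  then have "B \<in> Units (ring_mat TYPE('a) n ())"
    by (rule det_non_zero_imp_unit)
  then obtain C where C: "mat_inverse B = Some C"
    using mat_inverse(1)[OF B, of "()"] by (cases "mat_inverse B") auto
  from mat_inverse(2)[OF B C] C
  show "the (mat_inverse B) \<in> carrier_mat n n"
    and "B * the (mat_inverse B) = 1\<^sub>m n" and "the (mat_inverse B) * B = 1\<^sub>m n"
    by auto
qed

lemma left_right_act_closed: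
  assumes "A \<in> special_linear n" "B \<in> special_linear n" "X \<in> mat_tuples n m"
  shows "left_right_act m (A, B) X \<in> mat_tuples n m"
  using assms mat_inverse_special_linear(1)[OF assms(2)]
  by (auto simp: left_right_act_def mat_tuples_def special_linear_def PiE_iff)

text \<open>The coordinate functions on \<open>V\<close> are indexed by triples \<open>(k, i, j)\<close>, the entry in row \<open>i\<close> and
  column \<open>j\<close> of the \<open>k\<close>-th matrix; a monomial is given by its exponent vector \<open>a\<close>.\<close>

definition coords :: "nat \<Rightarrow> nat \<Rightarrow> (nat \<times> nat \<times> nat) set" where
  "coords n m = {..<m} \<times> {..<n} \<times> {..<n}"

definition exponents :: "nat \<Rightarrow> nat \<Rightarrow> nat \<Rightarrow> (nat \<times> nat \<times> nat \<Rightarrow> nat) set" where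
  "exponents n m d = {a \<in> coords n m \<rightarrow>\<^sub>E UNIV. sum a (coords n m) = d}"

definition monomial_fun ::
    "nat \<Rightarrow> nat \<Rightarrow> (nat \<times> nat \<times> nat \<Rightarrow> nat) \<Rightarrow> (nat \<Rightarrow> 'k::field mat) \<Rightarrow> 'k" where
  "monomial_fun n m a X = (\<Prod>(k, i, j)\<in>coords n m. (X k $$ (i, j)) ^ a (k, i, j))"

lemma finite_exponents: "finite (exponents n m d)"
proof -
  have fin: "finite (coords n m)"
    by (simp add: coords_def)
  then have "exponents n m d \<subseteq> coords n m \<rightarrow>\<^sub>E {..d}"
    by (auto simp: exponents_def PiE_iff extensional_def intro: member_le_sum)
  then show ?thesis
    by (rule finite_subset) (simp add: fin finite_PiE)
qed

definition homogeneous_funs :: "nat \<Rightarrow> nat \<Rightarrow> nat \<Rightarrow> ((nat \<Rightarrow> 'k::field mat) \<Rightarrow> 'k) set" where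
  "homogeneous_funs n m d =
    {f. \<exists>c. f = (\<lambda>X\<in>mat_tuples n m. \<Sum>a\<in>exponents n m d. c a * monomial_fun n m a X)}"

definition polynomial_funs :: "nat \<Rightarrow> nat \<Rightarrow> ((nat \<Rightarrow> 'k::field mat) \<Rightarrow> 'k) set" where
  "polynomial_funs n m =
    {f. \<exists>g D. (\<forall>d. g d \<in> homogeneous_funs n m d) \<and>
       f = (\<lambda>X\<in>mat_tuples n m. \<Sum>d\<le>D. g d X)}"

definition invariant_ring :: "nat \<Rightarrow> nat \<Rightarrow> ((nat \<Rightarrow> 'k::field mat) \<Rightarrow> 'k) set" where
  "invariant_ring n m =
    {f \<in> polynomial_funs n m.
       \<forall>g\<in>special_linear n \<times> special_linear n. \<forall>X\<in>mat_tuples n m.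
         f (left_right_act m g X) = f X}"

definition invariants_of_degree ::
    "nat \<Rightarrow> nat \<Rightarrow> nat \<Rightarrow> ((nat \<Rightarrow> 'k::field mat) \<Rightarrow> 'k) set" where
  "invariants_of_degree n m d = invariant_ring n m \<inter> homogeneous_funs n m d"

text \<open>The subalgebra generated by \<open>S\<close>, inside the algebra of \<open>K\<close>-valued functions on the set \<open>V\<close>
  with pointwise operations.\<close>

inductive_set generated_algebra :: "'v set \<Rightarrow> ('v \<Rightarrow> 'k::field) set \<Rightarrow> ('v \<Rightarrow> 'k) set"
  for V :: "'v set" and S :: "('v \<Rightarrow> 'k) set" where
  const: "(\<lambda>X\<in>V. c) \<in> generated_algebra V S"
| gen: "f \<in> S \<Longrightarrow> f \<in> generated_algebra V S"
| add: "f \<in> generated_algebra V S \<Longrightarrow> g \<in> generated_algebra V S \<Longrightarrow>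
    (\<lambda>X\<in>V. f X + g X) \<in> generated_algebra V S"
| mult: "f \<in> generated_algebra V S \<Longrightarrow> g \<in> generated_algebra V S \<Longrightarrow>
    (\<lambda>X\<in>V. f X * g X) \<in> generated_algebra V S"

definition generated_in_degree_le :: "'k::field itself \<Rightarrow> nat \<Rightarrow> nat \<Rightarrow> nat \<Rightarrow> bool" where
  "generated_in_degree_le K n m d \<longleftrightarrow>
    generated_algebra (mat_tuples n m) (\<Union>e\<le>d. invariants_of_degree n m e) =
    (invariant_ring n m :: ((nat \<Rightarrow> 'k mat) \<Rightarrow> 'k) set)"

text \<open>If no degree bound existed, this \<open>LEAST\<close> would be an unspecified number, so an inequality
  for \<open>beta\<close> is only meaningful together with the existence of some bound.\<close>

definition beta :: "'k::field itself \<Rightarrow> nat \<Rightarrow> nat \<Rightarrow> nat" where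
  "beta K n m = (LEAST d. generated_in_degree_le K n m d)"

end

theory Submission
  imports Defs "HOL-Library.Poly_Mapping" "HOL-Library.Multiset_Order" "HOL-Combinatorics.Multiset_Permutations"
    "HOL-Library.Product_Lexorder" "HOL-Analysis.Continuum_Not_Denumerable"
    "HOL-Computational_Algebra.Fundamental_Theorem_Algebra" "Jordan_Normal_Form.Char_Poly"
begin

text \<open>
  Write \<open>R\<^sub>e\<close> for the invariants of degree \<open>e\<close> with rational coefficients, \<open>d = n\<^sup>2\<close> and \<open>\<nu> = mn\<^sup>2 = dim V\<close>.
  A blow-up determinant \<open>det (\<Sum>\<^sub>k T\<^sub>k \<otimes> X\<^sub>k)\<close> with \<open>N \<times> N\<close> matrices \<open>T\<^sub>k\<close> is an invariant of degree
  \<open>nN\<close>. The omega process for both factors writes every invariant in terms of these determinants, and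
  by the regularity lemma (the rank of such a blow-up, if maximal for its size \<open>N\<close>, is divisible by \<open>N\<close>), if they all vanish at a
  point for \<open>N = n\<close>, they vanish there for every \<open>N \<ge> n\<close>. Hence \<open>R\<^sub>d\<close> cuts out the null cone.
  Noether reduction then gives \<open>\<nu>\<close> elements of \<open>R\<^sub>d\<close> which cut out the null cone, and they generate an
  ideal that contains \<open>R\<^sub>e\<close> for \<open>e \<ge> \<nu>d\<close>: this is the Briancon--Skoda bound, proved by reduction modulo
  large primes. A Reynolds operator, here orthogonal projection for the apolar pairing, makes the
  coefficients invariant, so \<open>R\<^sub>e = \<Sum> f\<^sub>i R\<^bsub>e-d\<^esub>\<close> for \<open>e \<ge> \<nu>d = mn\<^sup>4\<close>. An invariant over \<open>K\<close> is a
  \<open>K\<close>-linear combination of rational ones.\<close>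

section \<open>Polynomials as finitely supported functions on multisets of variables\<close>

text \<open>Two demands decide where coefficients and points live. Rational coefficients make the
  apolar pairing positive definite, so that orthogonality can replace averaging for a set of maps
  closed under transposes, and they allow denominators to be cleared before reducing modulo a prime.
  Complex points are used for the Nullstellensatz, for the roots of unity in the regularity lemma
  and for n-th roots of determinants. So null cone statements concern rational polynomials at
  complex points. It matters that a single degree \<open>d\<close> cuts out the null cone: linear
  combinations of elements of \<open>R d\<close> stay in \<open>R d\<close>, so Noether reduction
  does not raise degrees. The factor \<open>card X\<close> in the bound is a pigeonhole count: a
  product of \<open>card X * q\<close> factors taken from at most \<open>card X\<close> forms
  contains a \<open>q\<close>-th power. If \<open>u\<close> has degree at least
  \<open>card X * d\<close>, then a fixed nonzero polynomial times \<open>u ^ q\<close> is a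
  combination of such products for all large \<open>q\<close>. The number of forms is bounded by the
  dimension of the whole space because their algebraic dependence is found by counting monomials in
  its coordinates.\<close>

type_synonym ('v, 'a) mpoly = "'v multiset \<Rightarrow>\<^sub>0 'a"

abbreviation coef :: "('v, 'a::zero) mpoly \<Rightarrow> 'v multiset \<Rightarrow> 'a" where
  "coef \<equiv> Poly_Mapping.lookup"
abbreviation keys :: "('v, 'a::zero) mpoly \<Rightarrow> 'v multiset set" where
  "keys \<equiv> Poly_Mapping.keys"
abbreviation mon :: "'v multiset \<Rightarrow> 'a::zero \<Rightarrow> ('v, 'a) mpoly" where
  "mon \<equiv> Poly_Mapping.single"
abbreviation Con :: "'a::zero \<Rightarrow> ('v, 'a) mpoly" where
  "Con \<equiv> Poly_Mapping.single {#}"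
abbreviation Var :: "'v \<Rightarrow> ('v, 'a::zero_neq_one) mpoly" where
  "Var v \<equiv> Poly_Mapping.single {#v#} 1"

text \<open>One function serves for evaluation in the coefficient ring or in an extension of it, for
  substitution (\<open>h = Con\<close>) and, through \<open>mapc_hom\<close>, for a change of
  coefficients.\<close>

definition ev :: "('a::comm_ring_1 \<Rightarrow> 'b::comm_ring_1) \<Rightarrow> ('v \<Rightarrow> 'b) \<Rightarrow> ('v, 'a) mpoly \<Rightarrow> 'b" where
  "ev h z p = (\<Sum>A\<in>keys p. h (coef p A) * (\<Prod>v\<in>#A. z v))"

lemma ev_superset:
  assumes "finite S" "keys p \<subseteq> S" "h 0 = 0"
  shows "ev h z p = (\<Sum>A\<in>S. h (coef p A) * (\<Prod>v\<in>#A. z v))"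
  unfolding ev_def
  by (rule sum.mono_neutral_left) (use assms in \<open>auto simp: in_keys_iff\<close>)

lemma ev_single: "h 0 = 0 \<Longrightarrow> ev h z (mon A c) = h c * (\<Prod>v\<in>#A. z v)"
  by (simp add: ev_superset[of "{A}"])

lemma ev_add:
  assumes h: "h 0 = 0" "\<And>a b. h (a + b) = h a + h b"
  shows "ev h z (p + q) = ev h z p + ev h z q"
proof -
  let ?S = "keys p \<union> keys q"
  have "ev h z (p + q) = (\<Sum>A\<in>?S. h (coef (p + q) A) * (\<Prod>v\<in>#A. z v))"
    by (rule ev_superset) (use h keys_add[of p q] in auto)
  also have "\<dots> = (\<Sum>A\<in>?S. h (coef p A) * (\<Prod>v\<in>#A. z v)) + (\<Sum>A\<in>?S. h (coef q A) * (\<Prod>v\<in>#A. z v))"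
    by (simp add: lookup_add h sum.distrib algebra_simps)
  also have "\<dots> = ev h z p + ev h z q"
    by (simp add: ev_superset[of ?S] h)
  finally show ?thesis .
qed

lemma ev_zero [simp]: "ev h z 0 = 0"
  by (simp add: ev_def)

lemma ev_sum:
  assumes h: "h 0 = 0" "\<And>a b. h (a + b) = h a + h b"
  shows "ev h z (sum f I) = (\<Sum>i\<in>I. ev h z (f i))"
  by (induction I rule: infinite_finite_induct) (auto simp: ev_add[of h, OF h])

lemma poly_expand: "p = (\<Sum>A\<in>keys p. mon A (coef p A))"
proof (rule poly_mapping_eqI)
  fix B
  have "coef (\<Sum>A\<in>keys p. mon A (coef p A)) B = (\<Sum>A\<in>keys p. if A = B then coef p A else 0)"
    by (simp add: lookup_sum lookup_single when_def)
  also have "\<dots> = coef p B"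
    by (auto simp: in_keys_iff)
  finally show "coef p B = coef (\<Sum>A\<in>keys p. mon A (coef p A)) B" by simp
qed

lemma Con_one [simp]: "Con 1 = (1 :: ('v, 'a::zero_neq_one) mpoly)"
  by (simp flip: single_one)

lemma mult_expand: "p * q = (\<Sum>A\<in>keys p. \<Sum>B\<in>keys q. mon (A + B) (coef p A * coef q B))"
  by (subst poly_expand[of p], subst poly_expand[of q]) (simp add: sum_product mult_single)

lemma ev_hom: "comm_ring_hom h \<Longrightarrow> comm_ring_hom (ev h z)"
proof -
  assume "comm_ring_hom h"
  then interpret h: comm_ring_hom h .
  have add: "ev h z (p + q) = ev h z p + ev h z q" for p q
    by (simp add: ev_add h.hom_add)
  have one: "ev h z 1 = 1"
    using ev_single[of h z "{#}" 1] by simp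
  have "ev h z (p * q) = ev h z p * ev h z q" for p q
  proof -
    have "ev h z (p * q) = (\<Sum>A\<in>keys p. \<Sum>B\<in>keys q. ev h z (mon (A + B) (coef p A * coef q B)))"
      by (subst mult_expand) (simp add: ev_sum h.hom_add)
    also have "\<dots> = (\<Sum>A\<in>keys p. \<Sum>B\<in>keys q.
        (h (coef p A) * (\<Prod>v\<in>#A. z v)) * (h (coef q B) * (\<Prod>v\<in>#B. z v)))"
      by (simp add: ev_single h.hom_mult ac_simps)
    also have "\<dots> = ev h z p * ev h z q"
      by (simp add: ev_def sum_product)
    finally show ?thesis .
  qed
  with add one show ?thesis
    by unfold_locales auto
qed

lemma hom_id: "comm_ring_hom (\<lambda>x. x)"
  by unfold_locales auto

lemma Con_hom: "comm_ring_hom (Con :: 'a::comm_ring_1 \<Rightarrow> ('v, 'a) mpoly)"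
  by unfold_locales (auto simp: single_add mult_single)

lemma ev_Con: "comm_ring_hom h \<Longrightarrow> ev h z (Con c) = h c"
proof -
  assume "comm_ring_hom h"
  then interpret h: comm_ring_hom h .
  show ?thesis by (simp add: ev_single)
qed

lemma ev_Var: "comm_ring_hom h \<Longrightarrow> ev h z (Var v) = z v"
proof -
  assume "comm_ring_hom h"
  then interpret h: comm_ring_hom h .
  show ?thesis by (simp add: ev_single)
qed

lemma hom_ev:
  assumes "comm_ring_hom g"
  shows "g (ev h z p) = ev (\<lambda>c. g (h c)) (\<lambda>v. g (z v)) p"
proof -
  interpret g: comm_ring_hom g by fact
  show ?thesis
    unfolding ev_def by (simp add: g.hom_sum g.hom_mult g.hom_prod_mset image_mset.compositionality comp_def)
qed

lemma ev_cong: "(\<And>A v. A \<in> keys p \<Longrightarrow> v \<in># A \<Longrightarrow> z v = z' v) \<Longrightarrow> ev h z p = ev h z' p"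
  unfolding ev_def by (intro sum.cong refl arg_cong2[where f = "(*)"] arg_cong[where f = prod_mset] image_mset_cong) auto

section \<open>Substitution and change of coefficients\<close>

definition sbst :: "('v \<Rightarrow> ('w, 'a::comm_ring_1) mpoly) \<Rightarrow> ('v, 'a) mpoly \<Rightarrow> ('w, 'a) mpoly" where
  "sbst = ev Con"

lemma sbst_hom: "comm_ring_hom (sbst s)"
  unfolding sbst_def by (rule ev_hom, rule Con_hom)

lemma ev_sbst:
  assumes "comm_ring_hom h"
  shows "ev h z (sbst s p) = ev h (\<lambda>v. ev h z (s v)) p"
proof -
  have "ev h z (sbst s p) = ev (\<lambda>c. ev h z (Con c)) (\<lambda>v. ev h z (s v)) p"
    unfolding sbst_def by (rule hom_ev[OF ev_hom[OF assms]])
  then show ?thesis using assms by (simp add: ev_Con)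
qed

text \<open>Besides ring homomorphisms, \<open>h\<close> will be a rational linear functional on a
  field, a rounding of rationals to integers or a division by a prime. All of these fix 0.\<close>

definition mapc :: "('a::zero \<Rightarrow> 'b::comm_monoid_add) \<Rightarrow> ('v, 'a) mpoly \<Rightarrow> ('v, 'b) mpoly" where
  "mapc h p = (\<Sum>A\<in>keys p. mon A (h (coef p A)))"

lemma coef_mapc: "h 0 = 0 \<Longrightarrow> coef (mapc h p) A = h (coef p A)"
proof -
  assume h: "h 0 = 0"
  have "coef (mapc h p) A = (\<Sum>B\<in>keys p. if B = A then h (coef p B) else 0)"
    by (simp add: mapc_def lookup_sum lookup_single when_def)
  also have "\<dots> = h (coef p A)" using h by (auto simp: in_keys_iff)
  finally show ?thesis .
qed

lemma keys_mapc: "h 0 = 0 \<Longrightarrow> keys (mapc h p) \<subseteq> keys p"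
  by (auto simp: in_keys_iff coef_mapc)

lemma mapc_hom: 
  fixes h :: "'a::comm_ring_1 \<Rightarrow> 'b::comm_ring_1"
  assumes "comm_ring_hom h"
  shows "comm_ring_hom (mapc h :: ('v, 'a) mpoly \<Rightarrow> _)"
proof -
  interpret h: comm_ring_hom h by fact
  have "mapc h = (ev (\<lambda>c. Con (h c)) Var :: ('v, 'a) mpoly \<Rightarrow> _)"
  proof
    fix p :: "('v, 'a) mpoly"
    have "(\<Prod>v\<in>#A. Var v) = mon A (1::'b)" for A :: "'v multiset"
      by (induction A) (auto simp: mult_single)
    then show "mapc h p = ev (\<lambda>c. Con (h c)) Var p"
      unfolding mapc_def ev_def by (simp add: mult_single)
  qed
  moreover have "comm_ring_hom (\<lambda>c. Con (h c) :: ('v, 'b) mpoly)"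
    by unfold_locales (auto simp: single_add mult_single h.hom_add h.hom_mult)
  ultimately show ?thesis by (simp add: ev_hom)
qed

lemma ev_mapc: 
  assumes "h 0 = 0" "g 0 = 0"
  shows "ev g z (mapc h p) = ev (\<lambda>c. g (h c)) z p"
proof -
  have "ev g z (mapc h p) = (\<Sum>A\<in>keys p. g (coef (mapc h p) A) * (\<Prod>v\<in>#A. z v))"
    by (rule ev_superset) (use assms keys_mapc in auto)
  then show ?thesis using assms by (simp add: coef_mapc ev_def)
qed

section \<open>Homogeneous forms\<close>

definition Mon :: "'v set \<Rightarrow> nat \<Rightarrow> 'v multiset set" where
  "Mon X e = {A. set_mset A \<subseteq> X \<and> size A = e}"

lemma finite_Mon: "finite X \<Longrightarrow> finite (Mon X e)"
proof -
  assume "finite X"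
  then have "finite (mset ` {xs. set xs \<subseteq> X \<and> length xs = e})"
    by (intro finite_imageI finite_lists_length_eq)
  moreover have "Mon X e \<subseteq> mset ` {xs. set xs \<subseteq> X \<and> length xs = e}"
  proof
    fix A assume "A \<in> Mon X e"
    then show "A \<in> mset ` {xs. set xs \<subseteq> X \<and> length xs = e}"
      using ex_mset[of A] by (force simp: Mon_def)
  qed
  ultimately show ?thesis by (rule finite_subset[rotated])
qed

definition Form :: "'v set \<Rightarrow> nat \<Rightarrow> ('v, 'a::zero) mpoly set" where
  "Form X e = {p. keys p \<subseteq> Mon X e}"

lemma Form_zero [simp]: "0 \<in> Form X e"
  by (simp add: Form_def)

lemma Form_add: "p \<in> Form X e \<Longrightarrow> q \<in> Form X e \<Longrightarrow> p + q \<in> Form X e"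
  for p q :: "('v, 'a::comm_monoid_add) mpoly"
  using keys_add[of p q] by (auto simp: Form_def)

lemma Form_sum: "(\<And>i. i \<in> I \<Longrightarrow> f i \<in> Form X e) \<Longrightarrow> sum f I \<in> Form X e"
  by (induction I rule: infinite_finite_induct) (auto intro: Form_add)

lemma Form_single: "A \<in> Mon X e \<Longrightarrow> mon A c \<in> Form X e"
  by (auto simp: Form_def)

lemma Mon_add: "A \<in> Mon X d \<Longrightarrow> B \<in> Mon X e \<Longrightarrow> A + B \<in> Mon X (d + e)"
  by (auto simp: Mon_def)

lemma Form_mult: "p \<in> Form X d \<Longrightarrow> q \<in> Form X e \<Longrightarrow> p * q \<in> Form X (d + e)"
  for p q :: "('v, 'a::comm_ring_1) mpoly"
  unfolding mult_expand[of p q]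
  by (intro Form_sum Form_single Mon_add) (auto simp: Form_def)

lemma Form_Con: "Con c \<in> Form X 0"
  by (rule Form_single) (simp add: Mon_def)

lemma Form_one: "(1 :: ('v, 'a::comm_ring_1) mpoly) \<in> Form X 0"
  using Form_Con[of "1::'a" X] by simp

lemma Form_Con_mult: "p \<in> Form X e \<Longrightarrow> Con c * p \<in> Form X e"
  for p :: "('v, 'a::comm_ring_1) mpoly"
  using Form_mult[OF Form_Con, of p X e c] by simp

lemma Form_uminus: "p \<in> Form X e \<Longrightarrow> - p \<in> Form X e"
  for p :: "('v, 'a::comm_ring_1) mpoly"
  by (simp add: Form_def)

lemma Form_diff: "p \<in> Form X e \<Longrightarrow> q \<in> Form X e \<Longrightarrow> p - q \<in> Form X e"
  for p q :: "('v, 'a::comm_ring_1) mpoly"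
  using Form_add[of p X e "- q"] Form_uminus[of q] by simp

lemma Form_power: "p \<in> Form X e \<Longrightarrow> p ^ k \<in> Form X (k * e)"
  for p :: "('v, 'a::comm_ring_1) mpoly"
  by (induction k) (auto intro: Form_one Form_mult)

lemma Form_prod: "finite I \<Longrightarrow> (\<And>i. i \<in> I \<Longrightarrow> f i \<in> Form X (e i)) \<Longrightarrow> prod f I \<in> Form X (sum e I)"
  for f :: "'i \<Rightarrow> ('v, 'a::comm_ring_1) mpoly"
  by (induction I rule: finite_induct) (auto intro: Form_one Form_mult)

lemma Form_Var: "v \<in> X \<Longrightarrow> Var v \<in> Form X 1"
  by (rule Form_single) (simp add: Mon_def)

lemma Form_prod_mset: "(\<And>i. i \<in># I \<Longrightarrow> f i \<in> Form X (e i)) \<Longrightarrow> (\<Prod>i\<in>#I. f i) \<in> Form X (\<Sum>i\<in>#I. e i)"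
  for f :: "'i \<Rightarrow> ('v, 'a::comm_ring_1) mpoly"
  by (induction I) (auto intro: Form_one Form_mult)

lemma Form_sbst:
  assumes p: "p \<in> Form X e" and s: "\<And>v. v \<in> X \<Longrightarrow> s v \<in> Form Y d"
  shows "sbst s p \<in> Form Y (e * d)"
  unfolding sbst_def ev_def
proof (intro Form_sum Form_Con_mult)
  fix A assume "A \<in> keys p"
  then have A: "set_mset A \<subseteq> X" "size A = e"
    using p by (auto simp: Form_def Mon_def)
  have "(\<Prod>v\<in>#A. s v) \<in> Form Y (\<Sum>v\<in>#A. d)"
    by (rule Form_prod_mset) (use A s in auto)
  then show "(\<Prod>v\<in>#A. s v) \<in> Form Y (e * d)" using A by simp
qed

lemma ev_Form_scale:
  assumes p: "p \<in> Form X e" and h: "comm_ring_hom h"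
  shows "ev h (\<lambda>v. c * z v) p = c ^ e * ev h z p"
proof -
  have *: "(\<Prod>v\<in>#A. c * z v) = c ^ size A * (\<Prod>v\<in>#A. z v)" for A
    by (induction A) auto
  show ?thesis
    unfolding ev_def sum_distrib_left
    by (intro sum.cong refl) (use p in \<open>auto simp: Form_def Mon_def * mult_ac\<close>)
qed

text \<open>With \<open>S = Mon X e\<close> this is the homogeneous component of degree
  \<open>e\<close> in the variables \<open>X\<close>.\<close>

definition restr :: "'v multiset set \<Rightarrow> ('v, 'a::comm_monoid_add) mpoly \<Rightarrow> ('v, 'a) mpoly" where
  "restr S p = (\<Sum>A\<in>keys p \<inter> S. mon A (coef p A))"

lemma coef_restr: "coef (restr S p) A = (if A \<in> S then coef p A else 0)"
proof -
  have "coef (restr S p) A = (\<Sum>B\<in>keys p \<inter> S. if B = A then coef p B else 0)"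
    by (simp add: restr_def lookup_sum lookup_single when_def)
  also have "\<dots> = (if A \<in> S then coef p A else 0)" by (auto simp: in_keys_iff)
  finally show ?thesis .
qed

lemma keys_restr: "keys (restr S p) = keys p \<inter> S"
  by (auto simp: in_keys_iff coef_restr split: if_splits)

lemma restr_Form: "restr (Mon X e) p \<in> Form X e"
  by (auto simp: Form_def keys_restr)

lemma restr_sum: "restr S (sum f I) = (\<Sum>i\<in>I. restr S (f i))"
  by (rule poly_mapping_eqI) (auto simp: coef_restr lookup_sum)

subsection \<open>Vanishing at all points\<close>

text \<open>Uniqueness of base \<open>B\<close> expansions, which makes the Kronecker substitution
  below injective on monomials.\<close>

lemma digits_unique:
  fixes a b :: "nat \<Rightarrow> nat"
  assumes "\<And>i. i < k \<Longrightarrow> a i < B" "\<And>i. i < k \<Longrightarrow> b i < B"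
    and "(\<Sum>i<k. a i * B ^ i) = (\<Sum>i<k. b i * B ^ i)" and "i < k"
  shows "a i = b i"
  using assms
proof (induction k arbitrary: a b i)
  case (Suc k)
  have *: "(\<Sum>i<Suc k. c i * B ^ i) = c 0 + B * (\<Sum>i<k. c (Suc i) * B ^ i)" for c :: "nat \<Rightarrow> nat"
    by (subst sum.lessThan_Suc_shift) (simp add: sum_distrib_left mult_ac)
  have lt: "a 0 < B" "b 0 < B" using Suc.prems by auto
  have eq: "a 0 + B * (\<Sum>i<k. a (Suc i) * B ^ i) = b 0 + B * (\<Sum>i<k. b (Suc i) * B ^ i)"
    using Suc.prems(3) unfolding * .
  have 0: "a 0 = b 0"
    using arg_cong[OF eq, of "\<lambda>x. x mod B"] lt by simp
  with eq lt have eq': "(\<Sum>i<k. a (Suc i) * B ^ i) = (\<Sum>i<k. b (Suc i) * B ^ i)"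
    by simp
  have "a (Suc j) = b (Suc j)" if "j < k" for j
    by (rule Suc.IH[of "\<lambda>i. a (Suc i)" "\<lambda>i. b (Suc i)"]) (use Suc.prems eq' that in auto)
  with 0 show ?case using \<open>i < Suc k\<close> by (cases i) auto
qed auto

lemma sum_mset_count:
  fixes f :: "'v \<Rightarrow> nat"
  assumes "finite X" "set_mset A \<subseteq> X"
  shows "(\<Sum>v\<in>#A. f v) = (\<Sum>v\<in>X. count A v * f v)"
  using assms(2)
proof (induction A)
  case (add x A)
  have "(\<Sum>v\<in>X. count (add_mset x A) v * f v) = (\<Sum>v\<in>X. (if v = x then f v else 0) + count A v * f v)"
    by (intro sum.cong) auto
  also have "\<dots> = f x + (\<Sum>v\<in>X. count A v * f v)"
    using add.prems assms(1) by (simp add: sum.distrib)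
  finally show ?case using add by simp
qed auto

text \<open>Kronecker substitution reduces the multivariate case to the univariate one.\<close>

lemma zero_test:
  fixes p :: "('v, 'a::{idom, ring_char_0}) mpoly"
  assumes van: "\<And>z. (\<And>v. z v \<in> \<nat>) \<Longrightarrow> ev (\<lambda>c. c) z p = 0"
  shows "p = 0"
proof -
  define X where "X = (\<Union>A\<in>keys p. set_mset A)"
  have "finite X" unfolding X_def by auto
  then obtain idx :: "'v \<Rightarrow> nat" where idx: "bij_betw idx X {..<card X}"
    using ex_bij_betw_finite_nat[of X] by (auto simp: atLeast0LessThan)
  \<comment> \<open>Replacing variable number \<open>i\<close> by \<open>t ^ (B ^ i)\<close> turns
    the monomial \<open>A\<close> into \<open>t ^ ka A\<close>. All exponents are below
    \<open>B\<close>, so they are the base \<open>B\<close> digits of \<open>ka A\<close>.\<close>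
  define B where "B = Suc (Max (insert 0 (size ` keys p)))"
  have szB: "size A < B" if "A \<in> keys p" for A
    unfolding B_def using that by (auto simp: less_Suc_eq_le)
  define ka where "ka A = (\<Sum>v\<in>#A. B ^ idx v)" for A :: "'v multiset"
  have ka: "ka A = (\<Sum>i<card X. count A (the_inv_into X idx i) * B ^ i)" if "A \<in> keys p" for A
  proof -
    have "ka A = (\<Sum>v\<in>X. count A v * B ^ idx v)"
      unfolding ka_def by (rule sum_mset_count) (use \<open>finite X\<close> that in \<open>auto simp: X_def\<close>)
    also have "\<dots> = (\<Sum>v\<in>X. count A (the_inv_into X idx (idx v)) * B ^ idx v)"
      by (intro sum.cong refl) (simp add: the_inv_into_f_f[OF bij_betw_imp_inj_on[OF idx]])
    also have "\<dots> = (\<Sum>i<card X. count A (the_inv_into X idx i) * B ^ i)"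
      by (rule sum.reindex_bij_betw[OF idx])
    finally show ?thesis .
  qed
  have inj: "inj_on ka (keys p)"
  proof
    fix A C assume A: "A \<in> keys p" and C: "C \<in> keys p" and eq: "ka A = ka C"
    have cnt: "count A v < B" "count C v < B" for v
      using szB[OF A] szB[OF C] count_le_size[of A v] count_le_size[of C v] by linarith+
    show "A = C"
    proof (rule multiset_eqI)
      fix v
      show "count A v = count C v"
      proof (cases "v \<in> X")
        case True
        then have i: "idx v < card X" and v: "the_inv_into X idx (idx v) = v"
          using idx by (auto simp: bij_betw_def the_inv_into_f_f)
        show ?thesis
          using digits_unique[OF cnt(1) cnt(2) eq[unfolded ka[OF A] ka[OF C]] i] v by simp
      next
        case False
        then show ?thesis using A C by (auto simp: X_def not_in_iff)
      qed
    qed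
  qed
  define q where "q = (\<Sum>A\<in>keys p. monom (coef p A) (ka A))"
  have root: "poly q (of_nat t) = 0" for t
  proof -
    have prod: "(\<Prod>v\<in>#A. (of_nat t :: 'a) ^ (B ^ idx v)) = of_nat t ^ ka A" for A
      by (induction A) (auto simp: ka_def power_add)
    have "ev (\<lambda>c. c) (\<lambda>v. of_nat t ^ (B ^ idx v)) p = 0"
      by (rule van) (metis of_nat_in_Nats of_nat_power)
    then show ?thesis
      by (simp add: ev_def prod q_def poly_sum poly_monom)
  qed
  have inf: "infinite (range (of_nat :: nat \<Rightarrow> 'a))"
    by (rule range_inj_infinite) (auto simp: inj_on_def)
  have "range (of_nat :: nat \<Rightarrow> 'a) \<subseteq> {x. poly q x = 0}"
    using root by auto
  then have "q = 0"
    using poly_roots_finite inf finite_subset by metis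
  show "p = 0"
  proof (rule poly_mapping_eqI)
    fix A
    show "coef p A = coef 0 A"
    proof (cases "A \<in> keys p")
      case True
      have "coeff q (ka A) = (\<Sum>C\<in>keys p. if C = A then coef p C else 0)"
        unfolding q_def coeff_sum
        by (intro sum.cong refl) (use inj True in \<open>auto simp: inj_on_def\<close>)
      with True \<open>q = 0\<close> show ?thesis by simp
    qed (simp add: in_keys_iff)
  qed
qed

section \<open>The apolar pairing and invariants\<close>

interpretation mp: vector_space "\<lambda>c p. Con c * (p :: ('v, 'a::field) mpoly)"
proof unfold_locales
  fix a b :: 'a and x y :: "('v, 'a) mpoly"
  show "Con a * (x + y) = Con a * x + Con a * y" by (rule distrib_left)
  show "Con (a + b) * x = Con a * x + Con b * x" by (simp add: single_add distrib_right)
  show "Con a * (Con b * x) = Con (a * b) * x" by (simp add: mult_single flip: mult.assoc)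
  show "Con 1 * x = x" by simp
qed

text \<open>The ring as a module over itself: \<open>idl.span\<close> is the generated ideal and
  \<open>idl.subspace\<close> means being an ideal.\<close>

interpretation idl: Modules.module "(*) :: 'a::comm_ring_1 \<Rightarrow> 'a \<Rightarrow> 'a"
  by unfold_locales (auto simp: algebra_simps)

declare idl.scale_scale [simp del] mp.scale_scale [simp del]

definition mfact :: "'v multiset \<Rightarrow> nat" where
  "mfact A = (\<Prod>v\<in>set_mset A. fact (count A v))"

lemma mfact_pos: "mfact A > 0"
  unfolding mfact_def by (rule prod_pos) auto

lemma mfact_nonzero [simp]: "mfact A \<noteq> 0"
  using mfact_pos[of A] by simp

text \<open>This is \<open>p\<close>, read as a differential operator, applied to \<open>q\<close>
  and evaluated at 0. The weight \<open>mfact A\<close> comes from differentiating monomials, and it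
  is what makes transposed substitutions adjoint in \<open>pair_sbst\<close>.\<close>

definition pair :: "('v, 'a::comm_ring_1) mpoly \<Rightarrow> ('v, 'a) mpoly \<Rightarrow> 'a" where
  "pair p q = (\<Sum>A\<in>keys p. of_nat (mfact A) * coef p A * coef q A)"

lemma pair_superset:
  "finite S \<Longrightarrow> keys p \<subseteq> S \<Longrightarrow> pair p q = (\<Sum>A\<in>S. of_nat (mfact A) * coef p A * coef q A)"
  unfolding pair_def by (rule sum.mono_neutral_left) (auto simp: in_keys_iff)

lemma pair_commute: "pair p q = pair q p"
proof -
  have "pair p q = (\<Sum>A\<in>keys p \<union> keys q. of_nat (mfact A) * coef p A * coef q A)"
    by (rule pair_superset) auto
  also have "\<dots> = (\<Sum>A\<in>keys p \<union> keys q. of_nat (mfact A) * coef q A * coef p A)"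
    by (intro sum.cong refl) (simp only: mult.assoc mult.commute mult.left_commute)
  also have "\<dots> = pair q p"
    by (rule pair_superset[symmetric]) auto
  finally show ?thesis .
qed

lemma pair_add_left: "pair (p + p') q = pair p q + pair p' q"
proof -
  let ?S = "keys p \<union> keys p'"
  have "pair (p + p') q = (\<Sum>A\<in>?S. of_nat (mfact A) * coef (p + p') A * coef q A)"
    by (rule pair_superset) (use keys_add[of p p'] in auto)
  also have "\<dots> = (\<Sum>A\<in>?S. of_nat (mfact A) * coef p A * coef q A) + (\<Sum>A\<in>?S. of_nat (mfact A) * coef p' A * coef q A)"
    by (simp add: lookup_add algebra_simps sum.distrib)
  also have "\<dots> = pair p q + pair p' q"
    by (intro arg_cong2[where f = "(+)"] pair_superset[symmetric]) auto
  finally show ?thesis .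
qed

lemma pair_add_right: "pair q (p + p') = pair q p + pair q p'"
  by (simp only: pair_commute[of q] pair_add_left)

lemma pair_zero [simp]: "pair 0 q = 0" "pair q 0 = 0"
  by (auto simp: pair_def)

lemma coef_Con_mult: "coef (Con c * p) A = c * coef p A"
  for p :: "('v, 'a::comm_ring_1) mpoly"
proof -
  have "coef (Con c * p) A = coef (\<Sum>B\<in>keys p. mon B (c * coef p B)) A"
    by (subst (1) poly_expand[of p]) (simp add: sum_distrib_left mult_single)
  also have "\<dots> = (\<Sum>B\<in>keys p. if B = A then c * coef p B else 0)"
    by (simp add: lookup_sum lookup_single when_def)
  also have "\<dots> = c * coef p A" by (auto simp: in_keys_iff)
  finally show ?thesis .
qed

lemma pair_Con_right: "pair q (Con c * p) = c * pair q p"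
  unfolding pair_def coef_Con_mult sum_distrib_left by (intro sum.cong refl) (simp only: mult_ac)

lemma pair_Con_left: "pair (Con c * p) q = c * pair p q"
  by (simp only: pair_commute[of _ q] pair_Con_right)

lemma pair_uminus_right: "pair q (- p) = - pair q p"
  by (simp add: pair_def sum_negf)

lemma pair_diff_right: "pair q (p - p') = pair q p - pair q p'"
  using pair_add_right[of q p "- p'"] pair_uminus_right[of q p'] by simp

lemma pair_sum_left: "pair (sum f I) q = (\<Sum>i\<in>I. pair (f i) q)"
  by (induction I rule: infinite_finite_induct) (auto simp: pair_add_left)

lemma pair_single_left: "pair (mon A c) q = of_nat (mfact A) * c * coef q A"
  by (simp add: pair_superset[of "{A}"])

text \<open>A sum of squares with positive weights. This is the point where an ordered coefficient
  field is used.\<close>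

lemma pair_pos:
  fixes p :: "('v, rat) mpoly"
  assumes "pair p p = 0"
  shows "p = 0"
proof (rule ccontr)
  assume "p \<noteq> 0"
  then obtain A where A: "A \<in> keys p" by (metis keys_eq_empty ex_in_conv)
  have "0 < of_nat (mfact A) * coef p A * coef p A"
    using A mfact_pos[of A] by (auto simp: in_keys_iff mult.assoc zero_less_mult_iff linorder_neq_iff)
  also have "\<dots> \<le> pair p p"
    unfolding pair_def
    by (rule member_le_sum) (use A in \<open>auto simp: mult.assoc zero_le_mult_iff\<close>)
  finally show False using assms by simp
qed

lemma pair_span:
  assumes "\<And>b. b \<in> B \<Longrightarrow> pair b u = 0" "x \<in> mp.span B"
  shows "pair x u = 0"
  using assms(2)
  by (induction rule: mp.span_induct_alt) (auto simp: pair_add_left pair_Con_left assms(1))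

text \<open>Gram--Schmidt, one generator at a time. A generator that depends on the earlier ones
  gives \<open>v' = 0\<close>; then \<open>c\<close> is 0 and \<open>u = fu\<close>.\<close>

lemma orth_decomp:
  fixes f :: "('v, rat) mpoly"
  assumes "finite B"
  shows "\<exists>u\<in>mp.span B. \<forall>b\<in>B. pair b (f - u) = 0"
  using assms
proof (induction B arbitrary: f rule: finite_induct)
  case empty
  show ?case by (auto intro: bexI[of _ 0])
next
  case (insert v B)
  obtain vu where vu: "vu \<in> mp.span B" "\<forall>b\<in>B. pair b (v - vu) = 0" using insert.IH by blast
  obtain fu where fu: "fu \<in> mp.span B" "\<forall>b\<in>B. pair b (f - fu) = 0" using insert.IH by blast
  define v' where "v' = v - vu"
  define c where "c = pair v' (f - fu) / pair v' v'"
  define u where "u = fu + Con c * v'"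
  have sub: "mp.span B \<subseteq> mp.span (insert v B)" by (rule mp.span_mono) auto
  have v'span: "v' \<in> mp.span (insert v B)"
    unfolding v'_def using sub vu(1) by (auto intro: mp.span_diff mp.span_base)
  have uspan: "u \<in> mp.span (insert v B)"
    unfolding u_def using sub fu(1) v'span by (auto intro!: mp.span_add mp.span_scale)
  have fu_eq: "f - u = (f - fu) - Con c * v'" by (simp add: u_def)
  have B: "pair b (f - u) = 0" if "b \<in> B" for b
    using fu(2) vu(2) that unfolding fu_eq v'_def[symmetric] by (simp add: pair_diff_right pair_Con_right)
  have "pair vu (f - u) = 0" by (rule pair_span[OF B vu(1)])
  moreover have "pair v' (f - u) = 0"
  proof (cases "v' = 0")
    case False
    then have "pair v' v' \<noteq> 0" using pair_pos by blast
    then show ?thesis unfolding fu_eq by (simp add: pair_diff_right[of v' "f - fu"] pair_Con_right c_def)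
  qed simp
  ultimately have "pair v (f - u) = 0"
    using pair_add_left[of vu v' "f - u"] by (simp add: v'_def)
  with B uspan show ?case by blast
qed

text \<open>A maximal independent subset is no larger than the set of monomials of degree
  \<open>e\<close>. This makes \<open>orth_decomp\<close> applicable to any space of forms.\<close>

lemma finite_spanning_set:
  fixes W :: "('v, 'a::field) mpoly set"
  assumes X: "finite X" and W: "W \<subseteq> Form X e"
  obtains B where "finite B" "B \<subseteq> W" "W \<subseteq> mp.span B"
proof -
  obtain B where B: "B \<subseteq> W" "mp.independent B" "W \<subseteq> mp.span B"
    using mp.maximal_independent_subset[of W] by blast
  have "p \<in> mp.span ((\<lambda>A. mon A 1) ` Mon X e)" if "p \<in> Form X e" for p :: "('v, 'a) mpoly"
  proof (subst poly_expand[of p], rule mp.span_sum)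
    fix A assume "A \<in> keys p"
    then have "A \<in> Mon X e" using that by (auto simp: Form_def)
    then have "Con (coef p A) * mon A 1 \<in> mp.span ((\<lambda>A. mon A 1) ` Mon X e)"
      by (intro mp.span_scale mp.span_base) auto
    then show "mon A (coef p A) \<in> mp.span ((\<lambda>A. mon A 1) ` Mon X e)"
      by (simp add: mult_single)
  qed
  then have "finite B"
    using mp.independent_span_bound[of "(\<lambda>A. mon A 1) ` Mon X e" B] B W finite_Mon[OF X, of e] by blast
  with B that show thesis by blast
qed

subsection \<open>Powers of linear forms\<close>

definition lin :: "'v set \<Rightarrow> ('v \<Rightarrow> 'a) \<Rightarrow> ('v, 'a::comm_ring_1) mpoly" where
  "lin X y = (\<Sum>v\<in>X. mon {#v#} (y v))"

lemma lin_Form: "lin X y \<in> Form X 1"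
  unfolding lin_def by (intro Form_sum Form_single) (auto simp: Mon_def)

lemma ev_lin: "comm_ring_hom h \<Longrightarrow> ev h z (lin X y) = (\<Sum>v\<in>X. h (y v) * z v)"
proof -
  assume "comm_ring_hom h"
  then interpret h: comm_ring_hom h .
  interpret e: comm_ring_hom "ev h z" by (rule ev_hom) fact
  show ?thesis by (simp add: lin_def e.hom_sum ev_single)
qed

lemma lin_power:
  assumes "finite X"
  shows "lin X y ^ e = (\<Sum>xs | set xs \<subseteq> X \<and> length xs = e. mon (mset xs) (\<Prod>v\<leftarrow>xs. y v))"
proof (induction e)
  case 0
  have "{xs. set xs \<subseteq> X \<and> length xs = 0} = {[]}" by auto
  then show ?case by simp
next
  case (Suc e)
  let ?L = "\<lambda>e. {xs. set xs \<subseteq> X \<and> length xs = e}"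
  have L: "?L (Suc e) = (\<lambda>(x, xs). x # xs) ` (X \<times> ?L e)"
    by (auto simp: length_Suc_conv)
  have "lin X y ^ Suc e = (\<Sum>x\<in>X. \<Sum>xs\<in>?L e. mon (mset (x # xs)) (\<Prod>v\<leftarrow>x # xs. y v))"
    unfolding power_Suc Suc unfolding lin_def by (simp add: sum_product mult_single)
  also have "\<dots> = (\<Sum>(x, xs)\<in>X \<times> ?L e. mon (mset (x # xs)) (\<Prod>v\<leftarrow>x # xs. y v))"
    by (rule sum.cartesian_product)
  also have "\<dots> = (\<Sum>xs\<in>?L (Suc e). mon (mset xs) (\<Prod>v\<leftarrow>xs. y v))"
    unfolding L by (subst sum.reindex) (auto simp: inj_on_def case_prod_unfold)
  finally show ?case .
qed

text \<open>Multinomial theorem: the words with content \<open>A\<close> number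
  \<open>fact e\<close> divided by \<open>mfact A\<close>.\<close>

lemma coef_lin_power:
  assumes X: "finite X" and A: "A \<in> Mon X e"
  shows "of_nat (mfact A) * coef (lin X y ^ e) A = of_nat (fact e) * (\<Prod>v\<in>#A. y v)"
proof -
  let ?L = "{xs. set xs \<subseteq> X \<and> length xs = e}"
  have "coef (lin X y ^ e) A = (\<Sum>xs\<in>?L. (\<Prod>v\<leftarrow>xs. y v) when mset xs = A)"
    by (simp add: lin_power[OF X] lookup_sum lookup_single)
  also have "\<dots> = (\<Sum>xs\<in>?L. if mset xs = A then \<Prod>v\<in>#A. y v else 0)"
    by (intro sum.cong refl) (auto simp: when_def simp flip: prod_mset_prod_list)
  also have "\<dots> = of_nat (card {xs\<in>?L. mset xs = A}) * (\<Prod>v\<in>#A. y v)"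
    by (subst sum.If_cases) (auto simp: finite_lists_length_eq[OF X] Int_def)
  also have "{xs\<in>?L. mset xs = A} = permutations_of_multiset A"
    using A by (auto simp: permutations_of_multiset_def Mon_def)
  finally have "of_nat (mfact A) * coef (lin X y ^ e) A =
      of_nat (card (permutations_of_multiset A) * mfact A) * (\<Prod>v\<in>#A. y v)"
    by (simp add: mult_ac)
  also have "card (permutations_of_multiset A) * mfact A = fact e"
    using A card_permutations_of_multiset_aux[of A] by (simp add: mfact_def Mon_def)
  finally show ?thesis by simp
qed

text \<open>The multinomial coefficients cancel the weights of the pairing. Powers of linear forms
  thus represent point evaluations, on which the next two results rest.\<close>

lemma pair_lin_power:
  assumes X: "finite X" and h: "h \<in> Form X e"
  shows "pair (lin X y ^ e) h = of_nat (fact e) * ev (\<lambda>c. c) y h"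
proof -
  have "pair (lin X y ^ e) h = pair h (lin X y ^ e)" by (rule pair_commute)
  also have "\<dots> = (\<Sum>A\<in>keys h. coef h A * (of_nat (mfact A) * coef (lin X y ^ e) A))"
    by (simp add: pair_def mult_ac)
  also have "\<dots> = (\<Sum>A\<in>keys h. coef h A * (of_nat (fact e) * (\<Prod>v\<in>#A. y v)))"
    by (intro sum.cong refl arg_cong2[where f = "(*)"] coef_lin_power[OF X]) (use h in \<open>auto simp: Form_def\<close>)
  also have "\<dots> = of_nat (fact e) * ev (\<lambda>c. c) y h"
    by (simp add: ev_def sum_distrib_left mult_ac)
  finally show ?thesis .
qed

text \<open>The part of \<open>f\<close> orthogonal to all these powers vanishes at every point by
  \<open>pair_lin_power\<close>, hence is 0.\<close>

lemma powers_span: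
  fixes f :: "('v, rat) mpoly"
  assumes X: "finite X" and f: "f \<in> Form X e"
  shows "f \<in> mp.span (range (\<lambda>y. lin X y ^ e))"
proof -
  let ?P = "range (\<lambda>y. lin X y ^ e) :: ('v, rat) mpoly set"
  have P: "?P \<subseteq> Form X e" using Form_power[OF lin_Form, of X _ e] by auto
  obtain B where B: "finite B" "B \<subseteq> ?P" "?P \<subseteq> mp.span B"
    using finite_spanning_set[OF X P] by blast
  obtain u where u: "u \<in> mp.span B" "\<forall>b\<in>B. pair b (f - u) = 0"
    using orth_decomp[OF B(1)] by blast
  have uP: "u \<in> mp.span ?P" using u(1) mp.span_mono[OF B(2)] by blast
  have "u \<in> Form X e"
    using uP by (induction rule: mp.span_induct_alt) (use P in \<open>auto intro!: Form_add Form_Con_mult\<close>)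
  then have fu: "f - u \<in> Form X e" using f by (rule Form_diff[rotated])
  have "ev (\<lambda>c. c) y (f - u) = 0" for y
  proof -
    have "pair (lin X y ^ e) (f - u) = 0"
      by (rule pair_span[of B]) (use u B in auto)
    then show ?thesis using pair_lin_power[OF X fu] by simp
  qed
  then have "f - u = 0" by (intro zero_test)
  with uP show ?thesis by simp
qed

definition linsub :: "'v set \<Rightarrow> ('v \<Rightarrow> 'v \<Rightarrow> 'a) \<Rightarrow> 'v \<Rightarrow> ('v, 'a::comm_ring_1) mpoly" where
  "linsub X M v = lin X (M v)"

lemma sbst_linsub_Form: "p \<in> Form X e \<Longrightarrow> sbst (linsub X M) p \<in> Form X e"
  using Form_sbst[of p X e "linsub X M" X 1] lin_Form by (auto simp: linsub_def)

text \<open>By \<open>powers_span\<close> it is enough to take a power of a linear form for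
  \<open>p\<close>; then both sides evaluate \<open>q\<close> at the transformed coefficient
  vector.\<close>

lemma pair_sbst:
  fixes p q :: "('v, rat) mpoly"
  assumes X: "finite X" and p: "p \<in> Form X e" and q: "q \<in> Form X e"
  shows "pair (sbst (linsub X M) p) q = pair p (sbst (linsub X (\<lambda>v w. M w v)) q)"
proof -
  interpret s: comm_ring_hom "sbst (linsub X M)" by (rule sbst_hom)
  have pow: "pair (sbst (linsub X M) (lin X y ^ e)) q = pair (lin X y ^ e) (sbst (linsub X (\<lambda>v w. M w v)) q)" for y
  proof -
    have "sbst (linsub X M) (lin X y) = (\<Sum>v\<in>X. \<Sum>w\<in>X. mon {#w#} (y v * M v w))"
      by (simp add: sbst_def ev_lin[OF Con_hom] linsub_def) (simp add: lin_def sum_distrib_left mult_single)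
    also have "\<dots> = (\<Sum>w\<in>X. \<Sum>v\<in>X. mon {#w#} (y v * M v w))" by (rule sum.swap)
    also have "\<dots> = lin X (\<lambda>w. \<Sum>v\<in>X. y v * M v w)"
      unfolding lin_def
      by (intro sum.cong refl) (simp add: poly_mapping_eq_iff fun_eq_iff lookup_sum lookup_single when_def)
    finally have *: "sbst (linsub X M) (lin X y) = lin X (\<lambda>w. \<Sum>v\<in>X. y v * M v w)" .
    have "pair (sbst (linsub X M) (lin X y ^ e)) q = of_nat (fact e) * ev (\<lambda>c. c) (\<lambda>w. \<Sum>v\<in>X. y v * M v w) q"
      by (simp only: s.hom_power * pair_lin_power[OF X q])
    also have "ev (\<lambda>c. c) (\<lambda>w. \<Sum>v\<in>X. y v * M v w) q = ev (\<lambda>c. c) y (sbst (linsub X (\<lambda>v w. M w v)) q)"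
      by (simp add: ev_sbst[OF hom_id] linsub_def ev_lin[OF hom_id] mult.commute)
    finally show ?thesis
      by (simp add: pair_lin_power[OF X sbst_linsub_Form[OF q]])
  qed
  from powers_span[OF X p] show ?thesis
  proof (induction rule: mp.span_induct_alt)
    case (step c x y)
    then obtain z where "x = lin X z ^ e" by auto
    moreover have "sbst (linsub X M) (Con c) = Con c" by (simp add: sbst_def ev_Con[OF Con_hom])
    ultimately show ?case
      using step pow[of z] by (simp only: pair_add_left pair_Con_left s.hom_add s.hom_mult)
  qed simp
qed

lemma coef_mult_restr:
  fixes h g :: "('v, 'a::comm_ring_1) mpoly"
  assumes h: "h \<in> Form X d" and A: "A \<in> Mon X (d + e)"
  shows "coef (h * g) A = coef (h * restr (Mon X e) g) A"
proof -
  have "coef (h * (g - restr (Mon X e) g)) A = 0"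
  proof (rule ccontr)
    assume "coef (h * (g - restr (Mon X e) g)) A \<noteq> 0"
    then have "A \<in> keys (h * (g - restr (Mon X e) g))" by (simp add: in_keys_iff)
    then obtain B C where BC: "A = B + C" "B \<in> keys h" "C \<in> keys (g - restr (Mon X e) g)"
      using keys_mult by blast
    have "C \<notin> Mon X e" using BC(3) by (auto simp: in_keys_iff lookup_minus coef_restr)
    moreover have "B \<in> Mon X d" using BC(2) h by (auto simp: Form_def)
    ultimately show False using A BC(1) by (auto simp: Mon_def)
  qed
  then show ?thesis by (simp add: algebra_simps lookup_minus)
qed

lemma coef_mult_eq_0:
  fixes h g :: "('v, 'a::comm_ring_1) mpoly"
  assumes h: "h \<in> Form X d" and A: "A \<in> Mon X e" "e < d"
  shows "coef (h * g) A = 0"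
proof (rule ccontr)
  assume "coef (h * g) A \<noteq> 0"
  then have "A \<in> keys (h * g)" by (simp add: in_keys_iff)
  then obtain B C where BC: "A = B + C" "B \<in> keys h"
    using keys_mult by blast
  then show False using A h by (auto simp: Mon_def Form_def)
qed

text \<open>Here \<open>w\<close> is the degree \<open>e\<close> component of \<open>h\<close>, as a
  differential operator, applied to \<open>f\<close>. It is written down by duality on monomials, so
  that no derivatives have to be introduced.\<close>

lemma mult_adjoint:
  fixes h f :: "('v, 'a::field_char_0) mpoly"
  assumes X: "finite X"
  obtains w where "w \<in> Form X e" "\<And>g. g \<in> Form X e \<Longrightarrow> pair (h * g) f = pair g w"
proof
  let ?w = "\<Sum>C\<in>Mon X e. mon C (pair (h * mon C 1) f / of_nat (mfact C))"
  show "?w \<in> Form X e" by (intro Form_sum Form_single)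
  fix g :: "('v, 'a) mpoly" assume g: "g \<in> Form X e"
  have cw: "coef ?w C = pair (h * mon C 1) f / of_nat (mfact C)" if "C \<in> Mon X e" for C
    using that by (simp add: lookup_sum lookup_single when_def finite_Mon[OF X])
  have "h * g = (\<Sum>C\<in>keys g. Con (coef g C) * (h * mon C 1))"
    by (subst (1) poly_expand[of g]) (simp add: sum_distrib_left mult.left_commute[of _ h] mult_single)
  then have "pair (h * g) f = (\<Sum>C\<in>keys g. coef g C * pair (h * mon C 1) f)"
    by (simp only: pair_sum_left pair_Con_left)
  also have "\<dots> = pair g ?w"
    unfolding pair_def[of g]
    by (intro sum.cong refl) (use g in \<open>auto simp: Form_def subset_iff cw\<close>)
  finally show "pair (h * g) f = pair g ?w" .
qed

subsection \<open>Invariants of a self-adjoint set of linear maps\<close>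

text \<open>Transposes are the adjoints for the apolar pairing. Closure under them takes the place
  of complete reducibility: orthogonal complements of invariant spaces are again invariant.\<close>

locale invariants =
  fixes X :: "'v::linorder set" and Ms :: "('v \<Rightarrow> 'v \<Rightarrow> rat) set"
  assumes finX: "finite X"
    and transp: "M \<in> Ms \<Longrightarrow> (\<lambda>v w. M w v) \<in> Ms"
begin

definition R :: "nat \<Rightarrow> ('v, rat) mpoly set" where
  "R e = {p \<in> Form X e. \<forall>M\<in>Ms. sbst (linsub X M) p = p}"

lemma R_Form: "p \<in> R e \<Longrightarrow> p \<in> Form X e"
  by (simp add: R_def)

lemma R_zero [simp]: "0 \<in> R e"
  by (simp add: R_def sbst_def)

lemma R_add: "p \<in> R e \<Longrightarrow> q \<in> R e \<Longrightarrow> p + q \<in> R e"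
  using comm_ring_hom.axioms sbst_hom
  by (auto simp: R_def Form_add sbst_def ev_add single_add)

lemma R_mult: "p \<in> R d \<Longrightarrow> q \<in> R e \<Longrightarrow> p * q \<in> R (d + e)"
proof -
  assume p: "p \<in> R d" and q: "q \<in> R e"
  have "sbst (linsub X M) (p * q) = sbst (linsub X M) p * sbst (linsub X M) q" for M
  proof -
    interpret s: comm_ring_hom "sbst (linsub X M)" by (rule sbst_hom)
    show ?thesis by (rule s.hom_mult)
  qed
  with p q show ?thesis by (auto simp: R_def Form_mult)
qed

lemma R_Con: "Con c \<in> R 0"
  by (auto simp: R_def Form_Con sbst_def ev_Con[OF Con_hom])

lemma R_one: "1 \<in> R 0"
  using R_Con[of 1] by simp

lemma R_scale: "p \<in> R e \<Longrightarrow> Con c * p \<in> R e"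
  using R_mult[OF R_Con, of p e c] by simp

lemma R_diff: "p \<in> R e \<Longrightarrow> q \<in> R e \<Longrightarrow> p - q \<in> R e"
proof -
  assume p: "p \<in> R e" and q: "q \<in> R e"
  have "Con (-1) * q = - q" by (simp add: poly_mapping_eq_iff fun_eq_iff coef_Con_mult)
  then show ?thesis using R_add[OF p R_scale[OF q, of "-1"]] by simp
qed

lemma R_sum: "(\<And>i. i \<in> I \<Longrightarrow> f i \<in> R e) \<Longrightarrow> sum f I \<in> R e"
  by (induction I rule: infinite_finite_induct) (auto intro: R_add)

lemma R_power: "p \<in> R e \<Longrightarrow> p ^ k \<in> R (k * e)"
  by (induction k) (auto intro: R_one R_mult)

text \<open>Moving \<open>M\<close> across the pairing and past the invariant factor
  \<open>h\<close> shows that \<open>M\<close> applied to \<open>w\<close>, minus \<open>w\<close>,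
  is orthogonal to all forms of degree \<open>e\<close>, in particular to itself.\<close>

lemma adjoint_R:
  assumes h: "h \<in> R d" and f: "f \<in> R (d + e)" and w: "w \<in> Form X e"
    and adj: "\<And>g. g \<in> Form X e \<Longrightarrow> pair (h * g) f = pair g w"
  shows "w \<in> R e"
proof -
  have "sbst (linsub X M) w = w" if M: "M \<in> Ms" for M
  proof -
    let ?T = "linsub X (\<lambda>v w. M w v)"
    interpret s: comm_ring_hom "sbst ?T" by (rule sbst_hom)
    have "pair g (sbst (linsub X M) w) = pair g w" if g: "g \<in> Form X e" for g
    proof -
      have hg: "h * g \<in> Form X (d + e)" using R_Form[OF h] g by (rule Form_mult)
      have "pair g (sbst (linsub X M) w) = pair (sbst ?T g) w"
        using pair_sbst[OF finX g w, of "\<lambda>v w. M w v"] by simp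
      also have "\<dots> = pair (h * sbst ?T g) f"
        by (rule adj[symmetric], rule sbst_linsub_Form[OF g])
      also have "h * sbst ?T g = sbst ?T (h * g)"
        using h transp[OF M] by (simp add: s.hom_mult R_def)
      also have "pair \<dots> f = pair (h * g) (sbst (linsub X M) f)"
        using pair_sbst[OF finX hg R_Form[OF f], of "\<lambda>v w. M w v"] by simp
      also have "\<dots> = pair g w" using f M adj[OF g] by (simp add: R_def)
      finally show ?thesis .
    qed
    from this[of "sbst (linsub X M) w - w"]
    have "pair (sbst (linsub X M) w - w) (sbst (linsub X M) w - w) = 0"
      using w sbst_linsub_Form[OF w] by (simp add: pair_diff_right Form_diff)
    then show ?thesis using pair_pos by fastforce
  qed
  with w show ?thesis by (simp add: R_def)
qed

text \<open>The orthogonal projection plays the role of the Reynolds operator.\<close>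

lemma orth_ideal:
  assumes h: "h \<in> R d" and u: "u \<in> R e"
    and orth: "\<And>r. d \<le> e \<Longrightarrow> r \<in> R (e - d) \<Longrightarrow> pair (h * r) u = 0"
  shows "pair (h * g) u = 0"
proof (cases "d \<le> e")
  case True
  then have e: "d + (e - d) = e" by simp
  obtain w where w: "w \<in> Form X (e - d)"
    "\<And>g. g \<in> Form X (e - d) \<Longrightarrow> pair (h * g) u = pair g w"
    using mult_adjoint[OF finX, of "e - d" h u] by blast
  have "w \<in> R (e - d)"
    by (rule adjoint_R[OF h _ w]) (use u e in simp)
  \<comment> \<open>Being invariant, \<open>w\<close> may be taken for \<open>r\<close> in
    \<open>orth\<close>; by the choice of \<open>w\<close> this reads
    \<open>pair w w = 0\<close>.\<close>
  then have "pair w w = 0" using orth[OF True] w by metis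
  then have "w = 0" by (rule pair_pos)
  have "pair (h * g) u = pair u (h * g)" by (rule pair_commute)
  also have "\<dots> = pair u (h * restr (Mon X (e - d)) g)"
    unfolding pair_def
  proof (intro sum.cong refl arg_cong2[where f = "(*)"])
    fix A assume "A \<in> keys u"
    then have "A \<in> Mon X (d + (e - d))" using R_Form[OF u] e by (auto simp: Form_def)
    then show "coef (h * g) A = coef (h * restr (Mon X (e - d)) g) A"
      by (rule coef_mult_restr[OF R_Form[OF h]])
  qed
  also have "\<dots> = pair (h * restr (Mon X (e - d)) g) u" by (rule pair_commute)
  also have "\<dots> = 0" using w(2)[OF restr_Form] \<open>w = 0\<close> by simp
  finally show ?thesis .
next
  case False
  have "pair (h * g) u = pair u (h * g)" by (rule pair_commute)
  also have "\<dots> = 0"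
    unfolding pair_def
    by (rule sum.neutral) (use R_Form[OF u] coef_mult_eq_0[OF R_Form[OF h]] False in \<open>auto simp: Form_def\<close>)
  finally show ?thesis .
qed

text \<open>Orthogonal projection of \<open>f\<close> to the space \<open>U\<close> of combinations
  of \<open>H\<close> with invariant coefficients. The remainder is orthogonal to \<open>U\<close>,
  and then to the whole ideal by \<open>orth_ideal\<close>.\<close>

lemma orth_split:
  assumes H: "finite H" "\<And>h. h \<in> H \<Longrightarrow> h \<in> R (deg h)" and f: "f \<in> R e"
  obtains r u where "f = (\<Sum>h\<in>H. h * r h) + u" "u \<in> R e" "\<And>h. h \<in> H \<Longrightarrow> r h \<in> R (e - deg h)"
    "\<And>h. h \<in> H \<Longrightarrow> e < deg h \<Longrightarrow> r h = 0" "\<And>h g. h \<in> H \<Longrightarrow> pair (h * g) u = 0"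
proof -
  \<comment> \<open>When \<open>e < deg h\<close>, the difference \<open>e - deg h\<close> is 0 and
    would admit constants; such coefficients are forced to be 0.\<close>
  define ok where "ok r \<longleftrightarrow> (\<forall>h\<in>H. r h \<in> R (e - deg h) \<and> (e < deg h \<longrightarrow> r h = 0))" for r
  define U where "U = {\<Sum>h\<in>H. h * r h | r. ok r}"
  have UR: "U \<subseteq> R e"
  proof
    fix x assume "x \<in> U"
    then obtain r where x: "x = (\<Sum>h\<in>H. h * r h)" and r: "ok r" by (auto simp: U_def)
    have "h * r h \<in> R e" if "h \<in> H" for h
    proof (cases "e < deg h")
      case True
      then show ?thesis using r that by (simp add: ok_def)
    next
      case False
      then show ?thesis using R_mult[OF H(2)[OF that], of "r h" "e - deg h"] r that by (simp add: ok_def)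
    qed
    then show "x \<in> R e" unfolding x by (rule R_sum)
  qed
  have sub: "mp.subspace U"
  proof (rule mp.subspaceI)
    show "0 \<in> U" unfolding U_def by (auto intro!: exI[of _ "\<lambda>_. 0"] simp: ok_def)
    fix x y assume "x \<in> U" "y \<in> U"
    then obtain r s where "x = (\<Sum>h\<in>H. h * r h)" "y = (\<Sum>h\<in>H. h * s h)" "ok r" "ok s"
      by (auto simp: U_def)
    then show "x + y \<in> U" unfolding U_def
      by (auto intro!: exI[of _ "\<lambda>h. r h + s h"] simp: ok_def R_add sum.distrib algebra_simps)
  next
    fix c x assume "x \<in> U"
    then obtain r where "x = (\<Sum>h\<in>H. h * r h)" "ok r"
      by (auto simp: U_def)
    then show "Con c * x \<in> U" unfolding U_def
      by (auto intro!: exI[of _ "\<lambda>h. Con c * r h"] simp: ok_def R_scale sum_distrib_left mult.left_commute[of "Con c"])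
  qed
  obtain B where B: "finite B" "B \<subseteq> U" "U \<subseteq> mp.span B"
    using finite_spanning_set[OF finX, of U e] UR R_Form by blast
  obtain u where u: "u \<in> mp.span B" "\<forall>b\<in>B. pair b (f - u) = 0"
    using orth_decomp[OF B(1)] by blast
  have "u \<in> U" using u(1) mp.span_minimal[OF B(2) sub] by blast
  then obtain r where r: "u = (\<Sum>h\<in>H. h * r h)" "ok r" by (auto simp: U_def)
  have fu: "f - u \<in> R e" using f UR \<open>u \<in> U\<close> by (auto intro: R_diff)
  have orth: "pair x (f - u) = 0" if "x \<in> U" for x
    by (rule pair_span[of B]) (use u B that in auto)
  have "pair (h * g) (f - u) = 0" if h: "h \<in> H" for h g
  proof (rule orth_ideal[OF H(2)[OF h] fu])
    fix s assume "deg h \<le> e" "s \<in> R (e - deg h)"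
    then have "h * s \<in> U" unfolding U_def using h H(1)
      by (auto intro!: exI[of _ "\<lambda>h'. if h' = h then s else 0"] simp: ok_def if_distrib[of "\<lambda>x. _ * x"] cong: if_cong)
    then show "pair (h * s) (f - u) = 0" by (rule orth)
  qed
  with fu r show thesis by (intro that[of r "f - u"]) (auto simp: ok_def)
qed

text \<open>The remainder of \<open>orth_split\<close> lies in the ideal and is orthogonal to it, so
  it is orthogonal to itself and vanishes.\<close>

lemma reynolds:
  assumes H: "finite H" "\<And>h. h \<in> H \<Longrightarrow> h \<in> R (deg h)" and f: "f \<in> R e" "f \<in> idl.span H"
  obtains r where "f = (\<Sum>h\<in>H. h * r h)" "\<And>h. h \<in> H \<Longrightarrow> r h \<in> R (e - deg h)"
    "\<And>h. h \<in> H \<Longrightarrow> e < deg h \<Longrightarrow> r h = 0"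
proof -
  obtain r u where ru: "f = (\<Sum>h\<in>H. h * r h) + u" "u \<in> R e" "\<And>h. h \<in> H \<Longrightarrow> r h \<in> R (e - deg h)"
    "\<And>h. h \<in> H \<Longrightarrow> e < deg h \<Longrightarrow> r h = 0" "\<And>h g. h \<in> H \<Longrightarrow> pair (h * g) u = 0"
    using orth_split[OF H f(1)] by blast
  obtain g where "f = (\<Sum>h\<in>H. g h * h)" using f(2) unfolding idl.span_finite[OF H(1)] by auto
  then have "u = (\<Sum>h\<in>H. h * (g h - r h))"
    using ru(1) by (simp add: algebra_simps sum_subtractf)
  then have "pair u u = pair (\<Sum>h\<in>H. h * (g h - r h)) u" by (rule arg_cong)
  also have "\<dots> = (\<Sum>h\<in>H. pair (h * (g h - r h)) u)" by (rule pair_sum_left)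
  also have "\<dots> = 0" using ru(5) by simp
  finally have "u = 0" by (rule pair_pos)
  with ru show thesis by (intro that[of r]) auto
qed

end

section \<open>Finiteness: Dickson's lemma, Hilbert's basis theorem and the Nullstellensatz\<close>

text \<open>Beyond every index there is a position whose value is minimal among all later ones.
  Jumping from one such position to the next gives the subsequence.\<close>

lemma nat_mono_subseq:
  fixes s :: "nat \<Rightarrow> nat"
  shows "\<exists>g :: nat \<Rightarrow> nat. strict_mono g \<and> mono (s \<circ> g)"
proof -
  have ex: "\<exists>k\<ge>N. \<forall>l\<ge>k. s k \<le> s l" for N
  proof -
    obtain k where "k \<ge> N" "\<forall>l. l \<ge> N \<longrightarrow> s k \<le> s l"
      using arg_min_natI[of "\<lambda>k. k \<ge> N" N s] arg_min_nat_le[of "\<lambda>k. k \<ge> N" _ s] by blast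
    then show ?thesis by (metis le_trans)
  qed
  have "\<exists>g. \<forall>n. (\<forall>l\<ge>g n. s (g n) \<le> s l) \<and> g n < g (Suc n)"
  proof (rule dependent_nat_choice)
    show "\<exists>x. \<forall>l\<ge>x. s x \<le> s l" using ex[of 0] by blast
    fix x :: nat
    show "\<exists>y. (\<forall>l\<ge>y. s y \<le> s l) \<and> x < y" using ex[of "Suc x"] by (metis Suc_le_lessD)
  qed
  then obtain g :: "nat \<Rightarrow> nat" where g: "\<And>n l. l \<ge> g n \<Longrightarrow> s (g n) \<le> s l" "\<And>n. g n < g (Suc n)" by blast
  have "strict_mono g" using g(2) by (simp add: strict_mono_Suc_iff)
  moreover have "mono (s \<circ> g)"
    using g(1) strict_mono_less_eq[OF \<open>strict_mono g\<close>] by (auto simp: mono_def)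
  ultimately show ?thesis by blast
qed

text \<open>The monotone subsequence is refined once for each variable, which preserves monotonicity
  in the variables already treated.\<close>

lemma dickson_subseq:
  fixes f :: "nat \<Rightarrow> 'v multiset"
  assumes "finite X"
  shows "\<exists>g :: nat \<Rightarrow> nat. strict_mono g \<and> (\<forall>v\<in>X. mono (\<lambda>i. count (f (g i)) v))"
  using assms
proof (induction X rule: finite_induct)
  case empty
  show ?case by (auto intro: exI[of _ id] simp: strict_mono_def)
next
  case (insert x X)
  then obtain g :: "nat \<Rightarrow> nat" where g: "strict_mono g" "\<forall>v\<in>X. mono (\<lambda>i. count (f (g i)) v)" by blast
  obtain h :: "nat \<Rightarrow> nat" where h: "strict_mono h" "mono ((\<lambda>i. count (f (g i)) x) \<circ> h)"
    using nat_mono_subseq by blast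
  have "strict_mono (g \<circ> h)" using g(1) h(1) by (rule strict_mono_o)
  moreover have "mono (\<lambda>i. count (f ((g \<circ> h) i)) v)" if "v \<in> insert x X" for v
    using that g(2) h(2) strict_mono_less_eq[OF h(1)] by (auto simp: mono_def)
  ultimately show ?case by blast
qed

lemma dickson:
  fixes f :: "nat \<Rightarrow> 'v multiset"
  assumes "finite X" "\<And>i. set_mset (f i) \<subseteq> X"
  shows "\<exists>i j. i < j \<and> f i \<subseteq># f j"
proof -
  obtain g :: "nat \<Rightarrow> nat" where g: "strict_mono g" "\<forall>v\<in>X. mono (\<lambda>i. count (f (g i)) v)"
    using dickson_subseq[OF assms(1)] by blast
  have "count (f (g 0)) v \<le> count (f (g 1)) v" for v
  proof (cases "v \<in> X")
    case True
    then have "mono (\<lambda>i. count (f (g i)) v)" using g(2) by blast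
    from monoD[OF this, of 0 1] show ?thesis by simp
  next
    case False
    then have "v \<notin># f (g 0)" using assms(2)[of "g 0"] by auto
    then show ?thesis by (simp add: not_in_iff)
  qed
  then have "f (g 0) \<subseteq># f (g 1)" by (simp add: mset_subset_eqI)
  moreover have "g 0 < g 1" using g(1) by (simp add: strict_mono_def)
  ultimately show ?thesis by blast
qed

lemma idl_finite_support:
  assumes "finite T" "T \<subseteq> idl.span S"
  shows "\<exists>S'. finite S' \<and> S' \<subseteq> S \<and> T \<subseteq> idl.span S'"
  using assms
proof (induction T rule: finite_induct)
  case empty
  show ?case by (rule exI[of _ "{}"]) auto
next
  case (insert t T)
  then obtain S1 where S1: "finite S1" "S1 \<subseteq> S" "T \<subseteq> idl.span S1"
    by auto
  have "t \<in> idl.span S" using insert.prems by simp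
  then obtain S2 r where S2: "finite S2" "S2 \<subseteq> S" "t = (\<Sum>a\<in>S2. r a * a)"
    unfolding idl.span_explicit by blast
  have "t \<in> idl.span S2"
    unfolding S2(3) by (intro idl.span_sum idl.span_scale idl.span_base)
  show ?case
    by (rule exI[of _ "S1 \<union> S2"])
      (use S1 S2(1,2) \<open>t \<in> idl.span S2\<close> idl.span_mono[of S1 "S1 \<union> S2"] idl.span_mono[of S2 "S1 \<union> S2"] in auto)
qed

lemma coef_single_mult: "coef (mon D c * p) (D + A) = c * coef p A"
  for p :: "('v, 'a::comm_ring_1) mpoly"
proof -
  have "coef (mon D c * p) (D + A) = coef (\<Sum>B\<in>keys p. mon (D + B) (c * coef p B)) (D + A)"
    by (subst (1) poly_expand[of p]) (simp add: sum_distrib_left mult_single)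
  also have "\<dots> = (\<Sum>B\<in>keys p. if B = A then c * coef p B else 0)"
    by (simp add: lookup_sum lookup_single when_def)
  also have "\<dots> = c * coef p A" by (auto simp: in_keys_iff)
  finally show ?thesis .
qed

lemma keys_single_mult: "keys (mon D c * p) \<subseteq> (+) D ` keys p"
  for p :: "('v, 'a::comm_ring_1) mpoly"
  using keys_mult[of "mon D c" p] by (auto split: if_splits)

text \<open>Elements outside the ideal generated so far are chosen greedily with least leading
  monomial in the multiset order, which is a well-order here. If this never stopped, Dickson's lemma
  would give a leading monomial dividing a later one, and cancelling it would contradict
  minimality.\<close>

theorem hilbert_basis:
  fixes S :: "('v::wellorder, 'a::field) mpoly set"
  assumes X: "finite X" and S: "\<And>p A. p \<in> S \<Longrightarrow> A \<in> keys p \<Longrightarrow> set_mset A \<subseteq> X"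
  obtains T where "finite T" "T \<subseteq> S" "S \<subseteq> idl.span T"
proof -
  \<comment> \<open>Elements of the ideal may involve variables outside \<open>X\<close>. Keeping
    only polynomials in \<open>X\<close> provides the finite set of variables that Dickson's lemma
    asks for.\<close>
  define I where "I = {p \<in> idl.span S. \<forall>A\<in>keys p. set_mset A \<subseteq> X}"
  define LM where "LM p = Max (keys p)" for p :: "('v, 'a) mpoly"
  have SI: "S \<subseteq> I" using S by (auto simp: I_def intro: idl.span_base)
  have "\<exists>F. finite F \<and> F \<subseteq> I \<and> I \<subseteq> idl.span F"
  proof (rule ccontr)
    assume neg: "\<not> (\<exists>F. finite F \<and> F \<subseteq> I \<and> I \<subseteq> idl.span F)"
    define good where "good F p \<longleftrightarrow> p \<in> I - idl.span F \<and> (\<forall>q\<in>I - idl.span F. LM p \<le> LM q)" for F p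
    have ex: "\<exists>p. good F p" if "finite F" "F \<subseteq> I" for F
    proof -
      have "I - idl.span F \<noteq> {}" using neg that by blast
      then obtain p where "p \<in> I - idl.span F" "\<And>q. q \<in> I - idl.span F \<Longrightarrow> LM p \<le> LM q"
        using exists_least_iff[of "\<lambda>m. \<exists>p\<in>I - idl.span F. LM p = m"]
        by (metis (no_types, lifting) ex_in_conv linorder_not_le)
      then show ?thesis by (auto simp: good_def)
    qed
    define c where "c F = (SOME p. good F p)" for F
    define Fs where "Fs = rec_nat {} (\<lambda>_ F. insert (c F) F)"
    have Fs: "Fs 0 = {}" "Fs (Suc n) = insert (c (Fs n)) (Fs n)" for n
      by (auto simp: Fs_def)
    have fin: "finite (Fs n) \<and> Fs n \<subseteq> I \<and> good (Fs n) (c (Fs n))" for n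
    proof (induction n)
      case 0
      then show ?case using ex[of "{}"] by (auto simp: Fs c_def intro: someI_ex)
    next
      case (Suc n)
      then have "finite (Fs (Suc n))" "Fs (Suc n) \<subseteq> I" by (auto simp: Fs good_def)
      then show ?case using ex[of "Fs (Suc n)"] by (auto simp: c_def intro: someI_ex)
    qed
    define f where "f n = c (Fs n)" for n
    have f: "f n \<in> I" "f n \<notin> idl.span (Fs n)" "\<And>q. q \<in> I \<Longrightarrow> q \<notin> idl.span (Fs n) \<Longrightarrow> LM (f n) \<le> LM q" for n
      using fin[of n] by (auto simp: good_def f_def)
    have mono: "Fs m \<subseteq> Fs n" if "m \<le> n" for m n
      using that by (induction n) (auto simp: Fs le_Suc_eq)
    have fin_Fs: "f i \<in> Fs j" if "i < j" for i j
      using mono[of "Suc i" j] that by (auto simp: Fs f_def)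
    have nz: "f n \<noteq> 0" for n using f(2)[of n] idl.span_zero by metis
    have LMk: "LM p \<in> keys p" if "p \<noteq> 0" for p :: "('v, 'a) mpoly"
      unfolding LM_def using that by (intro Max_in) auto
    have LMmax: "A \<le> LM p" if "A \<in> keys p" for p :: "('v, 'a) mpoly" and A
      unfolding LM_def using that by (intro Max_ge) auto
    have "set_mset (LM (f n)) \<subseteq> X" for n
      using f(1)[of n] LMk[OF nz[of n]] by (auto simp: I_def)
    then obtain i j where ij: "i < j" "LM (f i) \<subseteq># LM (f j)"
      using dickson[OF X, of "\<lambda>n. LM (f n)"] by blast
    define D where "D = LM (f j) - LM (f i)"
    have D: "D + LM (f i) = LM (f j)" using ij(2) by (simp add: D_def)
    \<comment> \<open>The multiple of \<open>f i\<close> with the leading term of \<open>f j\<close>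
      is subtracted. The result is still outside the span of \<open>Fs j\<close>, but its leading
      monomial is smaller.\<close>
    define a where "a = coef (f j) (LM (f j)) / coef (f i) (LM (f i))"
    define q where "q = f j - mon D a * f i"
    have lc: "coef (f i) (LM (f i)) \<noteq> 0" using LMk[OF nz[of i]] by (simp add: in_keys_iff)
    have "mon D a * f i \<in> idl.span (Fs j)"
      using fin_Fs[OF ij(1)] by (intro idl.span_scale idl.span_base)
    then have qn: "q \<notin> idl.span (Fs j)"
      using f(2)[of j] idl.span_add[of q "Fs j" "mon D a * f i"] by (auto simp: q_def)
    have kq: "keys q \<subseteq> keys (f j) \<union> (+) D ` keys (f i)"
      unfolding q_def using keys_diff[of "f j" "mon D a * f i"] keys_single_mult[of D a "f i"] by blast
    have "q \<in> I"
    proof -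
      have "q \<in> idl.span S"
        unfolding q_def using f(1) by (intro idl.span_diff idl.span_scale) (auto simp: I_def)
      moreover have "set_mset A \<subseteq> X" if "A \<in> keys q" for A
      proof -
        have "set_mset D \<subseteq> set_mset (LM (f j))" by (auto simp: D_def dest: in_diffD)
        then have "set_mset D \<subseteq> X" using f(1)[of j] LMk[OF nz[of j]] by (auto simp: I_def)
        have kX: "set_mset B \<subseteq> X" if "B \<in> keys (f i) \<or> B \<in> keys (f j)" for B
          using that f(1)[of i] f(1)[of j] by (auto simp: I_def)
        from that kq consider "A \<in> keys (f j)" | B where "A = D + B" "B \<in> keys (f i)" by blast
        then show ?thesis
        proof cases
          case 2
          then show ?thesis using kX[of B] \<open>set_mset D \<subseteq> X\<close> by simp
        qed (use kX in blast)
      qed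
      ultimately show ?thesis by (simp add: I_def)
    qed
    have "q \<noteq> 0" using qn idl.span_zero by metis
    have "LM q \<le> LM (f j)"
    proof -
      have "D + B \<le> LM (f j)" if "B \<in> keys (f i)" for B
        using add_left_mono[OF LMmax[OF that], of D] by (simp only: D)
      then show ?thesis using LMk[OF \<open>q \<noteq> 0\<close>] kq LMmax[of _ "f j"] by auto
    qed
    moreover have "coef q (LM (f j)) = 0"
      using coef_single_mult[of D a "f i" "LM (f i)"] lc by (simp only: q_def lookup_minus D) (simp add: a_def)
    then have "LM q \<noteq> LM (f j)" using LMk[OF \<open>q \<noteq> 0\<close>] by (metis in_keys_iff)
    ultimately show False using f(3)[OF \<open>q \<in> I\<close> qn] by simp
  qed
  then obtain F where F: "finite F" "F \<subseteq> I" "I \<subseteq> idl.span F" by blast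
  then have "F \<subseteq> idl.span S" by (auto simp: I_def)
  from idl_finite_support[OF F(1) this] obtain T where T: "finite T" "T \<subseteq> S" "F \<subseteq> idl.span T"
    by blast
  have "idl.span F \<subseteq> idl.span T" using T(3) by (rule idl.span_minimal) (rule idl.subspace_span)
  with SI F(3) T that show thesis by blast
qed

text \<open>Elimination without division. It is stated for integral domains because it is also
  applied to vectors of polynomials in the regularity lemma.\<close>

lemma lin_dep:
  fixes m :: "'i \<Rightarrow> 'j \<Rightarrow> 'a::idom"
  assumes "finite I" "finite J" "card J < card I"
  shows "\<exists>c. (\<exists>i\<in>I. c i \<noteq> 0) \<and> (\<forall>j\<in>J. (\<Sum>i\<in>I. c i * m i j) = 0)"
  using assms(2,1,3)
proof (induction J arbitrary: I m rule: finite_induct)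
  case empty
  then show ?case by (auto intro!: exI[of _ "\<lambda>_. 1"] simp: card_gt_0_iff)
next
  case (insert j0 J)
  show ?case
  proof (cases "\<forall>i\<in>I. m i j0 = 0")
    case True
    have "card J < card I" using insert by auto
    then obtain c where "\<exists>i\<in>I. c i \<noteq> 0" "\<forall>j\<in>J. (\<Sum>i\<in>I. c i * m i j) = 0"
      using insert.IH[of I m] insert.prems by blast
    then show ?thesis using True by (intro exI[of _ c]) auto
  next
    case False
    then obtain i0 where i0: "i0 \<in> I" "m i0 j0 \<noteq> 0" by blast
    let ?I = "I - {i0}"
    define m' where "m' i j = m i0 j0 * m i j - m i j0 * m i0 j" for i j
    have "card J < card ?I" using insert i0 by auto
    then obtain c where c: "\<exists>i\<in>?I. c i \<noteq> 0" "\<forall>j\<in>J. (\<Sum>i\<in>?I. c i * m' i j) = 0"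
      using insert.IH[of ?I m'] insert.prems by blast
    define d where "d i = (if i = i0 then - (\<Sum>k\<in>?I. c k * m k j0) else m i0 j0 * c i)" for i
    have sum: "(\<Sum>i\<in>I. d i * m i j) = (\<Sum>i\<in>?I. c i * m' i j)" for j
    proof -
      have "(\<Sum>i\<in>I. d i * m i j) = d i0 * m i0 j + (\<Sum>i\<in>?I. d i * m i j)"
        using insert.prems i0 by (simp add: sum.remove)
      also have "(\<Sum>i\<in>?I. d i * m i j) = (\<Sum>i\<in>?I. m i0 j0 * c i * m i j)"
        by (intro sum.cong) (auto simp: d_def)
      finally show ?thesis
        by (simp add: d_def m'_def algebra_simps sum_subtractf sum_distrib_left)
    qed
    have "m' i j0 = 0" for i by (simp add: m'_def)
    then have "\<forall>j\<in>insert j0 J. (\<Sum>i\<in>I. d i * m i j) = 0"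
      using c(2) by (auto simp: sum)
    moreover have "\<exists>i\<in>I. d i \<noteq> 0" using c(1) i0 by (auto simp: d_def)
    ultimately show ?thesis by blast
  qed
qed

lemma idl_span_insert_iff: "x \<in> idl.span (insert a M) \<longleftrightarrow> (\<exists>r. x - r * a \<in> idl.span M)"
  by (simp add: idl.span_insert)

text \<open>Zorn's lemma for ideals that avoid all powers of \<open>h\<close>. A maximal one
  corresponds to a maximal ideal after inverting \<open>h\<close>: it is prime, and everything
  outside it divides a power of \<open>h\<close> modulo it. This plays the role of the Rabinowitsch
  trick.\<close>

lemma max_ideal_disjoint_powers:
  fixes h :: "'r::comm_ring_1"
  assumes "\<And>k. h ^ k \<notin> idl.span S"
  obtains M where "idl.subspace M" "S \<subseteq> M" "\<And>k. h ^ k \<notin> M"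
    "\<And>a. a \<notin> M \<Longrightarrow> \<exists>k r. h ^ k - r * a \<in> M"
    "\<And>a b. a * b \<in> M \<Longrightarrow> a \<in> M \<or> b \<in> M"
proof -
  define Z where "Z = {I. idl.subspace I \<and> S \<subseteq> I \<and> (\<forall>k. h ^ k \<notin> I)}"
  have "\<exists>M\<in>Z. \<forall>Y\<in>Z. M \<subseteq> Y \<longrightarrow> Y = M"
  proof (rule subset_Zorn_nonempty)
    have "idl.span S \<in> Z" using assms idl.span_superset by (auto simp: Z_def)
    then show "Z \<noteq> {}" by blast
    fix C assume C: "C \<noteq> {}" "subset.chain Z C"
    then have CZ: "C \<subseteq> Z" by (auto simp: subset.chain_def)
    have subC: "idl.subspace P" if "P \<in> C" for P using CZ that by (auto simp: Z_def)
    have "idl.subspace (\<Union>C)"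
    proof (rule idl.subspaceI)
      obtain P where "P \<in> C" using C(1) by blast
      then show "0 \<in> \<Union>C" using idl.subspace_0[OF subC] by blast
      fix x y assume "x \<in> \<Union>C" "y \<in> \<Union>C"
      then obtain P Q where PQ: "x \<in> P" "y \<in> Q" "P \<in> C" "Q \<in> C" by blast
      then have "P \<subseteq> Q \<or> Q \<subseteq> P" using C(2) by (auto simp: subset.chain_def)
      then obtain N where "N \<in> C" "x \<in> N" "y \<in> N" using PQ by blast
      then have "x + y \<in> N" using idl.subspace_add[OF subC] by blast
      then show "x + y \<in> \<Union>C" using \<open>N \<in> C\<close> by blast
    next
      fix c x assume "x \<in> \<Union>C"
      then obtain P where "P \<in> C" "x \<in> P" by blast
      then have "c * x \<in> P" using idl.subspace_scale[OF subC] by blast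
      then show "c * x \<in> \<Union>C" using \<open>P \<in> C\<close> by blast
    qed
    then show "\<Union>C \<in> Z" using C(1) CZ by (auto simp: Z_def)
  qed
  then obtain M where M: "M \<in> Z" "\<And>Y. Y \<in> Z \<Longrightarrow> M \<subseteq> Y \<Longrightarrow> Y = M" by blast
  have sub: "idl.subspace M" using M(1) by (simp add: Z_def)
  have span: "idl.span M = M" using sub by (rule idl.span_eq_iff[THEN iffD2])
  have max: "\<exists>k r. h ^ k - r * a \<in> M" if "a \<notin> M" for a
  proof (rule ccontr)
    assume neg: "\<not> ?thesis"
    have "idl.span (insert a M) \<in> Z"
      using neg M(1) idl.span_superset[of "insert a M"]
      by (auto simp: Z_def idl_span_insert_iff span)
    moreover have "M \<subseteq> idl.span (insert a M)" "a \<in> idl.span (insert a M)"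
      using idl.span_superset by blast+
    ultimately show False using M(2) that by blast
  qed
  have prime: "a \<in> M \<or> b \<in> M" if ab: "a * b \<in> M" for a b
  proof (rule ccontr)
    assume neg: "\<not> ?thesis"
    obtain k r where 1: "h ^ k - r * a \<in> M" using max neg by blast
    obtain l s where 2: "h ^ l - s * b \<in> M" using max neg by blast
    have "h ^ (k + l) = h ^ l * (h ^ k - r * a) + r * a * (h ^ l - s * b) + (r * s) * (a * b)"
      by (simp add: algebra_simps power_add)
    also have "\<dots> \<in> M"
      using idl.subspace_scale[OF sub 1, of "h ^ l"] idl.subspace_scale[OF sub 2, of "r * a"]
        idl.subspace_scale[OF sub ab, of "r * s"] by (intro idl.subspace_add[OF sub])
    finally show False using M(1) by (simp add: Z_def)
  qed
  from M(1) max prime show thesis by (intro that[of M]) (auto simp: Z_def)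
qed

lemma infinite_fiber:
  fixes F :: "'a \<Rightarrow> 'b"
  assumes "uncountable (UNIV :: 'a set)" "countable (range F)"
  obtains y where "infinite (F -` {y})"
proof (rule ccontr)
  assume "\<not> thesis"
  then have "countable (F -` {y})" for y using that countable_finite by blast
  then have "countable (\<Union>y\<in>range F. F -` {y})" using assms(2) by blast
  moreover have "(\<Union>y\<in>range F. F -` {y}) = UNIV" by auto
  ultimately show False using assms(1) by simp
qed

definition upoly :: "'v \<Rightarrow> 'a poly \<Rightarrow> ('v, 'a::comm_ring_1) mpoly" where
  "upoly v q = poly (map_poly Con q) (Var v)"

lemma upoly_hom:
  fixes v :: 'v
  shows "comm_ring_hom (upoly v :: 'a::comm_ring_1 poly \<Rightarrow> ('v, 'a) mpoly)"
proof -
  interpret c: comm_ring_hom "Con :: 'a \<Rightarrow> ('v, 'a) mpoly" by (rule Con_hom)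
  interpret m: map_poly_comm_ring_hom "Con :: 'a \<Rightarrow> ('v, 'a) mpoly" by unfold_locales
  show ?thesis
    by unfold_locales (simp_all add: upoly_def m.hom_mult m.hom_add)
qed

lemma upoly_linear: "upoly v [:- a, 1:] = Var v - Con a"
  by (simp add: upoly_def map_poly_pCons single_uminus)

lemma upoly_const: "upoly v [:a:] = Con a"
  by (cases "a = 0") (auto simp: upoly_def map_poly_pCons)

text \<open>Since \<open>\<complex>\<close> is uncountable while polynomials have countable dimension, every variable
  is congruent to a constant modulo a maximal ideal.\<close>

lemma nullstellensatz_point:
  fixes h :: "('v::countable, complex) mpoly"
  assumes "\<And>k. h ^ k \<notin> idl.span S"
  obtains z where "\<And>u. u \<in> S \<Longrightarrow> ev (\<lambda>c. c) z u = 0" "ev (\<lambda>c. c) z h \<noteq> 0"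
proof -
  obtain M where sub: "idl.subspace M" and SM: "S \<subseteq> M" and hM: "\<And>k. h ^ k \<notin> M"
    and max: "\<And>a. a \<notin> M \<Longrightarrow> \<exists>k r. h ^ k - r * a \<in> M"
    and prime: "\<And>a b. a * b \<in> M \<Longrightarrow> a \<in> M \<or> b \<in> M"
    using max_ideal_disjoint_powers[OF assms] by blast
  note subs = idl.subspace_add[OF sub] idl.subspace_scale[OF sub] idl.subspace_diff[OF sub]
  have conM: "c = 0" if "Con c \<in> M" for c
  proof (rule ccontr)
    assume "c \<noteq> 0"
    then have "Con (inverse c) * Con c = (1 :: ('v, complex) mpoly)" by (simp add: mult_single)
    moreover have "Con (inverse c) * Con c \<in> M" using that by (rule subs(2))
    ultimately show False using hM[of 0] by simp
  qed
  \<comment> \<open>A polynomial relation for \<open>v\<close> modulo \<open>M\<close> splits into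
    linear factors over the complex numbers, and primality puts one of them into
    \<open>M\<close>.\<close>
  have root: "\<exists>b. Var v - Con b \<in> M" if "q \<noteq> 0" "upoly v q \<in> M" for q v
    using that
  proof (induction "degree q" arbitrary: q rule: less_induct)
    case less
    interpret u: comm_ring_hom "upoly v :: complex poly \<Rightarrow> _" by (rule upoly_hom)
    show ?case
    proof (cases "degree q = 0")
      case True
      then obtain a where "q = [:a:]" by (metis degree_eq_zeroE)
      then show ?thesis using less.prems conM[of a] by (simp add: upoly_const)
    next
      case False
      then obtain b where "poly q b = 0"
        using fundamental_theorem_of_algebra[of q] by (auto simp: constant_degree)
      then obtain q' where q': "q = [:- b, 1:] * q'" by (auto simp: poly_eq_0_iff_dvd)
      then have "(Var v - Con b) * upoly v q' \<in> M"
        using less.prems(2) by (simp add: u.hom_mult upoly_linear del: mult_pCons_left)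
      then show ?thesis
      proof (cases "Var v - Con b \<in> M")
        case False
        then have "upoly v q' \<in> M" using prime \<open>(Var v - Con b) * upoly v q' \<in> M\<close> by blast
        moreover have "q' \<noteq> 0" using q' less.prems(1) by auto
        moreover have "degree q' < degree q" using q' \<open>q' \<noteq> 0\<close> by (simp add: degree_mult_eq del: mult_pCons_left)
        ultimately show ?thesis using less.hyps by blast
      qed blast
    qed
  qed
  have "\<exists>b. Var v - Con b \<in> M" for v
  proof (rule ccontr)
    assume neg: "\<not> ?thesis"
    then have "\<forall>b. \<exists>k g. h ^ k - g * (Var v - Con b) \<in> M" using max by blast
    then obtain kk g where g: "\<And>b. h ^ kk b - g b * (Var v - Con b) \<in> M" by metis
    \<comment> \<open>Exponent and support of \<open>g b\<close> take only countably many values, so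
      infinitely many \<open>b\<close> share them. More of these \<open>b\<close> than monomials in
      the common support gives a linear relation between the \<open>g b\<close>.\<close>
    define F where "F b = (kk b, keys (g b))" for b
    have cm: "countable (UNIV :: 'v multiset set)"
    proof -
      have "(UNIV :: 'v multiset set) = range mset" by (auto simp: image_iff) (metis ex_mset)
      then show ?thesis by (metis countable_image countableI_type)
    qed
    have "range F \<subseteq> UNIV \<times> {A. finite A \<and> A \<subseteq> UNIV}" by (auto simp: F_def)
    then have "countable (range F)"
      by (rule countable_subset) (intro countable_SIGMA countable_Collect_finite_subset cm countableI_type)
    then obtain y where y: "infinite (F -` {y})"
      using infinite_fiber[OF uncountable_UNIV_complex] by blast
    obtain k K where yk: "y = (k, K)" by (cases y)
    obtain a0 where "F a0 = y" using infinite_imp_nonempty[OF y] by auto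
    then have "finite K" by (auto simp: F_def yk)
    obtain B where B: "finite B" "card B = Suc (card K)" "B \<subseteq> F -` {y}"
      using infinite_arbitrarily_large[OF y] by blast
    have FB: "kk b = k" "keys (g b) = K" if "b \<in> B" for b using B(3) that by (auto simp: F_def yk)
    obtain c where c: "\<exists>b\<in>B. c b \<noteq> 0" "\<forall>A\<in>K. (\<Sum>b\<in>B. c b * coef (g b) A) = 0"
      using lin_dep[OF B(1) \<open>finite K\<close>, of "\<lambda>b. coef (g b)"] B(2) by auto
    have g0: "(\<Sum>b\<in>B. Con (c b) * g b) = 0"
    proof (rule poly_mapping_eqI)
      fix A
      show "coef (\<Sum>b\<in>B. Con (c b) * g b) A = coef 0 A"
      proof (cases "A \<in> K")
        case False
        then have "coef (g b) A = 0" if "b \<in> B" for b using FB(2)[OF that] by (auto simp: in_keys_iff)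
        then show ?thesis by (simp add: lookup_sum coef_Con_mult)
      qed (use c(2) in \<open>simp add: lookup_sum coef_Con_mult\<close>)
    qed
    define L where "L b = Var v - Con b" for b :: complex
    \<comment> \<open>The numerator of the sum of \<open>c b / (v - b)\<close> over the common
      denominator. As \<open>g b\<close> acts like \<open>h ^ k / (v - b)\<close> modulo
      \<open>M\<close>, the relation between the \<open>g b\<close> puts
      \<open>h ^ k * upoly v q\<close> into \<open>M\<close>. At a \<open>b\<close> with
      \<open>c b\<close> nonzero only one summand of \<open>q\<close> survives, so \<open>q\<close>
      is not 0.\<close>
    define q where "q = (\<Sum>b\<in>B. [:c b:] * (\<Prod>a\<in>B - {b}. [:- a, 1:]))"
    interpret u: comm_ring_hom "upoly v :: complex poly \<Rightarrow> _" by (rule upoly_hom)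
    have uq: "upoly v q = (\<Sum>b\<in>B. Con (c b) * (\<Prod>a\<in>B - {b}. L a))"
      by (simp add: q_def u.hom_sum u.hom_mult u.hom_prod upoly_const upoly_linear L_def del: mult_pCons_left)
    have trm: "h ^ k * (Con (c b) * (\<Prod>a\<in>B - {b}. L a)) - (Con (c b) * g b) * (\<Prod>a\<in>B. L a) \<in> M" if b: "b \<in> B" for b
    proof -
      have "(\<Prod>a\<in>B. L a) = L b * (\<Prod>a\<in>B - {b}. L a)" using B(1) b by (simp add: prod.remove)
      then have "h ^ k * (Con (c b) * (\<Prod>a\<in>B - {b}. L a)) - (Con (c b) * g b) * (\<Prod>a\<in>B. L a)
        = (Con (c b) * (\<Prod>a\<in>B - {b}. L a)) * (h ^ k - g b * L b)"
        by (simp add: algebra_simps)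
      also have "\<dots> \<in> M" unfolding L_def
        using subs(2)[OF g[of b]] unfolding FB(1)[OF b] .
      finally show ?thesis .
    qed
    have "h ^ k * upoly v q = (\<Sum>b\<in>B. h ^ k * (Con (c b) * (\<Prod>a\<in>B - {b}. L a)))
        - (\<Sum>b\<in>B. Con (c b) * g b) * (\<Prod>a\<in>B. L a)"
      by (simp add: uq sum_distrib_left g0)
    also have "\<dots> = (\<Sum>b\<in>B. h ^ k * (Con (c b) * (\<Prod>a\<in>B - {b}. L a)) - (Con (c b) * g b) * (\<Prod>a\<in>B. L a))"
      by (simp add: sum_subtractf sum_distrib_right)
    also have "\<dots> \<in> M" by (rule idl.subspace_sum[OF sub]) (rule trm)
    finally have "upoly v q \<in> M" using prime hM by blast
    moreover have "q \<noteq> 0"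
    proof -
      obtain b where b: "b \<in> B" "c b \<noteq> 0" using c(1) by blast
      have "poly q b = (\<Sum>b'\<in>B. c b' * (\<Prod>a\<in>B - {b'}. b - a))"
        by (simp add: q_def poly_sum poly_prod)
      also have "\<dots> = (\<Sum>b'\<in>B. if b' = b then c b * (\<Prod>a\<in>B - {b}. b - a) else 0)"
        by (intro sum.cong refl) (use b B(1) in auto)
      also have "\<dots> = c b * (\<Prod>a\<in>B - {b}. b - a)" using b B(1) by simp
      also have "\<dots> \<noteq> 0" using b B(1) by auto
      finally show ?thesis by auto
    qed
    ultimately show False using root neg by blast
  qed
  then obtain z where z: "\<And>v. Var v - Con (z v) \<in> M" by metis
  \<comment> \<open>All variables are constants modulo \<open>M\<close>, hence so are all
    polynomials: each is congruent to its value at \<open>z\<close>.\<close>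
  have mon: "mon A 1 - Con (\<Prod>v\<in>#A. z v) \<in> M" for A
  proof (induction A)
    case empty
    then show ?case using idl.subspace_0[OF sub] by simp
  next
    case (add x A)
    have "mon (add_mset x A) 1 - Con (\<Prod>v\<in>#add_mset x A. z v) =
        mon A 1 * (Var x - Con (z x)) + Con (z x) * (mon A 1 - Con (\<Prod>v\<in>#A. z v))"
      by (simp add: algebra_simps mult_single)
    also have "\<dots> \<in> M"
      by (rule subs(1)[OF subs(2)[OF z] subs(2)[OF add]])
    finally show ?case .
  qed
  have all: "p - Con (ev (\<lambda>c. c) z p) \<in> M" for p
  proof -
    interpret c: comm_ring_hom "Con :: complex \<Rightarrow> ('v, complex) mpoly" by (rule Con_hom)
    have "p - Con (ev (\<lambda>c. c) z p) = (\<Sum>A\<in>keys p. Con (coef p A) * (mon A 1 - Con (\<Prod>v\<in>#A. z v)))"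
      by (subst (1) poly_expand[of p]) (simp add: ev_def c.hom_sum sum_subtractf right_diff_distrib mult_single)
    also have "\<dots> \<in> M" by (rule idl.subspace_sum[OF sub], rule subs(2), rule mon)
    finally show ?thesis .
  qed
  have "ev (\<lambda>c. c) z u = 0" if "u \<in> S" for u
  proof -
    have "u \<in> M" using that SM by blast
    then have "u - (u - Con (ev (\<lambda>c. c) z u)) \<in> M" using all by (rule subs(3))
    then show ?thesis using conM by simp
  qed
  moreover have "ev (\<lambda>c. c) z h \<noteq> 0" using all[of h] hM[of 1] by auto
  ultimately show thesis by (rule that)
qed

subsection \<open>Rational linear functionals\<close>

interpretation rat_vs: vector_space "\<lambda>q x. of_rat q * (x :: 'k::field_char_0)"
  by unfold_locales (auto simp: algebra_simps of_rat_add of_rat_mult)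

declare rat_vs.scale_scale [simp del]

text \<open>Coordinates for a basis of the field over the rationals that contains 1. The last clause
  makes \<open>phi 1\<close> a linear retraction to the rationals; for \<open>b\<close> outside the
  basis \<open>phi b\<close> is 0.\<close>

lemma rat_coordinates:
  obtains phi :: "'k::field_char_0 \<Rightarrow> 'k \<Rightarrow> rat" where
    "\<And>b x y. phi b (x + y) = phi b x + phi b y" "\<And>b q x. phi b (of_rat q * x) = q * phi b x"
    "\<And>x. finite {b. phi b x \<noteq> 0}" "\<And>x. (\<Sum>b | phi b x \<noteq> 0. of_rat (phi b x) * b) = x"
    "phi 1 1 = 1"
proof -
  have "rat_vs.independent {1 :: 'k}" by (simp add: rat_vs.dependent_single)
  then obtain B :: "'k set" where "{1} \<subseteq> B" "B \<subseteq> UNIV" "rat_vs.independent B" "UNIV \<subseteq> rat_vs.span B"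
    using rat_vs.maximal_independent_subset_extend[OF subset_UNIV] by blast
  then have B: "{1} \<subseteq> B" "rat_vs.independent B" "rat_vs.span B = UNIV" by auto
  define phi where "phi b x = rat_vs.representation B x b" for b x
  show thesis
  proof (rule that[of phi])
    show "phi b (x + y) = phi b x + phi b y" for b x y
      unfolding phi_def using B by (simp add: rat_vs.representation_add)
    show "phi b (of_rat q * x) = q * phi b x" for b q x
      unfolding phi_def using B by (simp add: rat_vs.representation_scale)
    show "finite {b. phi b x \<noteq> 0}" for x
      unfolding phi_def by (rule rat_vs.finite_representation)
    show "(\<Sum>b | phi b x \<noteq> 0. of_rat (phi b x) * b) = x" for x
      unfolding phi_def using B by (intro rat_vs.sum_nonzero_representation_eq) auto
    show "phi 1 1 = 1"
      unfolding phi_def using B by (simp add: rat_vs.representation_basis)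
  qed
qed

text \<open>Linearity over the rationals, applied to coefficients, becomes linearity over rational
  polynomials. This lets ideal membership descend from an extension field.\<close>

lemma mapc_mult_rational:
  fixes phi :: "'k::field_char_0 \<Rightarrow> rat" and g :: "('v, 'k) mpoly"
  assumes add: "\<And>x y. phi (x + y) = phi x + phi y" and scale: "\<And>q x. phi (of_rat q * x) = q * phi x"
  shows "mapc phi (g * mapc of_rat u) = mapc phi g * u"
proof -
  have phi0: "phi 0 = 0" using add[of 0 0] by simp
  have phis: "phi (sum f I) = (\<Sum>i\<in>I. phi (f i))" for f and I :: "'i set"
    by (induction I rule: infinite_finite_induct) (auto simp: phi0 add)
  have ms: "mapc phi (sum f I) = (\<Sum>i\<in>I. mapc phi (f i))" for f :: "'i \<Rightarrow> ('v, 'k) mpoly" and I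
    by (rule poly_mapping_eqI) (simp add: coef_mapc[where h = phi, OF phi0] lookup_sum phis)
  have mon: "mapc phi (mon A c) = mon A (phi c)" for A c
    by (rule poly_mapping_eqI) (simp add: coef_mapc[where h = phi, OF phi0] lookup_single when_def phi0)
  have "g * mapc of_rat u = (\<Sum>A\<in>keys g. \<Sum>B\<in>keys u. mon (A + B) (of_rat (coef u B) * coef g A))"
    by (subst (1) poly_expand[of g]) (simp add: mapc_def sum_product mult_single mult.commute)
  then have "mapc phi (g * mapc of_rat u) = (\<Sum>A\<in>keys g. \<Sum>B\<in>keys u. mon (A + B) (coef u B * phi (coef g A)))"
    by (simp add: ms mon scale)
  also have "\<dots> = (\<Sum>A\<in>keys g. mon A (phi (coef g A))) * (\<Sum>B\<in>keys u. mon B (coef u B))"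
    by (simp add: sum_product mult_single) (simp add: mult.commute)
  also have "(\<Sum>B\<in>keys u. mon B (coef u B)) = u"
    by (rule poly_expand[symmetric])
  finally show ?thesis by (simp add: mapc_def)
qed

text \<open>The complex theorem gives a combination with complex coefficient polynomials; the
  retraction \<open>phi 1\<close> of \<open>rat_coordinates\<close> makes them rational and leaves
  \<open>h\<close> and \<open>S\<close> alone.\<close>

theorem nullstellensatz_rat:
  fixes h :: "('v::countable, rat) mpoly"
  assumes van: "\<And>z :: 'v \<Rightarrow> complex. (\<And>u. u \<in> S \<Longrightarrow> ev of_rat z u = 0) \<Longrightarrow> ev of_rat z h = 0"
  shows "\<exists>k. h ^ k \<in> idl.span S"
proof -
  interpret r: comm_ring_hom "of_rat :: rat \<Rightarrow> complex" by (rule of_rat_hom.comm_ring_hom_axioms)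
  interpret m: comm_ring_hom "mapc of_rat :: ('v, rat) mpoly \<Rightarrow> ('v, complex) mpoly"
    by (rule mapc_hom) (rule of_rat_hom.comm_ring_hom_axioms)
  have "\<exists>k. (mapc of_rat h :: ('v, complex) mpoly) ^ k \<in> idl.span (mapc of_rat ` S)"
  proof (rule ccontr)
    assume "\<not> ?thesis"
    then obtain z where z: "\<And>u. u \<in> mapc of_rat ` S \<Longrightarrow> ev (\<lambda>c. c) z u = 0"
      "ev (\<lambda>c. c) z (mapc of_rat h) \<noteq> (0 :: complex)"
      using nullstellensatz_point[of "mapc of_rat h" "mapc of_rat ` S"] by blast
    have "ev of_rat z u = 0" if "u \<in> S" for u
      using z(1)[of "mapc of_rat u"] that by (simp add: ev_mapc)
    then show False using van[of z] z(2) by (simp add: ev_mapc)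
  qed
  then obtain k where "mapc of_rat (h ^ k) \<in> idl.span (mapc of_rat ` S :: ('v, complex) mpoly set)"
    by (auto simp: m.hom_power)
  then obtain T r where T: "finite T" "T \<subseteq> mapc of_rat ` S" and
    eq: "mapc of_rat (h ^ k) = (\<Sum>a\<in>T. r a * (a :: ('v, complex) mpoly))"
    unfolding idl.span_explicit by auto
  obtain phi :: "complex \<Rightarrow> complex \<Rightarrow> rat" where
    add: "\<And>b x y. phi b (x + y) = phi b x + phi b y" and scale: "\<And>b q x. phi b (of_rat q * x) = q * phi b x"
    and "\<And>x. finite {b. phi b x \<noteq> 0}" "\<And>x. (\<Sum>b | phi b x \<noteq> 0. of_rat (phi b x) * b) = x"
    and one: "phi 1 1 = 1"
    using rat_coordinates[where 'k = complex] by blast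
  have phi0: "phi 1 0 = 0" using add[of 1 0 0] by simp
  have phis: "phi 1 (sum f I) = (\<Sum>i\<in>I. phi 1 (f i))" for f and I :: "('v, complex) mpoly set"
    by (induction I rule: infinite_finite_induct) (auto simp: phi0 add)
  have ms: "mapc (phi 1) (sum f I) = (\<Sum>i\<in>I. mapc (phi 1) (f i))"
    for f :: "('v, complex) mpoly \<Rightarrow> ('v, complex) mpoly" and I
    by (rule poly_mapping_eqI) (simp add: coef_mapc[where h = "phi 1", OF phi0] lookup_sum phis)
  have of_rat1: "phi 1 (of_rat q) = q" for q using scale[of 1 q 1] one by simp
  have "h ^ k = mapc (phi 1) (mapc of_rat (h ^ k))"
    by (rule poly_mapping_eqI) (simp add: coef_mapc phi0 of_rat1)
  also have "\<dots> = (\<Sum>a\<in>T. mapc (phi 1) (r a * a))" by (simp add: eq ms)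
  also have "\<dots> \<in> idl.span S"
  proof (rule idl.span_sum)
    fix a assume "a \<in> T"
    then obtain u where "u \<in> S" "a = mapc of_rat u" using T by auto
    then show "mapc (phi 1) (r a * a) \<in> idl.span S"
      using mapc_mult_rational[where phi = "phi 1", OF add scale, of "r a" u] by (auto intro: idl.span_scale idl.span_base)
  qed
  finally show ?thesis by blast
qed

section \<open>Invariants of one degree cutting out the null cone\<close>

text \<open>The exponent of one variable \<open>x\<close> is determined by the others, each of which
  is at most \<open>e\<close>.\<close>

lemma card_Mon_le:
  assumes X: "finite X" "X \<noteq> {}"
  shows "card (Mon X e) \<le> (e + 1) ^ (card X - 1)"
proof -
  obtain x where x: "x \<in> X" using X by blast
  let ?F = "(X - {x}) \<rightarrow>\<^sub>E {..e}"
  let ?r = "\<lambda>A. restrict (count A) (X - {x})"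
  have "inj_on ?r (Mon X e)"
  proof
    fix A B assume A: "A \<in> Mon X e" and B: "B \<in> Mon X e" and eq: "?r A = ?r B"
    have cnt: "count A v = count B v" if "v \<noteq> x" for v
    proof (cases "v \<in> X")
      case True
      then show ?thesis using fun_cong[OF eq, of v] that by simp
    next
      case False
      then have "v \<notin># A" "v \<notin># B" using A B by (auto simp: Mon_def)
      then show ?thesis by (simp add: not_in_iff)
    qed
    have sz: "e = count C x + (\<Sum>v\<in>X - {x}. count C v)" if "C \<in> Mon X e" for C
    proof -
      have "e = (\<Sum>v\<in>X. count C v)"
        using sum_mset_count[OF X(1), of C "\<lambda>_. 1"] that by (auto simp: Mon_def)
      then show ?thesis using X x by (simp add: sum.remove)
    qed
    have "(\<Sum>v\<in>X - {x}. count A v) = (\<Sum>v\<in>X - {x}. count B v)"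
      by (intro sum.cong refl cnt) auto
    with sz[OF A] sz[OF B] have "count A x = count B x" by simp
    with cnt show "A = B" by (metis multiset_eqI)
  qed
  moreover have "?r ` Mon X e \<subseteq> ?F"
    by (auto simp: Mon_def PiE_iff count_le_size extensional_def split: if_splits)
  moreover have "finite ?F" using X by (intro finite_PiE) auto
  ultimately have "card (Mon X e) \<le> card ?F" by (metis card_inj_on_le)
  also have "\<dots> = (e + 1) ^ (card X - 1)" using X x by (simp add: card_PiE)
  finally show ?thesis .
qed

text \<open>The exponents other than that of \<open>x\<close> are chosen freely up to
  \<open>k\<close>, and \<open>x\<close> fills up the degree.\<close>

lemma card_Mon_ge:
  assumes X: "finite X" "x \<in> X"
  shows "(k + 1) ^ (card X - 1) \<le> card (Mon X (k * (card X - 1)))"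
proof -
  let ?D = "k * (card X - 1)"
  let ?F = "(X - {x}) \<rightarrow>\<^sub>E {..k}"
  define m where "m g = (\<Sum>v\<in>X - {x}. replicate_mset (g v) v)" for g :: "'a \<Rightarrow> nat"
  define r where "r g = m g + replicate_mset (?D - size (m g)) x" for g
  have cnt: "count (m g) v = (if v \<in> X - {x} then g v else 0)" for g v
    unfolding m_def using X by (simp add: count_sum)
  have sz: "size (m g) \<le> ?D" if "g \<in> ?F" for g
  proof -
    have "size (m g) = (\<Sum>v\<in>X - {x}. g v)" unfolding m_def by (simp add: size_multiset_sum)
    also have "\<dots> \<le> (\<Sum>v\<in>X - {x}. k)" by (intro sum_mono) (use that in auto)
    also have "\<dots> = ?D" using X by simp
    finally show ?thesis .
  qed
  have "inj_on r ?F"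
  proof
    fix g h assume g: "g \<in> ?F" and h: "h \<in> ?F" and eq: "r g = r h"
    show "g = h"
    proof (rule PiE_ext[OF g h])
      fix v assume "v \<in> X - {x}"
      then show "g v = h v" using arg_cong[OF eq, of "\<lambda>A. count A v"] by (simp add: r_def cnt)
    qed
  qed
  moreover have "r ` ?F \<subseteq> Mon X ?D"
  proof
    fix A assume "A \<in> r ` ?F"
    then obtain g where g: "g \<in> ?F" "A = r g" by blast
    have "set_mset (m g) \<subseteq> X" using cnt[of g] by (auto simp: count_greater_zero_iff[symmetric] split: if_splits)
    then show "A \<in> Mon X ?D" using sz[OF g(1)] X g(2) by (auto simp: Mon_def r_def)
  qed
  ultimately have "card ?F \<le> card (Mon X ?D)" using finite_Mon[OF X(1)] by (metis card_inj_on_le)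
  then show ?thesis using X by (simp add: card_PiE)
qed

text \<open>Growth comparison: the monomials of degree \<open>D\<close> in \<open>F\<close> grow
  with one power of \<open>D\<close> per element of \<open>F\<close> but one, and they take values
  in forms of degree \<open>D * d\<close>, whose dimension grows with exponent
  \<open>card X - 1\<close> only.\<close>

lemma algebraic_dependence:
  fixes F :: "('v, 'a::field) mpoly set"
  assumes X: "finite X" "X \<noteq> {}" and F: "finite F" "F \<subseteq> Form X d" "card X < card F" and d: "d > 0"
  obtains D P where "D > 0" "P \<in> Form F D" "P \<noteq> 0" "ev Con (\<lambda>f. f) P = 0"
proof -
  define nu where "nu = card X"
  define s where "s = card F - 1"
  have nu: "nu \<ge> 1" using X by (simp add: nu_def Suc_le_eq card_gt_0_iff)
  have s: "s \<ge> nu" using F(3) by (simp add: nu_def s_def)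
  define c where "c = s * d"
  \<comment> \<open>Chosen so that the factor \<open>c ^ (nu - 1)\<close>, lost in bounding the
    monomials of degree \<open>D * d\<close>, is exactly \<open>k\<close>; the additional factor
    \<open>k + 1\<close> on the other side outweighs it.\<close>
  define k where "k = c ^ (nu - 1)"
  define D where "D = k * s"
  have c: "c \<ge> 1" using s nu d by (simp add: c_def Suc_le_eq)
  have k: "k \<ge> 1" using c by (simp add: k_def)
  have "card (Mon X (D * d)) \<le> (k * c + 1) ^ (nu - 1)"
    using card_Mon_le[OF X, of "D * d"] by (simp add: D_def c_def nu_def mult_ac)
  also have "\<dots> \<le> (c * (k + 1)) ^ (nu - 1)"
    using c by (intro power_mono) (auto simp: algebra_simps)
  also have "\<dots> = k * (k + 1) ^ (nu - 1)" by (simp only: power_mult_distrib k_def[symmetric])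
  also have "\<dots> < (k + 1) * (k + 1) ^ (nu - 1)" by simp
  also have "\<dots> = (k + 1) ^ nu" using nu by (metis Suc_diff_1 Suc_le_eq One_nat_def power_Suc)
  also have "\<dots> \<le> (k + 1) ^ s" using s by (intro power_increasing) auto
  also have "\<dots> \<le> card (Mon F D)"
  proof -
    have "F \<noteq> {}" using F(3) by auto
    then obtain f where "f \<in> F" by blast
    then show ?thesis using card_Mon_ge[OF F(1), of f k] by (simp add: D_def s_def)
  qed
  finally have less: "card (Mon X (D * d)) < card (Mon F D)" .
  obtain a where a: "\<exists>\<alpha>\<in>Mon F D. a \<alpha> \<noteq> 0"
    "\<forall>A\<in>Mon X (D * d). (\<Sum>\<alpha>\<in>Mon F D. a \<alpha> * coef (\<Prod>\<^sub># \<alpha>) A) = 0"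
    using lin_dep[OF finite_Mon[OF F(1)] finite_Mon[OF X(1)] less, of "\<lambda>\<alpha>. coef (\<Prod>\<^sub># \<alpha>)"] by blast
  define P where "P = (\<Sum>\<alpha>\<in>Mon F D. mon \<alpha> (a \<alpha>))"
  have cP: "coef P \<alpha> = (if \<alpha> \<in> Mon F D then a \<alpha> else 0)" for \<alpha>
    unfolding P_def using finite_Mon[OF F(1)] by (simp add: lookup_sum lookup_single when_def)
  show thesis
  proof (rule that)
    show "D > 0" using k s nu by (simp add: D_def)
    show "P \<in> Form F D" unfolding P_def by (intro Form_sum Form_single)
    show "P \<noteq> 0" using a(1) cP by (metis lookup_zero)
    have "ev Con (\<lambda>f. f) P = (\<Sum>\<alpha>\<in>Mon F D. Con (coef P \<alpha>) * (\<Prod>f\<in>#\<alpha>. f))"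
      by (rule ev_superset) (use finite_Mon[OF F(1)] cP in \<open>auto simp: in_keys_iff split: if_splits\<close>)
    also have "\<dots> = (\<Sum>\<alpha>\<in>Mon F D. Con (a \<alpha>) * (\<Prod>\<^sub># \<alpha>))"
      by (intro sum.cong) (auto simp: cP)
    also have "\<dots> = 0"
    proof (rule poly_mapping_eqI)
      fix A
      have form: "\<Prod>\<^sub># \<alpha> \<in> Form X (D * d)" if "\<alpha> \<in> Mon F D" for \<alpha>
        using Form_prod_mset[of \<alpha> "\<lambda>f. f" X "\<lambda>_. d"] that F(2) by (auto simp: Mon_def)
      show "coef (\<Sum>\<alpha>\<in>Mon F D. Con (a \<alpha>) * (\<Prod>\<^sub># \<alpha>)) A = coef 0 A"
      proof (cases "A \<in> Mon X (D * d)")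
        case True
        then show ?thesis using a(2) by (simp add: lookup_sum coef_Con_mult)
      next
        case False
        then have "coef (\<Prod>\<^sub># \<alpha>) A = 0" if "\<alpha> \<in> Mon F D" for \<alpha>
          using form[OF that] by (auto simp: Form_def in_keys_iff)
        then show ?thesis by (simp add: lookup_sum coef_Con_mult)
      qed
    qed
    finally show "ev Con (\<lambda>f. f) P = 0" .
  qed
qed

text \<open>The geometric input is stated at complex points because
  \<open>nullstellensatz_rat\<close> turns vanishing there into membership of a power in a rational
  ideal.\<close>

locale nullcone = invariants X Ms
  for X :: "'v::{wellorder, countable} set" and Ms :: "('v \<Rightarrow> 'v \<Rightarrow> rat) set" +
  fixes d :: nat
  assumes d: "d > 0" and Xne: "X \<noteq> {}"
    and nullcone: "\<And>(z :: 'v \<Rightarrow> complex) h e. (\<And>u. u \<in> R d \<Longrightarrow> ev of_rat z u = 0) \<Longrightarrow> h \<in> R e \<Longrightarrow> e > 0 \<Longrightarrow>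
      ev of_rat z h = 0"
begin

lemma mp_span_idl: "x \<in> mp.span B \<Longrightarrow> B \<subseteq> idl.span S \<Longrightarrow> x \<in> idl.span S"
proof (induction rule: mp.span_induct_alt)
  case (step c x y)
  then show ?case by (intro idl.span_add idl.span_scale) auto
qed (rule idl.span_zero)

lemma mp_span_mult:
  assumes "x \<in> mp.span B" "\<And>b. b \<in> B \<Longrightarrow> h * b \<in> mp.span C"
  shows "h * x \<in> mp.span C"
  using assms(1)
proof (induction rule: mp.span_induct_alt)
  case (step c x y)
  then show ?case
    using mp.span_add[OF mp.span_scale[OF assms(2), of x c] step.IH] by (simp add: algebra_simps)
qed (simp add: mp.span_zero)

text \<open>Hilbert's argument: ideal generators of the invariants of positive degree generate the
  algebra, since \<open>reynolds\<close> makes the coefficients invariant and these have smaller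
  degree.\<close>

lemma generators:
  obtains H deg where "finite H" "\<And>h. h \<in> H \<Longrightarrow> h \<in> R (deg h) \<and> deg h > 0"
    "\<And>f e. f \<in> R e \<Longrightarrow> f \<in> mp.span {\<Prod>\<^sub># \<alpha> | \<alpha>. set_mset \<alpha> \<subseteq> H \<and> (\<Sum>h\<in>#\<alpha>. deg h) = e}"
proof -
  define S where "S = (\<Union>e\<in>{0<..}. R e)"
  have "\<exists>T. finite T \<and> T \<subseteq> S \<and> S \<subseteq> idl.span T"
  proof (rule hilbert_basis[OF finX, of S])
    fix p A assume "p \<in> S" "A \<in> keys p"
    then obtain e where "p \<in> Form X e" using R_Form by (auto simp: S_def)
    then show "set_mset A \<subseteq> X" using \<open>A \<in> keys p\<close> by (auto simp: Form_def Mon_def)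
  qed blast
  then obtain H where H: "finite H" "H \<subseteq> S" "S \<subseteq> idl.span H" by blast
  have "\<forall>h. \<exists>e. h \<in> H \<longrightarrow> h \<in> R e \<and> e > 0" using H(2) by (auto simp: S_def)
  then obtain deg where deg: "\<And>h. h \<in> H \<Longrightarrow> h \<in> R (deg h) \<and> deg h > 0" by metis
  let ?P = "\<lambda>e. {\<Prod>\<^sub># \<alpha> | \<alpha>. set_mset \<alpha> \<subseteq> H \<and> (\<Sum>h\<in>#\<alpha>. deg h) = e}"
  have "f \<in> mp.span (?P e)" if "f \<in> R e" for f e
    using that
  proof (induction e arbitrary: f rule: less_induct)
    case (less e)
    show ?case
    proof (cases "e = 0")
      case True
      have "keys f \<subseteq> {{#}}" using R_Form[OF less.prems] True by (auto simp: Form_def Mon_def)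
      then have f: "f = Con (coef f {#}) * 1"
        by (subst (1) poly_expand[of f]) (auto simp: in_keys_iff subset_singleton_iff)
      have "1 \<in> ?P e" using True by (auto intro!: exI[of _ "{#}"])
      then have "Con (coef f {#}) * 1 \<in> mp.span (?P e)" by (intro mp.span_scale mp.span_base)
      then show ?thesis by (subst f)
    next
      case False
      then have "f \<in> idl.span H" using less.prems H(3) by (auto simp: S_def)
      then obtain r where r: "f = (\<Sum>h\<in>H. h * r h)" "\<And>h. h \<in> H \<Longrightarrow> r h \<in> R (e - deg h)"
        "\<And>h. h \<in> H \<Longrightarrow> e < deg h \<Longrightarrow> r h = 0"
        using reynolds[OF H(1) _ less.prems, of deg] deg by blast
      have "h * r h \<in> mp.span (?P e)" if h: "h \<in> H" for h
      proof (cases "e < deg h")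
        case True
        then show ?thesis using r(3)[OF h] by (simp add: mp.span_zero)
      next
        case le: False
        have "e - deg h < e" using deg[OF h] False by simp
        from less.IH[OF this r(2)[OF h]] show ?thesis
        proof (rule mp_span_mult)
          fix b assume "b \<in> ?P (e - deg h)"
          then obtain \<alpha> where \<alpha>: "b = \<Prod>\<^sub># \<alpha>" "set_mset \<alpha> \<subseteq> H" "(\<Sum>h\<in>#\<alpha>. deg h) = e - deg h" by blast
          then have "h * b \<in> ?P e" using h le by (intro CollectI exI[of _ "add_mset h \<alpha>"]) auto
          then show "h * b \<in> mp.span (?P e)" by (rule mp.span_base)
        qed
      qed
      then show ?thesis unfolding r(1) by (rule mp.span_sum)
    qed
  qed
  with H deg that show thesis by blast
qed

text \<open>Algebraic substitute for cutting out the null cone: the ideal of \<open>F\<close>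
  contains all invariants of sufficiently large degree.\<close>

definition cuts :: "('v, rat) mpoly set \<Rightarrow> bool" where
  "cuts F \<longleftrightarrow> finite F \<and> F \<subseteq> R d \<and> (\<exists>E. \<forall>e>E. R e \<subseteq> idl.span F)"

text \<open>Some power of each algebra generator lies in the ideal of \<open>R d\<close> by the
  Nullstellensatz. A product of generators of degree above \<open>E\<close> contains one of these
  powers.\<close>

lemma cuts_exists: "\<exists>F. cuts F"
proof -
  obtain H deg where H: "finite H" "\<And>h. h \<in> H \<Longrightarrow> h \<in> R (deg h) \<and> deg h > 0"
    "\<And>f e. f \<in> R e \<Longrightarrow> f \<in> mp.span {\<Prod>\<^sub># \<alpha> | \<alpha>. set_mset \<alpha> \<subseteq> H \<and> (\<Sum>h\<in>#\<alpha>. deg h) = e}"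
    using generators by blast
  have "\<exists>k. h ^ k \<in> idl.span (R d)" if "h \<in> H" for h
    by (rule nullstellensatz_rat) (use nullcone H(2)[OF that] in blast)
  then obtain kk where kk: "\<And>h. h \<in> H \<Longrightarrow> h ^ kk h \<in> idl.span (R d)" by metis
  obtain F where F: "finite F" "F \<subseteq> R d" "(\<lambda>h. h ^ kk h) ` H \<subseteq> idl.span F"
    using idl_finite_support[of "(\<lambda>h. h ^ kk h) ` H" "R d"] H(1) kk by blast
  define E where "E = (\<Sum>h\<in>H. kk h * deg h)"
  have "f \<in> idl.span F" if "f \<in> R e" "e > E" for f e
    using H(3)[OF that(1)]
  proof (rule mp_span_idl)
    show "{\<Prod>\<^sub># \<alpha> | \<alpha>. set_mset \<alpha> \<subseteq> H \<and> (\<Sum>h\<in>#\<alpha>. deg h) = e} \<subseteq> idl.span F"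
    proof clarify
      fix \<alpha> assume \<alpha>: "set_mset \<alpha> \<subseteq> H" "e = (\<Sum>h\<in>#\<alpha>. deg h)"
      have "\<exists>h\<in>H. kk h \<le> count \<alpha> h"
      proof (rule ccontr)
        assume "\<not> ?thesis"
        then have "(\<Sum>h\<in>H. count \<alpha> h * deg h) \<le> E"
          unfolding E_def by (intro sum_mono mult_right_mono) (auto simp: not_le less_imp_le)
        then show False using sum_mset_count[OF H(1) \<alpha>(1), of deg] \<alpha>(2) that(2) by simp
      qed
      then obtain h where h: "h \<in> H" "kk h \<le> count \<alpha> h" by blast
      then have "\<alpha> = (\<alpha> - replicate_mset (kk h) h) + replicate_mset (kk h) h"
        by (simp add: count_le_replicate_mset_subset_eq)
      then have "\<Prod>\<^sub># \<alpha> = \<Prod>\<^sub># (\<alpha> - replicate_mset (kk h) h) * h ^ kk h"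
        by (metis prod_mset_Un prod_mset_replicate_mset)
      then show "\<Prod>\<^sub># \<alpha> \<in> idl.span F" using F(3) h(1) by (auto intro: idl.span_scale)
    qed
  qed
  then have "\<forall>e>E. R e \<subseteq> idl.span F" by blast
  with F(1,2) have "cuts F" unfolding cuts_def by (intro conjI exI[of _ E])
  then show ?thesis ..
qed

text \<open>One step of Noether reduction. Modulo the ideal \<open>J\<close> of the new, smaller set
  every \<open>f\<close> is a multiple \<open>c f\<close> of \<open>f0\<close>, so the homogeneous
  relation \<open>P\<close> becomes \<open>P(c)\<close> times \<open>f0 ^ D\<close>. The
  coefficients are chosen with \<open>P(c)\<close> nonzero; hence \<open>f0 ^ D\<close> lies in
  \<open>J\<close>.\<close>

lemma cuts_reduce:
  assumes F: "cuts F" and card: "card X < card F"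
  shows "\<exists>F'. cuts F' \<and> card F' < card F"
proof -
  from F obtain E where fin: "finite F" and FR: "F \<subseteq> R d" and E: "\<And>e. e > E \<Longrightarrow> R e \<subseteq> idl.span F"
    by (auto simp: cuts_def)
  have "F \<subseteq> Form X d" using FR R_Form by blast
  then obtain D P where DP: "D > 0" "P \<in> Form F D" "P \<noteq> 0" "ev Con (\<lambda>f. f) P = 0"
    using algebraic_dependence[OF finX Xne fin _ card d] by blast
  obtain a where a: "ev (\<lambda>c. c) a P \<noteq> 0" using zero_test DP(3) by blast
  have "\<exists>f\<in>F. a f \<noteq> 0"
  proof (rule ccontr)
    assume neg: "\<not> ?thesis"
    have "(\<Prod>f\<in>#\<alpha>. a f) = 0" if "\<alpha> \<in> keys P" for \<alpha>
    proof -
      have "\<alpha> \<in> Mon F D" using DP(2) that by (auto simp: Form_def)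
      then have "set_mset \<alpha> \<subseteq> F" "\<alpha> \<noteq> {#}" using DP(1) by (auto simp: Mon_def)
      then obtain f where "f \<in># \<alpha>" "f \<in> F" by (meson multiset_nonemptyE subsetD)
      then show ?thesis using neg by auto
    qed
    then have "ev (\<lambda>c. c) a P = 0"
      unfolding ev_def by (intro sum.neutral ballI) (simp only: mult_zero_right)
    then show False using a by simp
  qed
  then obtain f0 where f0: "f0 \<in> F" "a f0 \<noteq> 0" by blast
  \<comment> \<open>Normalised to \<open>c f0 = 1\<close>, so that \<open>f0\<close> itself drops
    out of the new set.\<close>
  define c where "c f = a f / a f0" for f
  define F' where "F' = (\<lambda>f. f - Con (c f) * f0) ` (F - {f0})"
  define J where "J = idl.span F'"
  have F'R: "F' \<subseteq> R d" using FR f0 by (auto simp: F'_def intro!: R_diff R_scale)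
  have cF': "card F' < card F"
  proof -
    have "card F' \<le> card (F - {f0})" unfolding F'_def using fin by (intro card_image_le) auto
    also have "\<dots> < card F" using fin f0 by (meson card_Diff1_less)
    finally show ?thesis .
  qed
  note J = idl.span_add[of _ F', folded J_def] idl.span_scale[of _ F', folded J_def]
    idl.span_sum[of _ _ F', folded J_def] idl.span_diff[of _ F', folded J_def]
  have fJ: "f - Con (c f) * f0 \<in> J" if "f \<in> F" for f
  proof (cases "f = f0")
    case True
    then show ?thesis using f0 by (simp add: c_def J_def idl.span_zero)
  next
    case False
    then show ?thesis unfolding J_def F'_def using that by (intro idl.span_base) auto
  qed
  have prodJ: "\<Prod>\<^sub># \<alpha> - Con (\<Prod>f\<in>#\<alpha>. c f) * f0 ^ size \<alpha> \<in> J" if "set_mset \<alpha> \<subseteq> F" for \<alpha>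
    using that
  proof (induction \<alpha>)
    case empty
    then show ?case by (simp add: J_def idl.span_zero)
  next
    case (add f \<alpha>)
    have con: "(Con (x * y) :: ('v, rat) mpoly) = Con x * Con y" for x y by (simp add: mult_single)
    have "\<Prod>\<^sub># (add_mset f \<alpha>) - Con (\<Prod>f\<in>#add_mset f \<alpha>. c f) * f0 ^ size (add_mset f \<alpha>) =
      f * (\<Prod>\<^sub># \<alpha> - Con (\<Prod>f\<in>#\<alpha>. c f) * f0 ^ size \<alpha>)
        + (Con (\<Prod>f\<in>#\<alpha>. c f) * f0 ^ size \<alpha>) * (f - Con (c f) * f0)"
      by (simp add: con algebra_simps)
    also have "\<dots> \<in> J" using add fJ[of f] by (intro J(1) J(2)) auto
    finally show ?case .
  qed
  have "ev Con (\<lambda>f. f) P - Con (ev (\<lambda>x. x) c P) * f0 ^ D \<in> J"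
  proof -
    interpret Con: comm_ring_hom "Con :: rat \<Rightarrow> ('v, rat) mpoly" by (rule Con_hom)
    have "ev Con (\<lambda>f. f) P - Con (ev (\<lambda>x. x) c P) * f0 ^ D =
      (\<Sum>\<alpha>\<in>keys P. Con (coef P \<alpha>) * (\<Prod>\<^sub># \<alpha> - Con (\<Prod>f\<in>#\<alpha>. c f) * f0 ^ D))"
      by (simp add: ev_def Con.hom_sum Con.hom_mult sum_distrib_right right_diff_distrib sum_subtractf mult.assoc)
    also have "\<dots> \<in> J"
    proof (intro J(3) J(2))
      fix \<alpha> assume "\<alpha> \<in> keys P"
      then have "\<alpha> \<in> Mon F D" using DP(2) by (auto simp: Form_def)
      then show "\<Prod>\<^sub># \<alpha> - Con (\<Prod>f\<in>#\<alpha>. c f) * f0 ^ D \<in> J"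
        using prodJ[of \<alpha>] by (auto simp: Mon_def)
    qed
    finally show ?thesis .
  qed
  moreover have ne: "ev (\<lambda>x. x) c P \<noteq> 0"
  proof -
    have "ev (\<lambda>x. x) a P = ev (\<lambda>x. x) (\<lambda>f. a f0 * c f) P" using f0 by (simp add: c_def)
    also have "\<dots> = a f0 ^ D * ev (\<lambda>x. x) c P" by (rule ev_Form_scale[OF DP(2) hom_id])
    finally show ?thesis using a by auto
  qed
  ultimately have "Con (- inverse (ev (\<lambda>x. x) c P)) * (0 - Con (ev (\<lambda>x. x) c P) * f0 ^ D) \<in> J"
    using J(2) DP(4) by metis
  moreover have "Con (- inverse (ev (\<lambda>x. x) c P)) * (0 - Con (ev (\<lambda>x. x) c P) * f0 ^ D) = f0 ^ D"
  proof -
    have "Con (- inverse (ev (\<lambda>x. x) c P)) * (Con (ev (\<lambda>x. x) c P) * f0 ^ D) = - (f0 ^ D)"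
      using ne by (simp add: mult_single single_uminus flip: mult.assoc)
    then show ?thesis by simp
  qed
  ultimately have f0D: "f0 ^ D \<in> J" by (simp only:)
  \<comment> \<open>Modulo \<open>J\<close>, an invariant of large degree is \<open>f0\<close> times
    an invariant whose degree is lower by \<open>d\<close>. After \<open>D\<close> such steps the
    power of \<open>f0\<close> lies in \<open>J\<close>; this lowers the degree by
    \<open>D * d\<close> and explains the new threshold \<open>E + D * d\<close>.\<close>
  have step: "\<exists>g\<in>R (e - j * d). f - f0 ^ j * g \<in> J" if "f \<in> R e" "e > E + j * d" for f e j
    using that
  proof (induction j arbitrary: f e)
    case 0
    then show ?case by (intro bexI[of _ f]) (auto simp: J_def idl.span_zero)
  next
    case (Suc j)
    have eE: "e > E" and ed: "e - d > E + j * d" using Suc.prems by auto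
    obtain r where r: "f = (\<Sum>h\<in>F. h * r h)" "\<And>h. h \<in> F \<Longrightarrow> r h \<in> R (e - d)"
      using reynolds[of F "\<lambda>_. d" f e] fin FR Suc.prems(1) E[OF eE] by blast
    define g where "g = (\<Sum>h\<in>F. Con (c h) * r h)"
    have g: "g \<in> R (e - d)" unfolding g_def by (intro R_sum R_scale r(2))
    have "f - f0 * g = (\<Sum>h\<in>F. r h * (h - Con (c h) * f0))"
      by (simp add: r(1) g_def sum_distrib_left algebra_simps sum_subtractf)
    also have "\<dots> \<in> J" by (intro J(3) J(2) fJ)
    finally have 1: "f - f0 * g \<in> J" .
    obtain g' where g': "g' \<in> R (e - d - j * d)" "g - f0 ^ j * g' \<in> J" using Suc.IH[OF g ed] by blast
    have "f - f0 ^ Suc j * g' = (f - f0 * g) + f0 * (g - f0 ^ j * g')" by (simp add: algebra_simps)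
    also have "\<dots> \<in> J" using 1 g' by (intro J(1) J(2))
    finally show ?case using g' by (intro bexI[of _ g']) (auto simp: algebra_simps)
  qed
  have "R e \<subseteq> J" if e: "e > E + D * d" for e
  proof
    fix f assume "f \<in> R e"
    then obtain g where "f - f0 ^ D * g \<in> J" using step[OF _ e] by blast
    moreover have "g * f0 ^ D \<in> J" by (rule J(2)[OF f0D])
    ultimately have "(f - f0 ^ D * g) + g * f0 ^ D \<in> J" by (rule J(1))
    then show "f \<in> J" by (simp add: mult.commute)
  qed
  then have "cuts F'" unfolding cuts_def using F'R fin by (auto simp: F'_def J_def intro!: exI[of _ "E + D * d"])
  with cF' show ?thesis by blast
qed

lemma cuts_small: "\<exists>F. cuts F \<and> card F \<le> card X"
proof -
  obtain F where "cuts F" "\<And>F'. cuts F' \<Longrightarrow> card F \<le> card F'"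
    using cuts_exists arg_min_natI[of cuts _ card] arg_min_nat_le[of cuts _ card] by metis
  then show ?thesis using cuts_reduce by (meson not_le)
qed

end

section \<open>Reduction modulo primes\<close>

interpretation zm: Modules.module "\<lambda>c (p :: ('v, int) mpoly). Con c * p"
proof unfold_locales
  fix a b :: int and x y :: "('v, int) mpoly"
  show "Con a * (x + y) = Con a * x + Con a * y" by (rule distrib_left)
  show "Con (a + b) * x = Con a * x + Con b * x" by (simp add: single_add distrib_right)
  show "Con a * (Con b * x) = Con (a * b) * x" by (simp add: mult_single flip: mult.assoc)
  show "Con 1 * x = x" by simp
qed

declare zm.scale_scale [simp del] single_of_int [simp del] single_of_nat [simp del]

abbreviation ip :: "('v, int) mpoly \<Rightarrow> ('v, rat) mpoly" where
  "ip \<equiv> mapc of_int"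

lemma ip_hom: "comm_ring_hom (ip :: ('v, int) mpoly \<Rightarrow> _)"
  by (rule mapc_hom, rule of_int_hom.comm_ring_hom_axioms)

lemma coef_ip: "coef (ip p) A = of_int (coef p A)"
  by (rule coef_mapc) simp

lemma ip_inj: "ip p = ip q \<longleftrightarrow> p = q"
  by (auto simp: poly_mapping_eq_iff coef_ip fun_eq_iff)

lemma keys_ip: "keys (ip p) = keys p"
  by (auto simp: in_keys_iff coef_ip)

lemma ip_Form: "ip p \<in> Form X e \<longleftrightarrow> p \<in> Form X e"
  by (simp add: Form_def keys_ip)

lemma ip_Con: "ip (Con c) = Con (of_int c)"
  by (rule poly_mapping_eqI) (simp add: coef_ip lookup_single when_def)

lemma pair_ip: "pair (ip p) (ip q) = of_int (pair p q)"
  by (simp add: pair_def keys_ip coef_ip)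

lemma clear_denominators:
  assumes "finite (T :: rat set)"
  shows "\<exists>N::int. N > 0 \<and> (\<forall>r\<in>T. of_int N * r \<in> \<int>)"
  using assms
proof (induction T rule: finite_induct)
  case (insert r T)
  then obtain N where N: "N > 0" "\<forall>r\<in>T. of_int N * r \<in> \<int>" by blast
  obtain a b where ab: "quotient_of r = (a, b)" by (cases "quotient_of r")
  have b: "b > 0" using quotient_of_denom_pos[OF ab] .
  have r: "of_int b * r = of_int a" using quotient_of_div[OF ab] b by simp
  have "of_int (b * N) * s \<in> \<int>" if "s \<in> insert r T" for s
  proof (cases "s = r")
    case True
    have "of_int (b * N) * r = of_int (N * a)" by (simp add: mult.commute[of "of_int N"] mult.assoc flip: r)
    then show ?thesis using True by (metis Ints_of_int)
  next
    case False
    then have "of_int N * s \<in> \<int>" using that N by blast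
    then have "of_int b * (of_int N * s) \<in> \<int>" by (rule Ints_mult[OF Ints_of_int])
    then show ?thesis by (simp only: of_int_mult mult.assoc)
  qed
  then show ?case using N(1) b by (intro exI[of _ "b * N"]) auto
qed (auto intro: exI[of _ 1])

lemma clear_denominators_poly:
  assumes "finite (S :: ('v, rat) mpoly set)"
  obtains N :: int where "N > 0" "\<And>p. p \<in> S \<Longrightarrow> \<exists>q. Con (of_int N) * p = ip q"
proof -
  have "finite (\<Union>p\<in>S. coef p ` keys p)" using assms by auto
  then obtain N :: int where N: "N > 0" "\<forall>r\<in>(\<Union>p\<in>S. coef p ` keys p). of_int N * r \<in> \<int>"
    using clear_denominators by blast
  have "\<exists>q. Con (of_int N) * p = ip q" if p: "p \<in> S" for p
  proof (intro exI[of _ "mapc (\<lambda>r. \<lfloor>of_int N * r\<rfloor>) p"] poly_mapping_eqI)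
    fix A
    have "of_int N * coef p A \<in> \<int>"
      using N(2) p by (cases "A \<in> keys p") (auto simp: in_keys_iff)
    then show "coef (Con (of_int N) * p) A = coef (ip (mapc (\<lambda>r. \<lfloor>of_int N * r\<rfloor>) p)) A"
      by (simp add: coef_Con_mult coef_ip coef_mapc)
  qed
  with N(1) that show thesis by blast
qed

text \<open>Rational relations become integral after multiplication by one positive integer, which
  is invertible modulo every prime that does not divide it.\<close>

lemma integral_span:
  assumes S: "finite S" and x: "ip x \<in> mp.span (ip ` S)"
  obtains L :: int where "L > 0" "Con L * x \<in> zm.span S"
proof -
  interpret ip: comm_ring_hom "ip :: ('a, int) mpoly \<Rightarrow> _" by (rule ip_hom)
  obtain c where c: "ip x = (\<Sum>b\<in>ip ` S. Con (c b) * b)"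
    using x S unfolding mp.span_finite[OF finite_imageI[OF S]] by auto
  then have x: "ip x = (\<Sum>s\<in>S. Con (c (ip s)) * ip s)"
    by (subst (asm) sum.reindex) (auto simp: inj_on_def ip_inj)
  obtain L :: int where L: "L > 0" "\<forall>r\<in>(\<lambda>s. c (ip s)) ` S. of_int L * r \<in> \<int>"
    using clear_denominators[of "(\<lambda>s. c (ip s)) ` S"] S by blast
  then have "\<forall>s\<in>S. \<exists>n. of_int L * c (ip s) = of_int n" by (auto elim: Ints_cases)
  then obtain n where n: "\<And>s. s \<in> S \<Longrightarrow> of_int L * c (ip s) = of_int (n s)" by metis
  have "ip (Con L * x) = (\<Sum>s\<in>S. Con (of_int L * c (ip s)) * ip s)"
    by (simp add: ip.hom_mult ip_Con x sum_distrib_left mult_single flip: mult.assoc)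
  also have "\<dots> = (\<Sum>s\<in>S. Con (of_int (n s)) * ip s)" by (intro sum.cong) (simp_all add: n)
  also have "\<dots> = ip (\<Sum>s\<in>S. Con (n s) * s)"
    by (simp add: ip.hom_sum ip.hom_mult ip_Con)
  finally have "Con L * x = (\<Sum>s\<in>S. Con (n s) * s)" by (simp add: ip_inj)
  also have "\<dots> \<in> zm.span S" by (intro zm.span_sum zm.span_scale zm.span_base)
  finally show thesis using that L(1) by blast
qed

subsection \<open>Frobenius modulo a prime\<close>

text \<open>Congruence modulo a prime is expressed as divisibility of a difference in the integral
  polynomial ring, so no polynomials over residue fields appear. These are its rules of
  calculation.\<close>

lemma dvd_diff_trans: "(m::'a::comm_ring_1) dvd a - b \<Longrightarrow> m dvd b - c \<Longrightarrow> m dvd a - c"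
  using dvd_add[of m "a - b" "b - c"] by simp

lemma dvd_diff_mult: "(m::'a::comm_ring_1) dvd a - b \<Longrightarrow> m dvd c - d \<Longrightarrow> m dvd a * c - b * d"
proof -
  assume "m dvd a - b" "m dvd c - d"
  then have "m dvd (a - b) * c + b * (c - d)" by (intro dvd_add dvd_mult dvd_mult2)
  then show ?thesis by (simp add: algebra_simps)
qed

lemma dvd_diff_power: "(m::'a::comm_ring_1) dvd a - b \<Longrightarrow> m dvd a ^ k - b ^ k"
  by (induction k) (auto intro: dvd_diff_mult)

lemma dvd_diff_sum:
  "(\<And>i. i \<in> I \<Longrightarrow> (m::'a::comm_ring_1) dvd f i - g i) \<Longrightarrow> m dvd sum f I - sum g I"
  using dvd_sum[of I m "\<lambda>i. f i - g i"] by (simp add: sum_subtractf)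

lemma frobenius_add:
  fixes a b :: "'a::comm_ring_1"
  assumes p: "prime p"
  shows "of_nat p dvd (a + b) ^ p - (a ^ p + b ^ p)"
proof -
  have p1: "p > 0" using p prime_gt_0_nat by blast
  have "(a + b) ^ p = (\<Sum>k\<le>p. of_nat (p choose k) * a ^ k * b ^ (p - k))" by (rule binomial_ring)
  also have "{..p} = insert 0 (insert p {1..<p})" using p1 by auto
  also have "(\<Sum>k\<in>insert 0 (insert p {1..<p}). of_nat (p choose k) * a ^ k * b ^ (p - k))
      = b ^ p + (a ^ p + (\<Sum>k\<in>{1..<p}. of_nat (p choose k) * a ^ k * b ^ (p - k)))"
    using p1 by simp
  finally have "(a + b) ^ p - (a ^ p + b ^ p) = (\<Sum>k\<in>{1..<p}. of_nat (p choose k) * a ^ k * b ^ (p - k))"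
    by simp
  also have "of_nat p dvd \<dots>"
  proof (rule dvd_sum)
    fix k assume "k \<in> {1..<p}"
    then have "p dvd p choose k" using p by (intro dvd_choose_prime) auto
    then have "of_nat p dvd (of_nat (p choose k) :: 'a)" by (auto simp: dvd_def)
    then show "of_nat p dvd of_nat (p choose k) * a ^ k * b ^ (p - k)" by (intro dvd_mult2)
  qed
  finally show ?thesis .
qed

lemma frobenius_add_iter:
  fixes a b :: "'a::comm_ring_1"
  assumes p: "prime p"
  shows "of_nat p dvd (a + b) ^ (p ^ n) - (a ^ (p ^ n) + b ^ (p ^ n))"
proof (induction n)
  case (Suc n)
  have "of_nat p dvd ((a + b) ^ (p ^ n)) ^ p - (a ^ (p ^ n) + b ^ (p ^ n)) ^ p"
    by (rule dvd_diff_power[OF Suc])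
  moreover have "of_nat p dvd (a ^ (p ^ n) + b ^ (p ^ n)) ^ p - ((a ^ (p ^ n)) ^ p + (b ^ (p ^ n)) ^ p)"
    by (rule frobenius_add[OF p])
  ultimately have "of_nat p dvd ((a + b) ^ (p ^ n)) ^ p - ((a ^ (p ^ n)) ^ p + (b ^ (p ^ n)) ^ p)"
    by (rule dvd_diff_trans)
  then show ?case by (simp only: power_Suc2 power_mult)
qed simp

lemma frobenius_sum:
  fixes f :: "'i \<Rightarrow> 'a::comm_ring_1"
  assumes p: "prime p" and "finite I"
  shows "of_nat p dvd (sum f I) ^ (p ^ n) - (\<Sum>i\<in>I. f i ^ (p ^ n))"
  using assms(2)
proof (induction I rule: finite_induct)
  case empty
  then show ?case using prime_gt_0_nat[OF p] by (simp add: zero_power)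
next
  case (insert i I)
  have "of_nat p dvd (f i + sum f I) ^ (p ^ n) - (f i ^ (p ^ n) + sum f I ^ (p ^ n))"
    by (rule frobenius_add_iter[OF p])
  moreover have "of_nat p dvd (f i ^ (p ^ n) + sum f I ^ (p ^ n)) - (f i ^ (p ^ n) + (\<Sum>i\<in>I. f i ^ (p ^ n)))"
    using insert by simp
  ultimately have "of_nat p dvd (f i + sum f I) ^ (p ^ n) - (f i ^ (p ^ n) + (\<Sum>i\<in>I. f i ^ (p ^ n)))"
    by (rule dvd_diff_trans)
  with insert show ?case by simp
qed

text \<open>Fermat's little theorem, by induction on natural numbers through additivity of
  Frobenius; a residue then covers negative integers.\<close>

lemma fermat_iter:
  assumes p: "prime p"
  shows "int p dvd c ^ (p ^ n) - c"
proof -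
  have nat: "int p dvd int k ^ (p ^ n) - int k" for k
  proof (induction k)
    case 0
    then show ?case using prime_gt_0_nat[OF p] by (simp add: zero_power)
  next
    case (Suc k)
    have "int p dvd (int k + 1) ^ (p ^ n) - (int k ^ (p ^ n) + 1 ^ (p ^ n))"
      using frobenius_add_iter[OF p, of "int k" 1 n] by simp
    moreover have "int p dvd (int k ^ (p ^ n) + 1 ^ (p ^ n)) - (int k + 1)" using Suc by simp
    ultimately have "int p dvd (int k + 1) ^ (p ^ n) - (int k + 1)" by (rule dvd_diff_trans)
    then show ?case by (simp add: add.commute)
  qed
  define k where "k = nat (c mod int p)"
  have k: "int p dvd c - int k"
    using prime_gt_0_nat[OF p] by (simp add: k_def mod_eq_dvd_iff[symmetric])
  have "int p dvd c ^ (p ^ n) - int k ^ (p ^ n)" using k by (rule dvd_diff_power)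
  then have "int p dvd c ^ (p ^ n) - int k" using nat by (rule dvd_diff_trans)
  moreover have "int p dvd int k - c" using k by (simp add: dvd_diff_commute)
  ultimately show ?thesis by (rule dvd_diff_trans)
qed

text \<open>Here \<open>f\<close> is taken at the \<open>q\<close>-th powers of the variables, its
  coefficients unchanged. For integral \<open>f\<close> and \<open>q\<close> a power of a prime this
  is \<open>f ^ q\<close> modulo that prime (\<open>frob_power\<close>), but it is exactly additive
  in \<open>f\<close>.\<close>

definition frob :: "nat \<Rightarrow> ('v, 'a::comm_ring_1) mpoly \<Rightarrow> ('v, 'a) mpoly" where
  "frob q f = (\<Sum>A\<in>keys f. mon (repeat_mset q A) (coef f A))"

lemma mon_power: "mon A c ^ k = mon (repeat_mset k A) (c ^ k)"
  for c :: "'a::comm_ring_1"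
  by (induction k) (auto simp: mult_single)

lemma of_nat_Con: "of_nat p = (Con (of_nat p) :: ('v, 'a::semiring_1) mpoly)"
  by (rule poly_mapping_eqI) (simp add: lookup_of_nat lookup_single when_def eq_commute)

lemma frob_power:
  fixes f :: "('v, int) mpoly"
  assumes p: "prime p"
  shows "of_nat p dvd f ^ (p ^ n) - frob (p ^ n) f"
proof -
  have "of_nat p dvd (\<Sum>A\<in>keys f. mon A (coef f A)) ^ (p ^ n) - (\<Sum>A\<in>keys f. mon A (coef f A) ^ (p ^ n))"
    by (rule frobenius_sum[OF p]) simp
  moreover have "of_nat p dvd (\<Sum>A\<in>keys f. mon A (coef f A) ^ (p ^ n)) - frob (p ^ n) f"
    unfolding frob_def
  proof (rule dvd_diff_sum)
    fix A
    obtain k where k: "coef f A ^ (p ^ n) - coef f A = int p * k" using fermat_iter[OF p, of "coef f A" n] by (auto simp: dvd_def)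
    have "mon A (coef f A) ^ (p ^ n) - mon (repeat_mset (p ^ n) A) (coef f A) =
        of_nat p * mon (repeat_mset (p ^ n) A) k"
      by (simp add: mon_power of_nat_Con mult_single k flip: single_diff)
    then show "of_nat p dvd mon A (coef f A) ^ (p ^ n) - mon (repeat_mset (p ^ n) A) (coef f A)"
      by simp
  qed
  ultimately have "of_nat p dvd (\<Sum>A\<in>keys f. mon A (coef f A)) ^ (p ^ n) - frob (p ^ n) f"
    by (rule dvd_diff_trans)
  then show ?thesis by (simp only: poly_expand[of f, symmetric])
qed

text \<open>The coordinate of \<open>x\<close> at the basis monomial \<open>M\<close>, when
  polynomials are expanded over the ring of polynomials in \<open>q\<close>-th powers; these powers
  are renamed back to the variables.\<close>

definition digit :: "nat \<Rightarrow> 'v multiset \<Rightarrow> ('v, 'a::zero) mpoly \<Rightarrow> ('v, 'a) mpoly" where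
  "digit q M x = Poly_Mapping.map_key (\<lambda>B. repeat_mset q B + M) x"

lemma coef_digit:
  assumes "q > 0"
  shows "coef (digit q M x) B = coef x (repeat_mset q B + M)"
proof -
  have "inj (\<lambda>B. repeat_mset q B + M)"
    by (rule injI) (use assms in \<open>auto simp: multiset_eq_iff\<close>)
  then show ?thesis by (simp add: digit_def map_key.rep_eq)
qed

lemma digit_sum: "q > 0 \<Longrightarrow> digit q M (sum f I) = (\<Sum>i\<in>I. digit q M (f i))"
  by (rule poly_mapping_eqI) (simp add: coef_digit lookup_sum)

text \<open>Flatness of Frobenius: the monomials with all exponents below \<open>q\<close> are a basis over the \<open>q\<close>-th
  powers of the variables.\<close>

lemma digit_mult_frob:
  fixes x y :: "('v, 'a::comm_ring_1) mpoly"
  assumes q: "q > 0" and M: "\<And>v. count M v < q"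
  shows "digit q M (x * frob q y) = digit q M x * y"
proof -
  have mon: "digit q M (mon (A + repeat_mset q B) (a * b)) = digit q M (mon A a) * mon B b" for A B and a b :: 'a
  proof (cases "\<exists>C. A = repeat_mset q C + M")
    case True
    then obtain C where C: "A = repeat_mset q C + M" by blast
    have *: "digit q M (mon (repeat_mset q C + M) a) = mon C a" for C a
      by (rule poly_mapping_eqI) (use q in \<open>auto simp: coef_digit lookup_single when_def multiset_eq_iff\<close>)
    have E: "A + repeat_mset q B = repeat_mset q (C + B) + M"
      by (simp add: C multiset_eq_iff algebra_simps)
    show ?thesis unfolding E * unfolding C * by (simp add: mult_single)
  next
    case False
    have no: "A + repeat_mset q B \<noteq> repeat_mset q C + M" for C
    proof
      assume eq: "A + repeat_mset q B = repeat_mset q C + M"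
      have eqv: "count A v + q * count B v = q * count C v + count M v" for v
        using arg_cong[OF eq, of "\<lambda>A. count A v"] by simp
      \<comment> \<open>Since the exponents of \<open>M\<close> are below \<open>q\<close>, division
        by \<open>q\<close> involves no carry, so \<open>B\<close> can be subtracted from
        \<open>C\<close>.\<close>
      have BC: "count B v \<le> count C v" for v
      proof (rule ccontr)
        assume "\<not> ?thesis"
        then have "q * (count C v + 1) \<le> q * count B v" by (intro mult_le_mono2) simp
        then show False using eqv[of v] M[of v] by (simp add: algebra_simps)
      qed
      have "A = repeat_mset q (C - B) + M"
      proof (rule multiset_eqI)
        fix v
        show "count A v = count (repeat_mset q (C - B) + M) v"
          using eqv[of v] BC[of v] by (simp add: diff_mult_distrib2)
      qed
      with False show False by blast
    qed
    have "digit q M (mon (A + repeat_mset q B) (a * b)) = 0"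
      by (rule poly_mapping_eqI) (use q no in \<open>simp add: coef_digit lookup_single when_def\<close>)
    moreover have "digit q M (mon A a) = 0"
      by (rule poly_mapping_eqI) (use q False in \<open>auto simp add: coef_digit lookup_single when_def\<close>)
    ultimately show ?thesis by simp
  qed
  have "x * frob q y = (\<Sum>A\<in>keys x. \<Sum>B\<in>keys y. mon (A + repeat_mset q B) (coef x A * coef y B))"
    by (subst (1) poly_expand[of x]) (simp add: frob_def sum_product mult_single)
  then have "digit q M (x * frob q y) = (\<Sum>A\<in>keys x. \<Sum>B\<in>keys y. digit q M (mon A (coef x A)) * mon B (coef y B))"
    by (simp only: digit_sum[OF q] mon)
  also have "\<dots> = digit q M (\<Sum>A\<in>keys x. mon A (coef x A)) * (\<Sum>B\<in>keys y. mon B (coef y B))"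
    by (simp add: sum_product digit_sum[OF q])
  finally show ?thesis by (simp flip: poly_expand)
qed

lemma dvd_coef: "of_nat p dvd x \<Longrightarrow> int p dvd coef x A"
  for x :: "('v, int) mpoly"
  by (auto simp: dvd_def of_nat_Con coef_Con_mult)

lemma coef_dvd: "(\<And>A. int p dvd coef x A) \<Longrightarrow> of_nat p dvd x"
  for x :: "('v, int) mpoly"
proof -
  assume *: "\<And>A. int p dvd coef x A"
  have "x = of_nat p * mapc (\<lambda>c. c div int p) x"
    by (rule poly_mapping_eqI) (simp add: of_nat_Con coef_Con_mult coef_mapc *)
  then show ?thesis by (metis dvd_triv_left)
qed

lemma digit_dvd: "q > 0 \<Longrightarrow> of_nat p dvd x \<Longrightarrow> of_nat p dvd digit q M x"
  for x :: "('v, int) mpoly"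
  by (rule coef_dvd) (simp add: coef_digit dvd_coef)

text \<open>As in tight closure theory: since \<open>q = p\<^sup>n\<close> exceeds the degree of \<open>c\<close>, the coefficient of \<open>c\<close> at \<open>M\<close>
  can be extracted \<open>q\<close>-th power linearly, and the \<open>q\<close>-th powers are then removed modulo \<open>p\<close>.\<close>

lemma tight_closure_step:
  fixes c u :: "('v, int) mpoly"
  assumes p: "prime p" and F: "finite F"
    and mem: "c * u ^ (p ^ n) \<in> idl.span ((\<lambda>f. f ^ (p ^ n)) ` F)"
    and small: "\<And>A. A \<in> keys c \<Longrightarrow> size A < p ^ n" and M: "M \<in> keys c"
  shows "\<exists>g. of_nat p dvd Con (coef c M) * u - (\<Sum>f\<in>F. g f * f)"
proof -
  define q where "q = p ^ n"
  have q: "q > 0" using prime_gt_0_nat[OF p] by (simp add: q_def)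
  have Mq: "count M v < q" for v
    using small[OF M] count_le_size[of M v] by (simp add: q_def)
  have "\<exists>g. c * u ^ q = (\<Sum>f\<in>F. g f * f ^ q)"
    using mem F unfolding q_def
  proof (induction rule: idl.span_induct_alt)
    case base
    then show ?case by (intro exI[of _ "\<lambda>_. 0"]) simp
  next
    case (step r x y)
    then obtain g f where g: "y = (\<Sum>f\<in>F. g f * f ^ (p ^ n))" and f: "x = f ^ (p ^ n)" "f \<in> F" by blast
    show ?case
    proof (intro exI[of _ "\<lambda>h. (if h = f then r else 0) + g h"])
      have "(\<Sum>h\<in>F. ((if h = f then r else 0) + g h) * h ^ (p ^ n)) =
        (\<Sum>h\<in>F. (if h = f then r * h ^ (p ^ n) else 0) + g h * h ^ (p ^ n))"
        by (intro sum.cong) (auto simp: algebra_simps)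
      then show "r * x + y = (\<Sum>h\<in>F. ((if h = f then r else 0) + g h) * h ^ (p ^ n))"
        using F f g by (simp add: sum.distrib)
    qed
  qed
  then obtain g where g: "c * u ^ q = (\<Sum>f\<in>F. g f * f ^ q)" by blast
  have F1: "of_nat p dvd (\<Sum>f\<in>F. g f * f ^ q) - (\<Sum>f\<in>F. g f * frob q f)"
    by (intro dvd_diff_sum dvd_diff_mult) (use frob_power[OF p] in \<open>auto simp: q_def\<close>)
  have "of_nat p dvd frob q u - u ^ q"
    unfolding q_def using frob_power[OF p, of u n] by (metis dvd_minus_iff minus_diff_eq)
  then have "of_nat p dvd c * frob q u - c * u ^ q"
    by (intro dvd_diff_mult) auto
  from this[unfolded g] F1 have "of_nat p dvd c * frob q u - (\<Sum>f\<in>F. g f * frob q f)"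
    by (rule dvd_diff_trans)
  then have "of_nat p dvd digit q M (c * frob q u - (\<Sum>f\<in>F. g f * frob q f))"
    by (rule digit_dvd[OF q])
  moreover have "digit q M (x - y) = digit q M x - digit q M y" for x y :: "('v, int) mpoly"
    by (rule poly_mapping_eqI) (simp add: coef_digit[OF q] lookup_minus)
  \<comment> \<open>Any further key contributing to this coordinate would have degree at least
    \<open>q\<close>, more than \<open>c\<close> has.\<close>
  moreover have "digit q M c = Con (coef c M)"
  proof (rule poly_mapping_eqI)
    fix B
    show "coef (digit q M c) B = coef (Con (coef c M)) B"
    proof (cases "B = {#}")
      case False
      then have "size B \<ge> 1" by (simp add: Suc_le_eq nonempty_has_size)
      then have "q * 1 \<le> q * size B" by (rule mult_le_mono2)
      moreover have "size (repeat_mset q B + M) = q * size B + size M" by simp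
      ultimately have "q \<le> size (repeat_mset q B + M)" by linarith
      then have "repeat_mset q B + M \<notin> keys c" using small unfolding q_def[symmetric] by (metis not_le)
      then show ?thesis using False by (simp add: coef_digit[OF q] in_keys_iff lookup_single_not_eq)
    qed (simp add: coef_digit[OF q])
  qed
  ultimately have "of_nat p dvd Con (coef c M) * u - (\<Sum>f\<in>F. digit q M (g f) * f)"
    by (simp add: digit_sum[OF q] digit_mult_frob[OF q Mq])
  then show ?thesis by (rule exI[of _ "\<lambda>f. digit q M (g f)"])
qed

context nullcone
begin

text \<open>The Briancon--Skoda argument: a power of \<open>u\<close> times a fixed factor lies in the ideal of
  the \<open>q\<close>-th powers of \<open>card X\<close> forms of degree \<open>d\<close>, hence \<open>u\<close> lies in their ideal modulo
  almost all primes; being orthogonal to that ideal, it has norm \<open>0\<close> modulo these primes.\<close>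

lemma orthogonal_vanishes:
  assumes F: "cuts F" "card F \<le> card X" and u: "u \<in> R e" and e: "card X * d \<le> e"
    and orth: "\<And>f g. f \<in> F \<Longrightarrow> pair (f * g) u = 0"
  shows "u = 0"
proof (rule ccontr)
  assume u0: "u \<noteq> 0"
  interpret ip: comm_ring_hom "ip :: ('v, int) mpoly \<Rightarrow> _" by (rule ip_hom)
  interpret cz: comm_ring_hom "Con :: int \<Rightarrow> ('v, int) mpoly" by (rule Con_hom)
  define nu where "nu = card X"
  have nu: "nu > 0" using Xne finX by (simp add: nu_def card_gt_0_iff)
  have epos: "e > 0" using e nu d by (metis nu_def gr_zeroI le_zero_eq mult_is_0 not_gr0)
  obtain E where fin: "finite F" and FR: "F \<subseteq> R d" and E: "\<And>t. t > E \<Longrightarrow> R t \<subseteq> idl.span F"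
    using F(1) by (auto simp: cuts_def)
  have "\<exists>B. finite B \<and> B \<subseteq> R j \<and> R j \<subseteq> mp.span B" for j
  proof -
    have "R j \<subseteq> Form X j" using R_Form by blast
    from finite_spanning_set[OF finX this] show ?thesis by metis
  qed
  then obtain B where B: "\<And>j. finite (B j)" "\<And>j. B j \<subseteq> R j" "\<And>j. R j \<subseteq> mp.span (B j)" by metis
  have "finite (F \<union> (\<Union>j\<le>E. B j) \<union> {u})" using fin B(1) by auto
  then obtain N :: int where N: "N > 0" "\<And>p. p \<in> F \<union> (\<Union>j\<le>E. B j) \<union> {u} \<Longrightarrow> \<exists>q. Con (of_int N) * p = ip q"
    using clear_denominators_poly by metis
  \<comment> \<open>\<open>z p\<close> is the integral form of \<open>p\<close>. One denominator
    \<open>N\<close> serves for \<open>F\<close>, for \<open>u\<close> and for spanning sets of the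
    invariants of degree at most \<open>E\<close>.\<close>
  then obtain z where z: "\<And>p. p \<in> F \<union> (\<Union>j\<le>E. B j) \<union> {u} \<Longrightarrow> ip (z p) = Con (of_int N) * p" by metis
  have unit: "p = Con (1 / of_int N) * ip (z p)" if "p \<in> F \<union> (\<Union>j\<le>E. B j) \<union> {u}" for p
    using z[OF that] N(1) by (simp add: mult_single flip: mult.assoc)
  define FZ where "FZ = z ` F"
  define uz where "uz = z u"
  have ipuz: "ip uz = Con (of_int N) * u" unfolding uz_def by (rule z) simp
  have uzR: "ip uz \<in> R e" unfolding ipuz by (rule R_scale[OF u])
  have finFZ: "finite FZ" using fin by (simp add: FZ_def)
  have cFZ: "card FZ \<le> nu" unfolding FZ_def nu_def using card_image_le[OF fin, of z] F(2) by linarith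
  have ipFZ: "ip f \<in> R d" if "f \<in> FZ" for f
    using that FR by (auto simp: FZ_def z intro!: R_scale)
  have FFZ: "F \<subseteq> idl.span (ip ` FZ)"
  proof
    fix f assume f: "f \<in> F"
    then have "Con (1 / of_int N) * ip (z f) \<in> idl.span (ip ` FZ)"
      by (intro idl.span_scale idl.span_base) (auto simp: FZ_def)
    then show "f \<in> idl.span (ip ` FZ)" using unit[of f] f by simp
  qed
  have EZ: "R t \<subseteq> idl.span (ip ` FZ)" if "t > E" for t
    using E[OF that] idl.span_minimal[OF FFZ idl.subspace_span] by blast
  \<comment> \<open>By \<open>cuts\<close> the invariants are a finite module over the algebra
    generated by \<open>F\<close>, with module generators of degree at most \<open>E\<close>.
    \<open>P t\<close> is an integral version of the resulting spanning set in degree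
    \<open>t\<close>.\<close>
  define P where "P t = {\<Prod>\<^sub># \<alpha> * z b | \<alpha> j b. set_mset \<alpha> \<subseteq> FZ \<and> j \<le> E \<and> b \<in> B j \<and> d * size \<alpha> + j = t}" for t
  have PI: "\<Prod>\<^sub># \<alpha> * z b \<in> P t" if "set_mset \<alpha> \<subseteq> FZ" "j \<le> E" "b \<in> B j" "d * size \<alpha> + j = t" for \<alpha> j b t
    using that unfolding P_def by blast
  have span: "f \<in> mp.span (ip ` P t)" if "f \<in> R t" for f t
    using that
  proof (induction t arbitrary: f rule: less_induct)
    case (less t)
    show ?case
    proof (cases "t \<le> E")
      case True
      have "b \<in> mp.span (ip ` P t)" if b: "b \<in> B t" for b
      proof -
        have "z b \<in> P t" using PI[of "{#}" t b t] True b by simp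
        then have "Con (1 / of_int N) * ip (z b) \<in> mp.span (ip ` P t)"
          by (intro mp.span_scale mp.span_base) auto
        moreover have "b = Con (1 / of_int N) * ip (z b)" by (rule unit) (use b True in auto)
        ultimately show ?thesis by simp
      qed
      then have "mp.span (B t) \<subseteq> mp.span (ip ` P t)" by (intro mp.span_minimal) auto
      then show ?thesis using B(3)[of t] less.prems by blast
    next
      case False
      then have "f \<in> idl.span (ip ` FZ)" using EZ[of t] less.prems by auto
      then obtain r where r: "f = (\<Sum>h\<in>ip ` FZ. h * r h)" "\<And>h. h \<in> ip ` FZ \<Longrightarrow> r h \<in> R (t - d)"
        "\<And>h. h \<in> ip ` FZ \<Longrightarrow> t < d \<Longrightarrow> r h = 0"
        using reynolds[of "ip ` FZ" "\<lambda>_. d" f t] finFZ ipFZ less.prems by blast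
      have "h * r h \<in> mp.span (ip ` P t)" if h: "h \<in> ip ` FZ" for h
      proof (cases "t < d")
        case True
        then show ?thesis using r(3)[OF h] by (simp add: mp.span_zero)
      next
        case le: False
        then have "t - d < t" using d by simp
        from less.IH[OF this r(2)[OF h]] show ?thesis
        proof (rule mp_span_mult)
          fix b assume "b \<in> ip ` P (t - d)"
          then obtain \<alpha> j b' where b: "b = ip (\<Prod>\<^sub># \<alpha> * z b')" "set_mset \<alpha> \<subseteq> FZ" "j \<le> E" "b' \<in> B j"
            "d * size \<alpha> + j = t - d" by (auto simp: P_def)
          obtain h' where h': "h = ip h'" "h' \<in> FZ" using h by blast
          have "\<Prod>\<^sub># (add_mset h' \<alpha>) * z b' \<in> P t"
            by (rule PI[of _ j]) (use b h' le in auto)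
          moreover have "h * b = ip (\<Prod>\<^sub># (add_mset h' \<alpha>) * z b')"
            by (simp add: b h' ip.hom_mult mult.assoc)
          ultimately show "h * b \<in> mp.span (ip ` P t)" by (intro mp.span_base) auto
        qed
      qed
      then show ?thesis unfolding r(1) by (rule mp.span_sum)
    qed
  qed
  have finP: "finite (P t)" for t
  proof (rule finite_subset)
    show "P t \<subseteq> (\<lambda>(\<alpha>, b). \<Prod>\<^sub># \<alpha> * z b) ` ((\<Union>s\<le>t. Mon FZ s) \<times> (\<Union>j\<le>E. B j))"
    proof
      fix x assume "x \<in> P t"
      then obtain \<alpha> j b where x: "x = \<Prod>\<^sub># \<alpha> * z b" "set_mset \<alpha> \<subseteq> FZ" "j \<le> E" "b \<in> B j" "d * size \<alpha> + j = t"
        unfolding P_def by blast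
      have "size \<alpha> \<le> d * size \<alpha>" using d by simp
      then have "size \<alpha> \<le> t" using x(5) by linarith
      then have "(\<alpha>, b) \<in> (\<Union>s\<le>t. Mon FZ s) \<times> (\<Union>j\<le>E. B j)" using x by (auto simp: Mon_def)
      then show "x \<in> (\<lambda>(\<alpha>, b). \<Prod>\<^sub># \<alpha> * z b) ` ((\<Union>s\<le>t. Mon FZ s) \<times> (\<Union>j\<le>E. B j))" using x(1) by force
    qed
    show "finite ((\<lambda>(\<alpha>, b). \<Prod>\<^sub># \<alpha> * z b) ` ((\<Union>s\<le>t. Mon FZ s) \<times> (\<Union>j\<le>E. B j)))"
      using B(1) finite_Mon[OF finFZ] by auto
  qed
  have "\<exists>L::int. L > 0 \<and> Con L * (uz * z b) \<in> zm.span (P (e + j))" if "j \<le> E" "b \<in> B j" for j b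
  proof -
    have "ip (z b) = Con (of_int N) * b" by (rule z) (use that in auto)
    then have "ip (z b) \<in> R j" using R_scale B(2)[of j] that by auto
    then have "ip (uz * z b) \<in> R (e + j)" using uzR by (simp add: ip.hom_mult R_mult)
    then have "ip (uz * z b) \<in> mp.span (ip ` P (e + j))" by (rule span)
    then show ?thesis using integral_span[OF finP] by metis
  qed
  then obtain Lf :: "nat \<Rightarrow> _ \<Rightarrow> int" where Lf: "\<And>j b. j \<le> E \<Longrightarrow> b \<in> B j \<Longrightarrow> Lf j b > 0"
    "\<And>j b. j \<le> E \<Longrightarrow> b \<in> B j \<Longrightarrow> Con (Lf j b) * (uz * z b) \<in> zm.span (P (e + j))" by metis
  \<comment> \<open>A single denominator for the finitely many products of \<open>uz\<close> with
    module generators.\<close>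
  define L where "L = (\<Prod>(j, b)\<in>(SIGMA j:{..E}. B j). Lf j b)"
  have Lpos: "L > 0" unfolding L_def by (rule prod_pos) (use Lf(1) in auto)
  have LL: "Con L * (uz * z b) \<in> zm.span (P (e + j))" if "j \<le> E" "b \<in> B j" for j b
  proof -
    have "(case (j, b) of (j, b) \<Rightarrow> Lf j b) dvd L"
      unfolding L_def by (rule dvd_prodI) (use that B(1) in auto)
    then obtain k where "L = k * Lf j b" by (auto simp: dvd_def mult.commute)
    then have "Con L * (uz * z b) = Con k * (Con (Lf j b) * (uz * z b))"
      by (simp add: mult_single flip: mult.assoc)
    then show ?thesis using zm.span_scale[OF Lf(2)[OF that], of k] by (simp only:)
  qed
  have multW: "\<Prod>\<^sub># \<alpha> * x \<in> zm.span (P (d * size \<alpha> + s))" if "x \<in> zm.span (P s)" "set_mset \<alpha> \<subseteq> FZ" for \<alpha> x s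
    using that(1)
  proof (induction rule: zm.span_induct_alt)
    case (step c x y)
    obtain \<beta> j b where x: "x = \<Prod>\<^sub># \<beta> * z b" "set_mset \<beta> \<subseteq> FZ" "j \<le> E" "b \<in> B j" "d * size \<beta> + j = s"
      using step(1) unfolding P_def by blast
    have "\<Prod>\<^sub># (\<alpha> + \<beta>) * z b \<in> P (d * size \<alpha> + s)"
      by (rule PI[of _ j]) (use x that(2) in \<open>auto simp: algebra_simps\<close>)
    then have "Con c * (\<Prod>\<^sub># (\<alpha> + \<beta>) * z b) + \<Prod>\<^sub># \<alpha> * y \<in> zm.span (P (d * size \<alpha> + s))"
      by (rule zm.span_add[OF zm.span_scale[OF zm.span_base] step(2)])
    moreover have "\<Prod>\<^sub># \<alpha> * (Con c * x + y) = Con c * (\<Prod>\<^sub># (\<alpha> + \<beta>) * z b) + \<Prod>\<^sub># \<alpha> * y"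
      by (simp add: x(1) algebra_simps)
    ultimately show ?case by simp
  qed (simp add: zm.span_zero)
  \<comment> \<open>The lattices spanned by the \<open>P t\<close> are carried into each other by
    \<open>Con L * uz\<close>, with \<open>L\<close> independent of \<open>t\<close>. Hence the
    denominators of the powers of \<open>uz\<close> involve only the primes dividing
    \<open>L0 * L\<close>.\<close>
  have stepW: "(Con L * uz) * x \<in> zm.span (P (t + e))" if "x \<in> zm.span (P t)" for x t
    using that
  proof (induction rule: zm.span_induct_alt)
    case (step c x y)
    obtain \<beta> j b where x: "x = \<Prod>\<^sub># \<beta> * z b" "set_mset \<beta> \<subseteq> FZ" "j \<le> E" "b \<in> B j" "d * size \<beta> + j = t"
      using step(1) unfolding P_def by blast
    have "\<Prod>\<^sub># \<beta> * (Con L * (uz * z b)) \<in> zm.span (P (d * size \<beta> + (e + j)))"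
      by (rule multW[OF LL[OF x(3,4)] x(2)])
    moreover have "d * size \<beta> + (e + j) = t + e" using x(5) by simp
    ultimately have "Con c * (\<Prod>\<^sub># \<beta> * (Con L * (uz * z b))) + (Con L * uz) * y \<in> zm.span (P (t + e))"
      using step(2) by (intro zm.span_add zm.span_scale) auto
    moreover have "(Con L * uz) * (Con c * x + y) = Con c * (\<Prod>\<^sub># \<beta> * (Con L * (uz * z b))) + (Con L * uz) * y"
      by (simp add: x(1) algebra_simps)
    ultimately show ?case by simp
  qed (simp add: zm.span_zero)
  have "ip 1 \<in> mp.span (ip ` P 0)" using span[OF R_one] by simp
  then obtain L0 :: int where L0: "L0 > 0" "Con L0 * 1 \<in> zm.span (P 0)"
    using integral_span[OF finP] by metis
  have pow: "(Con L * uz) ^ k * Con L0 \<in> zm.span (P (k * e))" for k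
  proof (induction k)
    case 0
    then show ?case using L0(2) by simp
  next
    case (Suc k)
    then show ?case using stepW[OF Suc] by (simp add: algebra_simps)
  qed
  \<comment> \<open>The source of the factor \<open>nu\<close>: apart from a factor of degree at
    most \<open>E\<close>, an element of \<open>P t\<close> is a product of at least
    \<open>nu * q\<close> elements of \<open>FZ\<close>, which has at most \<open>nu\<close>
    elements, so one of them occurs \<open>q\<close> times.\<close>
  have cont: "zm.span (P t) \<subseteq> idl.span ((\<lambda>f. f ^ q) ` FZ)" if t: "E + d * nu * q \<le> t" and q: "q > 0" for t q
  proof -
    have "P t \<subseteq> idl.span ((\<lambda>f. f ^ q) ` FZ)"
    proof
      fix x assume "x \<in> P t"
      then obtain \<alpha> j b where x: "x = \<Prod>\<^sub># \<alpha> * z b" "set_mset \<alpha> \<subseteq> FZ" "j \<le> E" "b \<in> B j" "d * size \<alpha> + j = t"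
        unfolding P_def by blast
      have "d * (nu * q) \<le> d * size \<alpha>" using x(3,5) t unfolding mult.assoc by linarith
      then have sz: "nu * q \<le> size \<alpha>" using d by simp
      have "\<exists>f\<in>FZ. q \<le> count \<alpha> f"
      proof (rule ccontr)
        assume neg: "\<not> ?thesis"
        have "size \<alpha> = (\<Sum>f\<in>FZ. count \<alpha> f)" using sum_mset_count[OF finFZ x(2), of "\<lambda>_. 1"] by simp
        also have "\<dots> \<le> (\<Sum>f\<in>FZ. q - 1)" by (rule sum_mono) (use neg in \<open>auto simp: not_le\<close>)
        also have "\<dots> \<le> nu * (q - 1)" using cFZ by simp
        also have "\<dots> < nu * q" using nu q by simp
        finally show False using sz by simp
      qed
      then obtain f where f: "f \<in> FZ" "q \<le> count \<alpha> f" by blast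
      then have "\<alpha> = (\<alpha> - replicate_mset q f) + replicate_mset q f"
        by (simp add: count_le_replicate_mset_subset_eq)
      then have "\<Prod>\<^sub># \<alpha> = \<Prod>\<^sub># (\<alpha> - replicate_mset q f) * f ^ q"
        by (metis prod_mset_Un prod_mset_replicate_mset)
      then have "x = (\<Prod>\<^sub># (\<alpha> - replicate_mset q f) * z b) * f ^ q" by (simp add: x(1) mult_ac)
      then show "x \<in> idl.span ((\<lambda>f. f ^ q) ` FZ)" using f(1) by (auto intro: idl.span_scale idl.span_base)
    qed
    then show ?thesis
      by (intro zm.span_minimal) (auto simp: zm.subspace_def idl.span_zero idl.span_add idl.span_scale)
  qed
  have uzF: "uz \<in> Form X e" using R_Form[OF uzR] by (simp add: ip_Form)
  have "uz \<noteq> 0"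
  proof
    assume "uz = 0"
    then have "Con (1 / of_int N) * ip (z u) = 0" by (simp add: uz_def)
    then show False using unit[of u] u0 by simp
  qed
  \<comment> \<open>The fixed multiplier \<open>uz ^ E\<close> has degree at least \<open>E\<close>
    and so pays for the summand \<open>E\<close> in \<open>cont\<close>; being nonzero, it has a
    coefficient \<open>cM\<close> to extract.\<close>
  then have "uz ^ E \<noteq> 0" by simp
  then obtain M where M: "M \<in> keys (uz ^ E)" by (metis keys_eq_empty ex_in_conv)
  define cM where "cM = coef (uz ^ E) M"
  have cM: "cM \<noteq> 0" using M by (simp add: cM_def in_keys_iff)
  have norm: "pair uz uz \<noteq> 0"
  proof
    assume "pair uz uz = 0"
    then have "pair (ip uz) (ip uz) = 0" by (simp add: pair_ip)
    then have "ip uz = ip 0" using pair_pos by fastforce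
    then show False using \<open>uz \<noteq> 0\<close> by (simp only: ip_inj)
  qed
  \<comment> \<open>The integers that have to be nonzero modulo \<open>p\<close>. None of them
    depends on \<open>p\<close>, so a prime above \<open>T\<close> can be chosen.\<close>
  define T where "T = L0 * L * cM * pair uz uz"
  have T: "T \<noteq> 0" using L0(1) Lpos cM norm by (simp add: T_def)
  obtain p where p: "prime p" "nat \<bar>T\<bar> < p" using bigger_prime by blast
  have pT: "\<not> int p dvd T"
  proof
    assume "int p dvd T"
    then have "\<bar>int p\<bar> \<le> \<bar>T\<bar>" using T by (rule dvd_imp_le_int[rotated])
    then show False using p(2) by linarith
  qed
  have pp: "prime (int p)" using p(1) by simp
  \<comment> \<open>An exponent that makes \<open>p ^ n\<close> exceed the degree
    \<open>E * e\<close> of the multiplier for every prime \<open>p\<close>.\<close>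
  define n where "n = E * e"
  have small: "E * e < p ^ n"
  proof -
    have "n < 2 ^ n" by (rule less_exp)
    also have "\<dots> \<le> p ^ n" using prime_ge_2_nat[OF p(1)] by (rule power_mono) simp
    finally show ?thesis by (simp add: n_def)
  qed
  define q where "q = p ^ n"
  have q: "q > 0" using prime_gt_0_nat[OF p(1)] by (simp add: q_def)
  define c where "c = Con (L0 * L ^ (q + E)) * uz ^ E"
  have "c * uz ^ q = (Con L * uz) ^ (q + E) * Con L0"
    by (simp add: c_def cz.hom_mult cz.hom_power power_mult_distrib power_add mult_ac)
  moreover have "E + d * nu * q \<le> (q + E) * e"
  proof -
    have "q * (nu * d) \<le> q * e" using e by (simp add: nu_def)
    moreover have "E \<le> E * e" using epos by simp
    moreover have "d * nu * q = q * (nu * d)" "(q + E) * e = q * e + E * e" by (simp_all add: algebra_simps)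
    ultimately show ?thesis by linarith
  qed
  ultimately have "c * uz ^ q \<in> idl.span ((\<lambda>f. f ^ q) ` FZ)"
    using pow[of "q + E"] cont[OF _ q] by auto
  moreover have "coef c M = L0 * L ^ (q + E) * cM" by (simp add: c_def cM_def coef_Con_mult)
  moreover from this have "M \<in> keys c" using L0(1) Lpos cM by (simp add: in_keys_iff)
  moreover have "size A < p ^ n" if "A \<in> keys c" for A
  proof -
    have "c \<in> Form X (E * e)" unfolding c_def by (intro Form_Con_mult Form_power uzF)
    then show ?thesis using that small by (auto simp: Form_def Mon_def)
  qed
  ultimately obtain g where "of_nat p dvd Con (L0 * L ^ (q + E) * cM) * uz - (\<Sum>f\<in>FZ. g f * f)"
    using tight_closure_step[OF p(1) finFZ, of c uz n M] unfolding q_def by metis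
  then obtain w where "Con (L0 * L ^ (q + E) * cM) * uz - (\<Sum>f\<in>FZ. g f * f) = of_nat p * w"
    by (auto simp: dvd_def)
  then have "Con (L0 * L ^ (q + E) * cM) * uz = (\<Sum>f\<in>FZ. g f * f) + Con (int p) * w"
    by (simp add: of_nat_Con algebra_simps)
  then have "pair (Con (L0 * L ^ (q + E) * cM) * uz) uz = pair ((\<Sum>f\<in>FZ. g f * f) + Con (int p) * w) uz"
    by (rule arg_cong)
  then have eq: "L0 * L ^ (q + E) * cM * pair uz uz = (\<Sum>f\<in>FZ. pair (g f * f) uz) + int p * pair w uz"
    by (simp only: pair_Con_left pair_add_left pair_sum_left)
  have "pair (g f * f) uz = 0" if f: "f \<in> FZ" for f
  proof -
    obtain f0 where f0: "f0 \<in> F" "f = z f0" using f by (auto simp: FZ_def)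
    then have ipf: "ip f = Con (of_int N) * f0" by (simp add: z)
    have "pair (ip (g f * f)) (ip uz) = of_int N * (of_int N * pair (f0 * ip (g f)) u)"
      unfolding ip.hom_mult ipf ipuz pair_Con_right
      by (simp only: mult.commute[of "ip (g f)"] mult.assoc pair_Con_left)
    then have "pair (ip (g f * f)) (ip uz) = 0" by (simp add: orth f0(1))
    then show ?thesis by (simp add: pair_ip)
  qed
  then have "int p dvd L0 * L ^ (q + E) * cM * pair uz uz" unfolding eq by simp
  \<comment> \<open>The exponent of \<open>L\<close> depends on \<open>p\<close>; primality reduces
    it to 1, which is why \<open>T\<close> could be fixed before \<open>p\<close>.\<close>
  then have "int p dvd L0 * L * cM * pair uz uz"
    using prime_dvd_power[OF pp, of L "q + E"] by (auto simp only: prime_dvd_mult_iff[OF pp])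
  then show False using pT by (simp add: T_def)
qed

text \<open>The remainder left by \<open>orth_split\<close> is orthogonal to the ideal of a small
  cutting set and vanishes in these degrees by \<open>orthogonal_vanishes\<close>.\<close>

theorem decomposition:
  obtains F where "finite F" "F \<subseteq> R d"
    "\<And>f e. f \<in> R e \<Longrightarrow> card X * d \<le> e \<Longrightarrow> \<exists>r. f = (\<Sum>h\<in>F. h * r h) \<and> (\<forall>h\<in>F. r h \<in> R (e - d))"
proof -
  obtain F where F: "cuts F" "card F \<le> card X" using cuts_small by blast
  then have fin: "finite F" "F \<subseteq> R d" by (auto simp: cuts_def)
  have "\<exists>r. f = (\<Sum>h\<in>F. h * r h) \<and> (\<forall>h\<in>F. r h \<in> R (e - d))" if f: "f \<in> R e" and e: "card X * d \<le> e" for f e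
  proof -
    obtain r u where ru: "f = (\<Sum>h\<in>F. h * r h) + u" "u \<in> R e" "\<And>h. h \<in> F \<Longrightarrow> r h \<in> R (e - d)"
      "\<And>h g. h \<in> F \<Longrightarrow> pair (h * g) u = 0"
      using orth_split[of F "\<lambda>_. d" f e] fin f by blast
    have "u = 0" by (rule orthogonal_vanishes[OF F ru(2) e ru(4)])
    with ru show ?thesis by auto
  qed
  with fin that show thesis by blast
qed

end

section \<open>Blow-ups of matrix tuples\<close>

text \<open>The blow-up \<open>\<Sum>\<^sub>k T\<^sub>k \<otimes> z\<^sub>k\<close>, with \<open>N \<times> N\<close> blocks of size \<open>n\<close>.\<close>

definition bigmat :: "nat \<Rightarrow> nat \<Rightarrow> nat \<Rightarrow> (nat \<times> nat \<times> nat \<Rightarrow> 'a) \<Rightarrow> (nat \<times> nat \<times> nat \<Rightarrow> 'a) \<Rightarrow> 'a::comm_ring_1 mat" where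
  "bigmat m n N z T = mat (N * n) (N * n)
     (\<lambda>(p, q). \<Sum>k<m. z (k, p mod n, q mod n) * T (k, p div n, q div n))"

text \<open>The kernel of \<open>bigmat\<close> in block coordinates, which keeps \<open>div\<close>
  and \<open>mod\<close> on matrix indices out of the arguments about kernels.\<close>

definition in_kernel :: "nat \<Rightarrow> nat \<Rightarrow> nat \<Rightarrow> (nat \<times> nat \<times> nat \<Rightarrow> 'a) \<Rightarrow> (nat \<times> nat \<times> nat \<Rightarrow> 'a) \<Rightarrow>
    (nat \<Rightarrow> nat \<Rightarrow> 'a::comm_ring_1) \<Rightarrow> bool" where
  "in_kernel m n N z T v \<longleftrightarrow>
     (\<forall>b<N. \<forall>i<n. (\<Sum>c<N. \<Sum>j<n. (\<Sum>k<m. z (k, i, j) * T (k, b, c)) * v c j) = 0)"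

lemma bigmat_carrier [simp]: "bigmat m n N z T \<in> carrier_mat (N * n) (N * n)"
  by (simp add: bigmat_def)

lemma sum_blocks:
  fixes f :: "nat \<Rightarrow> nat \<Rightarrow> 'a::comm_monoid_add"
  assumes "n > 0"
  shows "(\<Sum>q<N * n. f (q div n) (q mod n)) = (\<Sum>c<N. \<Sum>j<n. f c j)"
proof -
  have "(\<Sum>q<N * n. f (q div n) (q mod n)) = (\<Sum>c<N. \<Sum>q = c * n..<c * n + n. f (q div n) (q mod n))"
    by (rule sum.nat_group[symmetric])
  also have "\<dots> = (\<Sum>c<N. \<Sum>j<n. f c j)"
  proof (rule sum.cong[OF refl])
    fix c
    have "(\<Sum>q = c * n..<c * n + n. f (q div n) (q mod n)) = (\<Sum>j = 0..<n. f ((j + c * n) div n) ((j + c * n) mod n))"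
      using sum.shift_bounds_nat_ivl[of "\<lambda>q. f (q div n) (q mod n)" 0 "c * n" n] by (simp add: add.commute)
    also have "\<dots> = (\<Sum>j<n. f c j)"
      unfolding atLeast0LessThan by (rule sum.cong) (use assms in auto)
    finally show "(\<Sum>q = c * n..<c * n + n. f (q div n) (q mod n)) = (\<Sum>j<n. f c j)" .
  qed
  finally show ?thesis .
qed

lemma block_index_less: "c < N \<Longrightarrow> j < n \<Longrightarrow> c * n + j < N * (n::nat)"
proof -
  assume "c < N" "j < n"
  then have "c * n + j < Suc c * n" by simp
  also have "\<dots> \<le> N * n" using \<open>c < N\<close> by (intro mult_le_mono1) simp
  finally show ?thesis .
qed

lemma det_bigmat_eq_0_iff:
  fixes z :: "nat \<times> nat \<times> nat \<Rightarrow> 'a::idom"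
  assumes n: "n > 0"
  shows "det (bigmat m n N z T) = 0 \<longleftrightarrow>
    (\<exists>v. (\<exists>c<N. \<exists>j<n. v c j \<noteq> 0) \<and> in_kernel m n N z T v)"
proof -
  let ?M = "bigmat m n N z T"
  have mv: "(?M *\<^sub>v vec (N * n) (\<lambda>q. v (q div n) (q mod n))) $ p =
      (\<Sum>c<N. \<Sum>j<n. (\<Sum>k<m. z (k, p mod n, j) * T (k, p div n, c)) * v c j)"
    if "p < N * n" for v p
  proof -
    have "(?M *\<^sub>v vec (N * n) (\<lambda>q. v (q div n) (q mod n))) $ p =
      (\<Sum>q<N * n. (\<Sum>k<m. z (k, p mod n, q mod n) * T (k, p div n, q div n)) * v (q div n) (q mod n))"
      using that by (simp add: bigmat_def scalar_prod_def atLeast0LessThan)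
    also have "\<dots> = (\<Sum>c<N. \<Sum>j<n. (\<Sum>k<m. z (k, p mod n, j) * T (k, p div n, c)) * v c j)"
      by (rule sum_blocks[OF n, where f = "\<lambda>c j. (\<Sum>k<m. z (k, p mod n, j) * T (k, p div n, c)) * v c j"])
    finally show ?thesis .
  qed
  show ?thesis
  proof
    assume "det ?M = 0"
    then obtain x where x: "x \<in> carrier_vec (N * n)" "x \<noteq> 0\<^sub>v (N * n)" "?M *\<^sub>v x = 0\<^sub>v (N * n)"
      using det_0_iff_vec_prod_zero[of ?M "N * n"] by auto
    define v where "v c j = x $ (c * n + j)" for c j
    have xv: "x = vec (N * n) (\<lambda>q. v (q div n) (q mod n))"
      by (rule eq_vecI) (use x(1) in \<open>auto simp: v_def\<close>)
    obtain q where "q < N * n" "x $ q \<noteq> 0" using x(1,2) by (metis carrier_vecD eq_vecI index_zero_vec)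
    then have "v (q div n) (q mod n) \<noteq> 0" by (simp add: v_def)
    moreover have "q div n < N" "q mod n < n" using \<open>q < N * n\<close> n by (auto simp: less_mult_imp_div_less)
    moreover have "in_kernel m n N z T v"
      unfolding in_kernel_def
    proof (intro allI impI)
      fix b i assume bi: "b < N" "i < n"
      then have "b * n + i < N * n" by (rule block_index_less)
      then have "(?M *\<^sub>v x) $ (b * n + i) = 0" by (simp add: x(3))
      then show "(\<Sum>c<N. \<Sum>j<n. (\<Sum>k<m. z (k, i, j) * T (k, b, c)) * v c j) = 0"
        using mv[OF \<open>b * n + i < N * n\<close>, of v] bi n unfolding xv[symmetric] by simp
    qed
    ultimately show "\<exists>v. (\<exists>c<N. \<exists>j<n. v c j \<noteq> 0) \<and> in_kernel m n N z T v" by blast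
  next
    assume "\<exists>v. (\<exists>c<N. \<exists>j<n. v c j \<noteq> 0) \<and> in_kernel m n N z T v"
    then obtain v c j where v: "c < N" "j < n" "v c j \<noteq> 0" "in_kernel m n N z T v" by blast
    let ?x = "vec (N * n) (\<lambda>q. v (q div n) (q mod n))"
    have "?x $ (c * n + j) \<noteq> 0" using v block_index_less[OF v(1,2)] by simp
    then have "?x \<noteq> 0\<^sub>v (N * n)" using block_index_less[OF v(1,2)] by (metis index_zero_vec(1))
    moreover have "?M *\<^sub>v ?x = 0\<^sub>v (N * n)"
    proof (rule eq_vecI)
      fix p assume "p < dim_vec (0\<^sub>v (N * n) :: 'a vec)"
      then have p: "p < N * n" by simp
      then have "p div n < N" "p mod n < n" using n by (auto simp: less_mult_imp_div_less)
      then show "(?M *\<^sub>v ?x) $ p = 0\<^sub>v (N * n) $ p"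
        using v(4) p by (simp add: mv[OF p] in_kernel_def)
    qed (simp add: bigmat_def)
    ultimately show "det ?M = 0"
      using det_0_iff_vec_prod_zero[of ?M "N * n"] by (metis bigmat_carrier vec_carrier)
  qed
qed

lemma hom_bigmat:
  assumes "comm_ring_hom h"
  shows "h (det (bigmat m n N z T)) = det (bigmat m n N (\<lambda>v. h (z v)) (\<lambda>v. h (T v)))"
proof -
  interpret h: comm_ring_hom h by fact
  have "map_mat h (bigmat m n N z T) = bigmat m n N (\<lambda>v. h (z v)) (\<lambda>v. h (T v))"
    by (rule eq_matI) (auto simp: bigmat_def h.hom_sum h.hom_mult)
  then show ?thesis by (metis h.hom_det)
qed

subsection \<open>Leading coefficients\<close>

text \<open>\<open>a\<close> may be 0: in a vector of polynomials all entries share one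
  \<open>D\<close>, and not every entry attains it.\<close>

definition ltop :: "nat \<Rightarrow> 'a::zero poly \<Rightarrow> 'a \<Rightarrow> bool" where
  "ltop D p a \<longleftrightarrow> (\<forall>i>D. coeff p i = 0) \<and> coeff p D = a"

lemma ltop_add: "ltop D p a \<Longrightarrow> ltop D q b \<Longrightarrow> ltop D (p + q) (a + b)"
  by (simp add: ltop_def)

lemma ltop_zero: "ltop D 0 0"
  by (simp add: ltop_def)

lemma ltop_const: "ltop 0 [:a:] a"
  by (auto simp: ltop_def coeff_pCons split: nat.splits)

lemma ltop_monom: "ltop d (monom a d) a"
  by (simp add: ltop_def)

lemma ltop_mult:
  fixes p q :: "'a::comm_ring_1 poly"
  assumes p: "ltop D p a" and q: "ltop E q b"
  shows "ltop (D + E) (p * q) (a * b)"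
proof -
  have "coeff (p * q) n = 0" if n: "n > D + E" for n
    unfolding coeff_mult
  proof (rule sum.neutral, rule ballI)
    fix i assume "i \<in> {..n}"
    then have "i > D \<or> n - i > E" using n by auto
    then show "coeff p i * coeff q (n - i) = 0" using p q by (auto simp: ltop_def)
  qed
  moreover have "coeff (p * q) (D + E) = (\<Sum>i\<le>D + E. if i = D then a * b else 0)"
    unfolding coeff_mult
  proof (rule sum.cong[OF refl])
    fix i
    show "coeff p i * coeff q (D + E - i) = (if i = D then a * b else 0)"
    proof (cases "i = D")
      case False
      then have "i > D \<or> D + E - i > E" by auto
      then show ?thesis using p q False by (auto simp: ltop_def)
    qed (use p q in \<open>simp add: ltop_def\<close>)
  qed
  ultimately show ?thesis by (simp add: ltop_def)
qed

text \<open>Iterated leading coefficient, first in the outer and then in the inner variable; again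
  \<open>a\<close> may be 0.\<close>

definition top2 :: "nat \<Rightarrow> nat \<Rightarrow> 'a::zero poly poly \<Rightarrow> 'a \<Rightarrow> bool" where
  "top2 D E p a \<longleftrightarrow> (\<exists>b. ltop D p b \<and> ltop E b a)"

lemma top2_add: "top2 D E p a \<Longrightarrow> top2 D E q b \<Longrightarrow> top2 D E (p + q) (a + b)"
  unfolding top2_def by (meson ltop_add)

lemma top2_zero: "top2 D E 0 0"
  unfolding top2_def by (meson ltop_zero)

lemma top2_sum: "(\<And>i. i \<in> I \<Longrightarrow> top2 D E (f i) (a i)) \<Longrightarrow> top2 D E (sum f I) (sum a I)"
  by (induction I rule: infinite_finite_induct) (auto intro: top2_add top2_zero)

lemma top2_mult:
  fixes p q :: "'a::comm_ring_1 poly poly"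
  shows "top2 D E p a \<Longrightarrow> top2 D' E' q b \<Longrightarrow> top2 (D + D') (E + E') (p * q) (a * b)"
  unfolding top2_def by (meson ltop_mult)

lemma top2_const: "top2 0 0 [:[:a:]:] a"
  unfolding top2_def by (meson ltop_const)

lemma top2_scale: "top2 D E p a \<Longrightarrow> top2 D E ([:[:c:]:] * p) (c * a)"
  for p :: "'a::comm_ring_1 poly poly"
  using top2_mult[OF top2_const[of c], of D E p a] by simp

lemma top2_monom: "top2 d e (monom (monom a e) d) a"
  unfolding top2_def by (meson ltop_monom)

lemma top2_prod:
  fixes f :: "'i \<Rightarrow> 'a::comm_ring_1 poly poly"
  assumes "finite I" "\<And>i. i \<in> I \<Longrightarrow> top2 D E (f i) (a i)"
  shows "top2 (card I * D) (card I * E) (prod f I) (prod a I)"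
  using assms
proof (induction I rule: finite_induct)
  case empty
  then show ?case using top2_const[of "1::'a"] by (simp flip: one_pCons)
next
  case (insert i I)
  then show ?case using top2_mult[of D E "f i" "a i" "card I * D" "card I * E" "prod f I" "prod a I"] by simp
qed

text \<open>Independence of leading coefficient vectors passes to the polynomial vectors through
  this: if \<open>det U\<close> is nonzero, so is \<open>det W\<close>.\<close>

lemma top2_det:
  fixes W :: "'a::comm_ring_1 poly poly mat"
  assumes W: "W \<in> carrier_mat N N" and U: "U \<in> carrier_mat N N"
    and ltop: "\<And>i j. i < N \<Longrightarrow> j < N \<Longrightarrow> top2 D E (W $$ (i, j)) (U $$ (i, j))"
  shows "top2 (N * D) (N * E) (det W) (det U)"
  unfolding det_def'[OF W] det_def'[OF U]
proof (rule top2_sum)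
  fix p assume "p \<in> {p. p permutes {0..<N}}"
  then have p: "p permutes {0..<N}" by simp
  have "top2 (card {0..<N} * D) (card {0..<N} * E) (\<Prod>i = 0..<N. W $$ (i, p i)) (\<Prod>i = 0..<N. U $$ (i, p i))"
    by (rule top2_prod) (use ltop permutes_in_image[OF p] in auto)
  moreover have "signof p = ([:[:signof p:]:] :: 'a poly poly)"
    by (simp add: sign_def one_pCons)
  ultimately show "top2 (N * D) (N * E) (signof p * (\<Prod>i = 0..<N. W $$ (i, p i))) (signof p * (\<Prod>i = 0..<N. U $$ (i, p i)))"
    using top2_scale[of "N * D" "N * E" "\<Prod>i = 0..<N. W $$ (i, p i)" _ "signof p"] by simp
qed

lemma top2_exists:
  fixes w :: "'i \<Rightarrow> 'a::zero poly poly"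
  assumes I: "finite I" "i0 \<in> I" "w i0 \<noteq> 0"
  shows "\<exists>D E a. (\<forall>i\<in>I. top2 D E (w i) (a i)) \<and> (\<exists>i\<in>I. a i \<noteq> 0)"
proof -
  have lead: "\<exists>D. (\<forall>i\<in>I. ltop D (f i) (coeff (f i) D)) \<and> (\<exists>i\<in>I. coeff (f i) D \<noteq> 0)"
    if "\<exists>i\<in>I. f i \<noteq> 0" for f :: "'i \<Rightarrow> 'b::zero poly"
  proof -
    let ?J = "{i \<in> I. f i \<noteq> 0}"
    define D where "D = Max (degree ` f ` ?J)"
    have J: "finite (degree ` f ` ?J)" "degree ` f ` ?J \<noteq> {}" using I(1) that by auto
    have "\<forall>i\<in>I. ltop D (f i) (coeff (f i) D)"
    proof
      fix i assume "i \<in> I"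
      have "degree (f i) \<le> D"
      proof (cases "f i = 0")
        case False
        then show ?thesis unfolding D_def using J(1) \<open>i \<in> I\<close> by (intro Max_ge) auto
      qed simp
      then show "ltop D (f i) (coeff (f i) D)" by (auto simp: ltop_def coeff_eq_0)
    qed
    moreover obtain i where "i \<in> ?J" "degree (f i) = D"
      using Max_in[OF J] unfolding D_def by auto
    then have "\<exists>i\<in>I. coeff (f i) D \<noteq> 0" by (intro bexI[of _ i]) auto
    ultimately show ?thesis by blast
  qed
  obtain D where D: "\<forall>i\<in>I. ltop D (w i) (coeff (w i) D)" "\<exists>i\<in>I. coeff (w i) D \<noteq> 0"
    using lead[of w] I by blast
  obtain E where E: "\<forall>i\<in>I. ltop E (coeff (w i) D) (coeff (coeff (w i) D) E)" "\<exists>i\<in>I. coeff (coeff (w i) D) E \<noteq> 0"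
    using lead[of "\<lambda>i. coeff (w i) D"] D(2) by blast
  show ?thesis
    by (rule exI[of _ D], rule exI[of _ E], rule exI[of _ "\<lambda>i. coeff (coeff (w i) D) E"])
      (use D E in \<open>auto simp: top2_def\<close>)
qed

text \<open>A solution that vanishes at \<open>y\<close> is divided by its common linear factor; the
  total degree drops, so after finitely many divisions evaluation at \<open>y\<close> gives a
  nonzero solution.\<close>

lemma specialise_kernel:
  fixes v :: "'i \<Rightarrow> 'a::idom poly"
  assumes "finite I" "\<exists>i\<in>I. v i \<noteq> 0" "\<And>s. s \<in> S \<Longrightarrow> (\<Sum>i\<in>I. A s i * v i) = 0"
  shows "\<exists>v'. (\<exists>i\<in>I. v' i \<noteq> 0) \<and> (\<forall>s\<in>S. (\<Sum>i\<in>I. poly (A s i) y * v' i) = 0)"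
  using assms(2,3)
proof (induction "\<Sum>i\<in>I. degree (v i)" arbitrary: v rule: less_induct)
  case less
  show ?case
  proof (cases "\<exists>i\<in>I. poly (v i) y \<noteq> 0")
    case True
    have "(\<Sum>i\<in>I. poly (A s i) y * poly (v i) y) = 0" if "s \<in> S" for s
      using arg_cong[OF less.prems(2)[OF that], of "\<lambda>p. poly p y"] by (simp add: poly_sum)
    with True show ?thesis by (intro exI[of _ "\<lambda>i. poly (v i) y"]) auto
  next
    case False
    then have "\<forall>i\<in>I. \<exists>u. v i = [:- y, 1:] * u" by (auto simp: poly_eq_0_iff_dvd dvd_def)
    then obtain u where u: "\<And>i. i \<in> I \<Longrightarrow> v i = [:- y, 1:] * u i" by metis
    have deg: "degree (v i) = (if u i = 0 then 0 else Suc (degree (u i)))" if "i \<in> I" for i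
      using u[OF that] by (auto simp: degree_mult_eq simp del: mult_pCons_left)
    obtain i where i: "i \<in> I" "v i \<noteq> 0" using less.prems(1) by blast
    then have ui: "u i \<noteq> 0" using u by auto
    have "(\<Sum>i\<in>I. degree (u i)) < (\<Sum>i\<in>I. degree (v i))"
      by (rule sum_strict_mono_ex1) (use assms(1) i ui deg in auto)
    moreover have "(\<Sum>i\<in>I. A s i * u i) = 0" if "s \<in> S" for s
    proof -
      have "[:- y, 1:] * (\<Sum>i\<in>I. A s i * u i) = (\<Sum>i\<in>I. A s i * v i)"
        unfolding sum_distrib_left by (rule sum.cong) (simp_all add: u mult_ac del: mult_pCons_left mult_pCons_right)
      then have "[:- y, 1:] * (\<Sum>i\<in>I. A s i * u i) = 0" using less.prems(2)[OF that] by simp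
      then show ?thesis by (metis mult_eq_0_iff pCons_eq_0_iff one_neq_zero)
    qed
    ultimately show ?thesis using less.hyps[of u] i ui by blast
  qed
qed

lemma interpolation:
  fixes g :: "'b \<Rightarrow> 'a::field"
  assumes "finite S" "inj_on g S"
  shows "\<exists>p. \<forall>s\<in>S. poly p (g s) = f s"
  using assms
proof (induction S rule: finite_induct)
  case (insert s S)
  then obtain p where p: "\<forall>t\<in>S. poly p (g t) = f t" by auto
  define r where "r = (\<Prod>t\<in>S. [:- g t, 1:])"
  have r: "poly r (g s) \<noteq> 0" "\<And>t. t \<in> S \<Longrightarrow> poly r (g t) = 0"
    using insert.hyps insert.prems by (auto simp: r_def poly_prod)
  show ?case
    by (rule exI[of _ "p + smult ((f s - poly p (g s)) / poly r (g s)) r"]) (use p r in auto)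
qed simp

lemma poly_poly_zero_test:
  fixes q :: "'a::{idom, ring_char_0} poly poly"
  assumes "\<And>x y. poly (poly q [:y:]) x = 0"
  shows "q = 0"
proof (rule ccontr)
  assume "q \<noteq> 0"
  have "poly q [:y:] = 0" for y using assms poly_all_0_iff_0 by blast
  then have "range (\<lambda>y. [:y:]) \<subseteq> {x. poly q x = 0}" by auto
  moreover have "infinite (range (\<lambda>y::'a. [:y:]))"
    by (subst finite_image_iff) (auto simp: inj_on_def infinite_UNIV_char_0)
  ultimately show False using poly_roots_finite[OF \<open>q \<noteq> 0\<close>] finite_subset by blast
qed

lemma coeff_pcompose_scale: "coeff (pcompose p [:0, a:]) i = a ^ i * coeff p i"
  for p :: "'a::comm_ring_1 poly"
proof (induction p arbitrary: i)
  case (pCons c p)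
  then show ?case
    by (cases i) (auto simp: pcompose_pCons coeff_pCons mult_ac split: nat.splits)
qed simp

subsection \<open>The regularity lemma\<close>

declare mult_pCons_left [simp del] mult_pCons_right [simp del]

text \<open>The coefficient matrices \<open>T\<close> are deformed to \<open>T\<^bsub>bc\<^esub>(x, y) = y\<^bsup>(b - c) mod N\<^esup> p\<^bsub>b - c\<^esub>(\<omega>\<^sup>b x)\<close>,
  an element of a quantum torus, with \<open>T(1, 1) = T\<close>. The substitutions \<open>y := \<omega> y\<close> and
  \<open>x := \<omega> x\<close> amount to conjugation by the clock and the shift matrix, so leading coefficients of kernel
  vectors form a space stable under both, and this forces \<open>N\<close> independent kernel vectors.\<close>

lemma regularity:
  fixes z T :: "nat \<times> nat \<times> nat \<Rightarrow> complex"
  assumes n: "n > 0" and N: "N > 0"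
    and sing: "\<And>T. det (bigmat m n N z T) = 0"
  shows "\<exists>v. (\<exists>c<N. \<exists>j<n. v c j \<noteq> 0) \<and> in_kernel m n N z T v \<and>
    (\<forall>r<N - 1. (\<Sum>c<N. \<Sum>j<n. B r c j * v c j) = 0)"
proof -
  define om where "om = cis (2 * pi / real N)"
  have om_pow: "om ^ k = cis (2 * pi * real k / real N)" for k
    unfolding om_def DeMoivre by (simp add: mult_ac)
  have inj: "inj_on (\<lambda>k. om ^ k) {..<N}"
    using bij_betw_roots_unity[OF N] by (simp add: bij_betw_def om_pow)
  have omN: "om ^ N = 1" using N by (simp add: om_pow)
  have om0: "om \<noteq> 0" by (simp add: om_def)
  have ommod: "om ^ (k mod N) = om ^ k" for k
  proof -
    have "om ^ k = om ^ (N * (k div N) + k mod N)" by simp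
    also have "\<dots> = om ^ (k mod N)" by (simp only: power_add power_mult omN) simp
    finally show ?thesis by simp
  qed
  \<comment> \<open>The entries of \<open>T\<close> on the cyclic diagonal with \<open>b - c\<close>
    congruent to \<open>j\<close> are interpolated by one polynomial at the roots of unity.\<close>
  have "\<exists>p. \<forall>b<N. poly p (om ^ b) = T (k, b, (b + N - j) mod N)" for k j
    using interpolation[OF finite_lessThan inj, of "\<lambda>b. T (k, b, (b + N - j) mod N)"] by auto
  then obtain p where p: "\<And>k j b. b < N \<Longrightarrow> poly (p k j) (om ^ b) = T (k, b, (b + N - j) mod N)" by metis
  define Q :: "nat \<Rightarrow> nat \<Rightarrow> nat \<Rightarrow> complex poly poly" where
    "Q k b c = monom (pcompose (p k ((b + N - c) mod N)) [:0, om ^ b:]) ((b + N - c) mod N)" for k b c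
  define Tp where "Tp = (\<lambda>(k, b, c). Q k b c)"
  define zp where "zp = (\<lambda>v. [:[:z v:]:])"
  have Q1: "poly (poly (Q k b c) 1) 1 = T (k, b, c)" if "b < N" "c < N" for k b c
  proof -
    have "(b + N - (b + N - c) mod N) mod N = c"
    proof (cases "c \<le> b")
      case True
      then have "b + N - c = (b - c) + N" by simp
      then have "(b + N - c) mod N = b - c" using that by (metis mod_add_self2 mod_less less_imp_diff_less)
      moreover have "b + N - (b - c) = c + N" using True by simp
      ultimately show ?thesis using that by simp
    next
      case False
      then have "b + N - c < N" using that by linarith
      then have "(b + N - c) mod N = b + N - c" by simp
      moreover have "b + N - (b + N - c) = c" using that by linarith
      ultimately show ?thesis using that by simp
    qed
    then show ?thesis using p[OF that(1)] by (simp add: Q_def poly_monom poly_pcompose)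
  qed
  \<comment> \<open>Every specialisation of the deformed matrix at complex values of both variables
    is singular by \<open>sing\<close>.\<close>
  have "det (bigmat m n N zp Tp) = 0"
  proof (rule poly_poly_zero_test)
    fix x y :: complex
    have h: "comm_ring_hom (\<lambda>q :: complex poly poly. poly (poly q [:y:]) x)"
      by unfold_locales auto
    show "poly (poly (det (bigmat m n N zp Tp)) [:y:]) x = 0"
      using sing by (simp add: hom_bigmat[OF h] zp_def)
  qed
  then obtain w0 where w0: "\<exists>c<N. \<exists>j<n. w0 c j \<noteq> 0" "in_kernel m n N zp Tp w0"
    using det_bigmat_eq_0_iff[OF n] by blast
  define lead where "lead u w D E \<longleftrightarrow> in_kernel m n N zp Tp w \<and> (\<forall>c<N. \<forall>j<n. top2 D E (w c j) (u c j))"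
    for u :: "nat \<Rightarrow> nat \<Rightarrow> complex" and w D E
  \<comment> \<open>Leading vectors of polynomial kernel vectors, of whatever degrees.
    Multiplication by monomials (\<open>lead_shift\<close>) equalises degrees, so \<open>L\<close>
    is closed under addition.\<close>
  define L where "L = {u. \<exists>w D E. lead u w D E}"
  have ker_add: "in_kernel m n N zp Tp (\<lambda>c j. w c j + w' c j)"
    if "in_kernel m n N zp Tp w" "in_kernel m n N zp Tp w'" for w w'
    using that by (simp add: in_kernel_def distrib_left sum.distrib)
  have ker_scale: "in_kernel m n N zp Tp (\<lambda>c j. a * w c j)" if "in_kernel m n N zp Tp w" for a w
    using that by (simp add: in_kernel_def mult.left_commute[of _ a] flip: sum_distrib_left)
  have lead_scale: "lead (\<lambda>c j. a * u c j) (\<lambda>c j. [:[:a:]:] * w c j) D E" if "lead u w D E" for a u w D E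
    using that ker_scale[of w "[:[:a:]:]"] by (auto simp: lead_def intro!: top2_scale)
  have lead_shift: "lead u (\<lambda>c j. monom (monom 1 e) d * w c j) (d + D) (e + E)" if "lead u w D E" for u w D E d e
  proof -
    have "top2 (d + D) (e + E) (monom (monom 1 e) d * w c j) (u c j)" if "top2 D E (w c j) (u c j)" for c j
      using top2_mult[OF top2_monom that, of d e 1] by simp
    then show ?thesis using that ker_scale[of w] by (simp add: lead_def)
  qed
  have L_add: "(\<lambda>c j. u c j + u' c j) \<in> L" if uL: "u \<in> L" and uL': "u' \<in> L" for u u'
  proof -
    obtain w D E w' D' E' where 1: "lead u w D E" and 2: "lead u' w' D' E'" using uL uL' by (auto simp: L_def)
    have e1: "lead u (\<lambda>c j. monom (monom 1 E') D' * w c j) (D' + D) (E' + E)" by (rule lead_shift[OF 1])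
    have e2: "lead u' (\<lambda>c j. monom (monom 1 E) D * w' c j) (D' + D) (E' + E)"
      using lead_shift[OF 2, of E D] by (simp add: add.commute)
    have "lead (\<lambda>c j. u c j + u' c j) (\<lambda>c j. monom (monom 1 E') D' * w c j + monom (monom 1 E) D * w' c j) (D' + D) (E' + E)"
      using e1 e2 ker_add by (auto simp: lead_def intro!: top2_add)
    then show ?thesis by (auto simp: L_def)
  qed
  have L_scale: "(\<lambda>c j. a * u c j) \<in> L" if uL: "u \<in> L" for a u
  proof -
    obtain w D E where "lead u w D E" using uL by (auto simp: L_def)
    from lead_scale[OF this, of a] show ?thesis by (auto simp: L_def)
  qed
  have clock: "(\<lambda>c j. om ^ (N - c) * u c j) \<in> L" if uL: "u \<in> L" for u
  proof -
    obtain w D E where wL: "lead u w D E"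
      using uL by (auto simp: L_def)
    then have w: "in_kernel m n N zp Tp w" "\<And>c j. c < N \<Longrightarrow> j < n \<Longrightarrow> top2 D E (w c j) (u c j)"
      by (auto simp: lead_def)
    \<comment> \<open>The substitution of \<open>om * y\<close> for the outer variable. It
      multiplies the entry \<open>(b, c)\<close> by \<open>om ^ b\<close> and
      \<open>om ^ (N - c)\<close>: the first factor scales a whole equation, the second is absorbed
      by rescaling block \<open>c\<close> of the vector.\<close>
    define sy where "sy q = pcompose q [:0, [:om:]:]" for q :: "complex poly poly"
    interpret sy: comm_ring_hom sy
      by unfold_locales (auto simp: sy_def pcompose_add pcompose_mult pcompose_1)
    have csy: "coeff (sy q) i = smult (om ^ i) (coeff q i)" for q i
      by (simp add: sy_def coeff_pcompose_scale poly_const_pow mult_pCons_left)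
    have syz: "sy (zp v) = zp v" for v by (simp add: sy_def zp_def)
    have syT: "sy (Tp (k, b, c)) = [:[:om ^ b:]:] * [:[:om ^ (N - c):]:] * Tp (k, b, c)" if "c < N" for k b c
    proof (rule poly_eqI)
      fix i
      have "om ^ ((b + N - c) mod N) = om ^ b * om ^ (N - c)"
        unfolding ommod power_add[symmetric] using that by simp
      then show "coeff (sy (Tp (k, b, c))) i = coeff ([:[:om ^ b:]:] * [:[:om ^ (N - c):]:] * Tp (k, b, c)) i"
        by (auto simp: csy Tp_def Q_def mult_pCons_left)
    qed
    let ?w = "\<lambda>c j. [:[:om ^ (N - c):]:] * sy (w c j)"
    have "in_kernel m n N zp Tp ?w"
      unfolding in_kernel_def
    proof (intro allI impI)
      fix b i assume bi: "b < N" "i < n"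
      have "0 = sy (\<Sum>c<N. \<Sum>j<n. (\<Sum>k<m. zp (k, i, j) * Tp (k, b, c)) * w c j)"
        using w(1) bi by (simp add: in_kernel_def)
      also have "\<dots> = (\<Sum>c<N. \<Sum>j<n. (\<Sum>k<m. zp (k, i, j) * sy (Tp (k, b, c))) * sy (w c j))"
        by (simp only: sy.hom_sum sy.hom_mult syz)
      also have "\<dots> = (\<Sum>c<N. \<Sum>j<n. [:[:om ^ b:]:] * ((\<Sum>k<m. zp (k, i, j) * Tp (k, b, c)) * ?w c j))"
      proof (intro sum.cong refl)
        fix c j assume "c \<in> {..<N}"
        then have "(\<Sum>k<m. zp (k, i, j) * sy (Tp (k, b, c))) =
          (\<Sum>k<m. ([:[:om ^ b:]:] * [:[:om ^ (N - c):]:]) * (zp (k, i, j) * Tp (k, b, c)))"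
          by (intro sum.cong refl) (simp only: syT lessThan_iff mult_ac)
        also have "\<dots> = ([:[:om ^ b:]:] * [:[:om ^ (N - c):]:]) * (\<Sum>k<m. zp (k, i, j) * Tp (k, b, c))"
          by (simp only: sum_distrib_left)
        finally have eq: "(\<Sum>k<m. zp (k, i, j) * sy (Tp (k, b, c))) =
          ([:[:om ^ b:]:] * [:[:om ^ (N - c):]:]) * (\<Sum>k<m. zp (k, i, j) * Tp (k, b, c))" .
        show "(\<Sum>k<m. zp (k, i, j) * sy (Tp (k, b, c))) * sy (w c j) =
          [:[:om ^ b:]:] * ((\<Sum>k<m. zp (k, i, j) * Tp (k, b, c)) * ?w c j)"
          unfolding eq by (simp only: mult_ac)
      qed
      also have "\<dots> = [:[:om ^ b:]:] * (\<Sum>c<N. \<Sum>j<n. (\<Sum>k<m. zp (k, i, j) * Tp (k, b, c)) * ?w c j)"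
        by (simp only: sum_distrib_left)
      finally have "[:[:om ^ b:]:] * (\<Sum>c<N. \<Sum>j<n. (\<Sum>k<m. zp (k, i, j) * Tp (k, b, c)) * ?w c j) = 0"
        by (rule sym)
      moreover have "[:[:om ^ b:]:] \<noteq> 0" using om0 by simp
      ultimately show "(\<Sum>c<N. \<Sum>j<n. (\<Sum>k<m. zp (k, i, j) * Tp (k, b, c)) * ?w c j) = 0"
        unfolding mult_eq_0_iff by blast
    qed
    moreover have "top2 D E (?w c j) (om ^ (N - c) * (om ^ D * u c j))" if cj: "c < N" "j < n" for c j
    proof (rule top2_scale)
      obtain b where "ltop D (w c j) b" "ltop E b (u c j)" using w(2)[OF cj] by (auto simp: top2_def)
      then have "ltop D (sy (w c j)) (smult (om ^ D) b)" "ltop E (smult (om ^ D) b) (om ^ D * u c j)"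
        by (auto simp: ltop_def csy)
      then show "top2 D E (sy (w c j)) (om ^ D * u c j)" by (auto simp: top2_def)
    qed
    ultimately have "lead (\<lambda>c j. om ^ (N - c) * (om ^ D * u c j)) ?w D E" by (simp add: lead_def)
    then have "(\<lambda>c j. om ^ (N - c) * (om ^ D * u c j)) \<in> L" by (auto simp: L_def)
    then have "(\<lambda>c j. inverse (om ^ D) * (om ^ (N - c) * (om ^ D * u c j))) \<in> L" by (rule L_scale)
    moreover have "(\<lambda>c j. inverse (om ^ D) * (om ^ (N - c) * (om ^ D * u c j))) = (\<lambda>c j. om ^ (N - c) * u c j)"
      using om0 by (simp add: fun_eq_iff)
    ultimately show ?thesis by (simp only:)
  qed
  have shift: "(\<lambda>c j. u ((c + N - 1) mod N) j) \<in> L" if uL: "u \<in> L" for u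
  proof -
    obtain w D E where wL: "lead u w D E"
      using uL by (auto simp: L_def)
    then have w: "in_kernel m n N zp Tp w" "\<And>c j. c < N \<Longrightarrow> j < n \<Longrightarrow> top2 D E (w c j) (u c j)"
      by (auto simp: lead_def)
    \<comment> \<open>The substitution of \<open>om * x\<close> for the inner variable, which moves
      the entry \<open>(b, c)\<close> to \<open>(b + 1, c + 1)\<close> modulo
      \<open>N\<close>.\<close>
    define sx where "sx = map_poly (\<lambda>q :: complex poly. pcompose q [:0, om:])"
    interpret px: comm_ring_hom "\<lambda>q :: complex poly. pcompose q [:0, om:]"
      by unfold_locales (auto simp: pcompose_add pcompose_mult pcompose_1)
    interpret mx: map_poly_comm_ring_hom "\<lambda>q :: complex poly. pcompose q [:0, om:]" by unfold_locales
    have sx: "comm_ring_hom sx" unfolding sx_def by unfold_locales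
    interpret sx: comm_ring_hom sx by (rule sx)
    have csx: "coeff (sx q) i = pcompose (coeff q i) [:0, om:]" for q i
      by (simp add: sx_def coeff_map_poly)
    have sxz: "sx (zp v) = zp v" for v
      by (rule poly_eqI) (simp add: csx zp_def coeff_pCons split: nat.splits)
    have sxT: "sx (Tp (k, b, c)) = Tp (k, (b + 1) mod N, (c + 1) mod N)" if "b < N" "c < N" for k b c
    proof (rule poly_eqI)
      fix i
      have j: "((b + 1) mod N + N - (c + 1) mod N) mod N = (b + N - c) mod N"
      proof -
        have I: "int ((x + N - y) mod N) = (int x - int y) mod int N" if "y < N" for x y
        proof -
          have "int (x + N - y) = (int x - int y) + int N" using that by simp
          then show ?thesis by (simp add: zmod_int)
        qed
        have "int (((b + 1) mod N + N - (c + 1) mod N) mod N) = int ((b + N - c) mod N)"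
          unfolding I[OF that(2)] I[OF mod_less_divisor[OF N]] by (simp add: zmod_int mod_simps)
        then show ?thesis by (simp only: of_nat_eq_iff)
      qed
      have "pcompose (pcompose q [:0, om ^ b:]) [:0, om:] = pcompose q [:0, om ^ ((b + 1) mod N):]" for q
        by (simp add: pcompose_pCons mult_pCons_left ommod mult.commute flip: pcompose_assoc)
      then show "coeff (sx (Tp (k, b, c))) i = coeff (Tp (k, (b + 1) mod N, (c + 1) mod N)) i"
        by (auto simp: csx Tp_def Q_def j[unfolded Suc_eq_plus1[symmetric]])
    qed
    let ?w = "\<lambda>c j. sx (w ((c + N - 1) mod N) j)"
    have bk: "((c + 1) mod N + N - 1) mod N = c" if "c < N" for c
      using that N by (cases "c + 1 = N") auto
    have fwd: "((c + N - 1) mod N + 1) mod N = c" if "c < N" for c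
      unfolding mod_add_left_eq using that N by simp
    have bij: "bij_betw (\<lambda>c. (c + 1) mod N) {..<N} {..<N}"
      by (rule bij_betwI[where g = "\<lambda>c. (c + N - 1) mod N"]) (use N bk fwd in auto)
    have "in_kernel m n N zp Tp ?w"
      unfolding in_kernel_def
    proof (intro allI impI)
      fix b' i assume b': "b' < N" and i: "i < n"
      then obtain b where b: "b < N" "b' = (b + 1) mod N" using bij by (auto simp: bij_betw_def image_iff set_eq_iff)
      have "0 = sx (\<Sum>c<N. \<Sum>j<n. (\<Sum>k<m. zp (k, i, j) * Tp (k, b, c)) * w c j)"
        using w(1) b i by (simp add: in_kernel_def)
      also have "\<dots> = (\<Sum>c<N. \<Sum>j<n. (\<Sum>k<m. zp (k, i, j) * sx (Tp (k, b, c))) * sx (w c j))"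
        by (simp only: sx.hom_sum sx.hom_mult sxz)
      also have "\<dots> = (\<Sum>c<N. \<Sum>j<n. (\<Sum>k<m. zp (k, i, j) * Tp (k, b', (c + 1) mod N)) * ?w ((c + 1) mod N) j)"
      proof (intro sum.cong refl)
        fix c j assume "c \<in> {..<N}"
        then have c: "c < N" by simp
        show "(\<Sum>k<m. zp (k, i, j) * sx (Tp (k, b, c))) * sx (w c j) =
          (\<Sum>k<m. zp (k, i, j) * Tp (k, b', (c + 1) mod N)) * ?w ((c + 1) mod N) j"
          unfolding bk[OF c] sxT[OF b(1) c] b(2) by (rule refl)
      qed
      also have "\<dots> = (\<Sum>c<N. \<Sum>j<n. (\<Sum>k<m. zp (k, i, j) * Tp (k, b', c)) * ?w c j)"
        by (rule sum.reindex_bij_betw[OF bij])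
      finally show "(\<Sum>c<N. \<Sum>j<n. (\<Sum>k<m. zp (k, i, j) * Tp (k, b', c)) * ?w c j) = 0" by simp
    qed
    moreover have "top2 D E (?w c j) (om ^ E * u ((c + N - 1) mod N) j)" if "c < N" "j < n" for c j
    proof -
      have "(c + N - 1) mod N < N" using N by simp
      from w(2)[OF this that(2)] obtain b where "ltop D (w ((c + N - 1) mod N) j) b" "ltop E b (u ((c + N - 1) mod N) j)"
        by (auto simp: top2_def)
      then have "ltop D (?w c j) (pcompose b [:0, om:])" "ltop E (pcompose b [:0, om:]) (om ^ E * u ((c + N - 1) mod N) j)"
        by (auto simp: ltop_def csx coeff_pcompose_scale)
      then show ?thesis by (auto simp: top2_def)
    qed
    ultimately have "lead (\<lambda>c j. om ^ E * u ((c + N - 1) mod N) j) ?w D E" by (simp add: lead_def)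
    then have "(\<lambda>c j. om ^ E * u ((c + N - 1) mod N) j) \<in> L" by (auto simp: L_def)
    then have "(\<lambda>c j. inverse (om ^ E) * (om ^ E * u ((c + N - 1) mod N) j)) \<in> L" by (rule L_scale)
    moreover have "(\<lambda>c j. inverse (om ^ E) * (om ^ E * u ((c + N - 1) mod N) j)) = (\<lambda>c j. u ((c + N - 1) mod N) j)"
      using om0 by (simp add: fun_eq_iff)
    ultimately show ?thesis by (simp only:)
  qed
  define supp where "supp u = {c. c < N \<and> (\<exists>j<n. u c j \<noteq> 0)}" for u :: "nat \<Rightarrow> nat \<Rightarrow> complex"
  have fins: "finite (supp u)" for u by (simp add: supp_def)
  have "\<exists>u\<in>L. supp u \<noteq> {}"
  proof -
    let ?I = "{..<N} \<times> {..<n}"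
    obtain c0 j0 where "c0 < N" "j0 < n" "w0 c0 j0 \<noteq> 0" using w0(1) by blast
    then have "\<exists>D E a. (\<forall>i\<in>?I. top2 D E ((\<lambda>(c, j). w0 c j) i) (a i)) \<and> (\<exists>i\<in>?I. a i \<noteq> 0)"
      by (intro top2_exists[of _ "(c0, j0)"]) auto
    then obtain D E and a :: "nat \<times> nat \<Rightarrow> complex" where a: "\<forall>i\<in>?I. top2 D E ((\<lambda>(c, j). w0 c j) i) (a i)" "\<exists>i\<in>?I. a i \<noteq> 0" by blast
    have "lead (\<lambda>c j. a (c, j)) w0 D E" using a(1) w0(2) by (auto simp: lead_def)
    then have "(\<lambda>c j. a (c, j)) \<in> L" by (auto simp: L_def)
    moreover have "supp (\<lambda>c j. a (c, j)) \<noteq> {}" using a(2) by (auto simp: supp_def)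
    ultimately show ?thesis by blast
  qed
  \<comment> \<open>Minimal support in the number of blocks; clock invariance will force this
    support to be a single block.\<close>
  then obtain u where u: "u \<in> L" "supp u \<noteq> {}" "\<And>u'. u' \<in> L \<Longrightarrow> supp u' \<noteq> {} \<Longrightarrow> card (supp u) \<le> card (supp u')"
    using arg_min_natI[of "\<lambda>u. u \<in> L \<and> supp u \<noteq> {}" _ "\<lambda>u. card (supp u)"]
      arg_min_nat_le[of "\<lambda>u. u \<in> L \<and> supp u \<noteq> {}" _ "\<lambda>u. card (supp u)"] by blast
  obtain c0 where c0: "c0 \<in> supp u" using u(2) by blast
  have single: "c = c0" if c: "c \<in> supp u" for c
  proof (rule ccontr)
    assume ne: "c \<noteq> c0"
    \<comment> \<open>Distinct blocks have distinct eigenvalues under the clock, so this combination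
      kills block \<open>c0\<close> and keeps block \<open>c\<close>.\<close>
    let ?u = "\<lambda>c j. om ^ (N - c) * u c j + (- (om ^ (N - c0))) * u c j"
    have uL: "?u \<in> L" using L_add[OF clock[OF u(1)] L_scale[OF u(1)]] by blast
    have "om ^ (N - c) \<noteq> om ^ (N - c0)"
    proof
      assume eq: "om ^ (N - c) = om ^ (N - c0)"
      have inv: "om ^ (N - d) * om ^ d = 1" if "d \<in> supp u" for d
        using that omN by (simp add: supp_def flip: power_add)
      have "om ^ c = om ^ c * (om ^ (N - c0) * om ^ c0)" using inv[OF c0] by simp
      also have "\<dots> = (om ^ (N - c) * om ^ c) * om ^ c0" unfolding eq by (simp only: mult_ac)
      also have "\<dots> = om ^ c0" using inv[OF c] by simp
      finally show False using inj ne c c0 by (auto simp: supp_def inj_on_def)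
    qed
    then have "c \<in> supp ?u" using c by (auto simp: supp_def algebra_simps)
    then have "supp ?u \<noteq> {}" by blast
    from u(3)[OF uL this] have "card (supp u) \<le> card (supp ?u)" .
    also have "\<dots> \<le> card (supp u - {c0})"
      by (rule card_mono) (use fins in \<open>auto simp: supp_def\<close>)
    also have "\<dots> < card (supp u)" using fins c0 by (rule card_Diff1_less)
    finally show False by simp
  qed
  have c0N: "c0 < N" using c0 by (simp add: supp_def)
  define a where "a = u c0"
  obtain j0 where j0: "j0 < n" "a j0 \<noteq> 0" using c0 by (auto simp: supp_def a_def)
  have u_eq: "u c j = (if c = c0 then a j else 0)" if "c < N" "j < n" for c j
    using single[of c] that by (auto simp: supp_def a_def)
  \<comment> \<open>Shifting carries the same vector \<open>a\<close> into every block, which yields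
    \<open>N\<close> leading vectors.\<close>
  have orbit: "\<exists>u'\<in>L. \<forall>c<N. \<forall>j<n. u' c j = (if c = (c0 + t) mod N then a j else 0)" for t
  proof (induction t)
    case 0
    then show ?case using u_eq c0N by (intro bexI[OF _ u(1)]) simp
  next
    case (Suc t)
    then obtain u' where u': "u' \<in> L" "\<forall>c<N. \<forall>j<n. u' c j = (if c = (c0 + t) mod N then a j else 0)" by blast
    have iff: "(c + N - 1) mod N = s mod N \<longleftrightarrow> c = Suc s mod N" if "c < N" for c s
    proof
      assume "(c + N - 1) mod N = s mod N"
      then have "((c + N - 1) mod N + 1) mod N = (s mod N + 1) mod N" by simp
      then have "(c + N - 1 + 1) mod N = (s + 1) mod N" by (simp only: mod_add_left_eq)
      then show "c = Suc s mod N" using that N by simp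
    next
      assume "c = Suc s mod N"
      then have "(c + N - 1) mod N = (Suc s mod N + (N - 1)) mod N" using N by simp
      also have "\<dots> = (Suc s + (N - 1)) mod N" by (rule mod_add_left_eq)
      also have "Suc s + (N - 1) = s + N" using N by simp
      finally show "(c + N - 1) mod N = s mod N" by simp
    qed
    show ?case
    proof (intro bexI[OF _ shift[OF u'(1)]] allI impI)
      fix c j assume "c < N" "j < n"
      moreover have "(c + N - 1) mod N < N" using N by simp
      ultimately show "u' ((c + N - 1) mod N) j = (if c = (c0 + Suc t) mod N then a j else 0)"
        using u'(2) iff[of c "c0 + t"] by simp
    qed
  qed
  have "\<exists>w D E. lead (\<lambda>c j. if c = d then a j else 0) w D E" if "d < N" for d
  proof -
    have "(c0 + (d + N - c0)) mod N = d" using that c0N by simp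
    then obtain u' where "u' \<in> L" "\<forall>c<N. \<forall>j<n. u' c j = (if c = d then a j else 0)"
      using orbit[of "d + N - c0"] by auto
    moreover from this obtain w D E where "lead u' w D E" by (auto simp: L_def)
    ultimately have "lead (\<lambda>c j. if c = d then a j else 0) w D E" by (simp add: lead_def)
    then show ?thesis by blast
  qed
  then obtain w D E where wDE: "\<And>d. d < N \<Longrightarrow> lead (\<lambda>c j. if c = d then a j else 0) (w d) (D d) (E d)" by metis
  define DD where "DD = (\<Sum>d<N. D d)"
  define EE where "EE = (\<Sum>d<N. E d)"
  \<comment> \<open>Monomial factors bring the \<open>N\<close> kernel vectors to common degrees
    \<open>DD\<close> and \<open>EE\<close>, as needed for \<open>top2_det\<close>.\<close>
  define W where "W d c j = monom (monom 1 (EE - E d)) (DD - D d) * w d c j" for d c j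
  have W: "lead (\<lambda>c j. if c = d then a j else 0) (W d) DD EE" if "d < N" for d
  proof -
    have "D d \<le> DD" "E d \<le> EE" unfolding DD_def EE_def using that by (auto intro: member_le_sum)
    then show ?thesis using lead_shift[OF wDE[OF that], of "EE - E d" "DD - D d"] by (simp add: W_def[abs_def])
  qed
  define mm where "mm d r = (\<Sum>c<N. \<Sum>j<n. [:[:B r c j:]:] * W d c j)" for d r
  \<comment> \<open>There are \<open>N\<close> vectors and only \<open>N - 1\<close> conditions, so
    some nontrivial combination satisfies them all.\<close>
  obtain la where la: "\<exists>d\<in>{..<N}. la d \<noteq> 0" "\<forall>r\<in>{..<N - 1}. (\<Sum>d<N. la d * mm d r) = 0"
    using lin_dep[of "{..<N}" "{..<N - 1}" mm] N by auto
  define v where "v c j = (\<Sum>d<N. la d * W d c j)" for c j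
  have vker: "in_kernel m n N zp Tp v"
  proof -
    have "in_kernel m n N zp Tp (\<lambda>c j. \<Sum>d\<in>S. la d * W d c j)" if "S \<subseteq> {..<N}" for S
      using finite_subset[OF that finite_lessThan] that
    proof (induction S rule: finite_induct)
      case empty
      then show ?case by (simp add: in_kernel_def)
    next
      case (insert d S)
      then show ?case using ker_add[OF ker_scale] W[of d] by (simp add: lead_def)
    qed
    then show ?thesis unfolding v_def by blast
  qed
  have vB: "(\<Sum>c<N. \<Sum>j<n. [:[:B r c j:]:] * v c j) = 0" if "r < N - 1" for r
  proof -
    have "(\<Sum>c<N. \<Sum>j<n. [:[:B r c j:]:] * v c j) = (\<Sum>c<N. \<Sum>j<n. \<Sum>d<N. la d * ([:[:B r c j:]:] * W d c j))"
      unfolding v_def sum_distrib_left by (simp only: mult.left_commute)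
    also have "\<dots> = (\<Sum>c<N. \<Sum>d<N. \<Sum>j<n. la d * ([:[:B r c j:]:] * W d c j))"
      by (intro sum.cong refl sum.swap)
    also have "\<dots> = (\<Sum>d<N. \<Sum>c<N. \<Sum>j<n. la d * ([:[:B r c j:]:] * W d c j))" by (rule sum.swap)
    also have "\<dots> = (\<Sum>d<N. la d * mm d r)" by (simp only: mm_def sum_distrib_left)
    finally show ?thesis using la(2) that by simp
  qed
  \<comment> \<open>The combination is not 0: in coordinate \<open>j0\<close> the leading
    coefficients of the \<open>N\<close> vectors form \<open>a j0\<close> times the identity, whose
    determinant is nonzero.\<close>
  have v0: "\<exists>c<N. v c j0 \<noteq> 0"
  proof (rule ccontr)
    assume neg: "\<not> ?thesis"
    let ?W = "mat N N (\<lambda>(c, d). W d c j0)" and ?U = "mat N N (\<lambda>(c, d). if c = d then a j0 else 0)"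
    have "?W *\<^sub>v vec N la = 0\<^sub>v N"
      by (rule eq_vecI) (use neg in \<open>auto simp: scalar_prod_def v_def atLeast0LessThan mult.commute\<close>)
    moreover have "vec N la \<noteq> 0\<^sub>v N" using la(1) by (metis index_vec index_zero_vec(1) lessThan_iff)
    ultimately have "det ?W = 0"
      using det_0_iff_vec_prod_zero[of ?W N] by (metis mat_carrier vec_carrier)
    moreover have "top2 (N * DD) (N * EE) (det ?W) (det ?U)"
      by (rule top2_det) (use W j0(1) in \<open>auto simp: lead_def\<close>)
    ultimately have "det ?U = 0" by (auto simp: top2_def ltop_def)
    moreover have "det ?U = a j0 ^ N"
    proof -
      have "?U = a j0 \<cdot>\<^sub>m 1\<^sub>m N" by (rule eq_matI) auto
      then show ?thesis by simp
    qed
    ultimately show False using j0(2) by simp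
  qed
  let ?I = "{..<N} \<times> {..<n}"
  \<comment> \<open>Kernel equations (\<open>Inl\<close>) and extra conditions (\<open>Inr\<close>)
    form one linear system, so both survive the specialisation of the outer and then the inner
    variable to 1.\<close>
  define S :: "(nat \<times> nat + nat) set" where "S = Inl ` ({..<N} \<times> {..<n}) \<union> Inr ` {..<N - 1}"
  define A where "A s = (case s of Inl (b, i) \<Rightarrow> \<lambda>(c, j). (\<Sum>k<m. zp (k, i, j) * Tp (k, b, c))
    | Inr r \<Rightarrow> \<lambda>(c, j). [:[:B r c j:]:])" for s
  have v_eq: "(\<Sum>i\<in>?I. A s i * (\<lambda>(c, j). v c j) i) = 0" if "s \<in> S" for s
    using that vker vB
    by (auto simp: S_def A_def in_kernel_def sum.cartesian_product')
  have "\<exists>v'. (\<exists>i\<in>?I. v' i \<noteq> 0) \<and> (\<forall>s\<in>S. (\<Sum>i\<in>?I. poly (A s i) 1 * v' i) = 0)"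
    by (rule specialise_kernel[of ?I "\<lambda>(c, j). v c j" S A 1]) (use v0 j0(1) v_eq in auto)
  then obtain v1 where v1: "\<exists>i\<in>?I. v1 i \<noteq> 0" "\<And>s. s \<in> S \<Longrightarrow> (\<Sum>i\<in>?I. poly (A s i) 1 * v1 i) = 0" by blast
  have "\<exists>v'. (\<exists>i\<in>?I. v' i \<noteq> 0) \<and> (\<forall>s\<in>S. (\<Sum>i\<in>?I. poly (poly (A s i) 1) 1 * v' i) = 0)"
    by (rule specialise_kernel[of ?I v1 S "\<lambda>s i. poly (A s i) 1" 1]) (use v1 in auto)
  then obtain v2 where v2: "\<exists>i\<in>?I. v2 i \<noteq> 0" "\<And>s. s \<in> S \<Longrightarrow> (\<Sum>i\<in>?I. poly (poly (A s i) 1) 1 * v2 i) = 0" by blast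
  show ?thesis
  proof (intro exI[of _ "\<lambda>c j. v2 (c, j)"] conjI)
    show "\<exists>c<N. \<exists>j<n. v2 (c, j) \<noteq> 0" using v2(1) by auto
    show "in_kernel m n N z T (\<lambda>c j. v2 (c, j))"
      unfolding in_kernel_def
    proof (intro allI impI)
      fix b i assume bi: "b < N" "i < n"
      then have "Inl (b, i) \<in> S" by (auto simp: S_def)
      from v2(2)[OF this] have "(\<Sum>c<N. \<Sum>j<n. (\<Sum>k<m. z (k, i, j) * poly (poly (Tp (k, b, c)) 1) 1) * v2 (c, j)) = 0"
        by (simp add: A_def poly_sum zp_def sum.cartesian_product')
      moreover have "poly (poly (Tp (k, b, c)) 1) 1 = T (k, b, c)" if "c < N" for k c
        using Q1[OF bi(1) that] by (simp add: Tp_def)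
      ultimately show "(\<Sum>c<N. \<Sum>j<n. (\<Sum>k<m. z (k, i, j) * T (k, b, c)) * v2 (c, j)) = 0" by simp
    qed
    show "\<forall>r<N - 1. (\<Sum>c<N. \<Sum>j<n. B r c j * v2 (c, j)) = 0"
    proof (intro allI impI)
      fix r assume "r < N - 1"
      then have "Inr r \<in> S" by (auto simp: S_def)
      from v2(2)[OF this] show "(\<Sum>c<N. \<Sum>j<n. B r c j * v2 (c, j)) = 0"
        by (simp add: A_def sum.cartesian_product')
    qed
  qed
qed

lemma sum_skip:
  fixes g :: "nat \<Rightarrow> 'a::comm_monoid_add"
  assumes "j \<le> N"
  shows "(\<Sum>c<Suc N. g c) = g j + (\<Sum>c<N. g (if c < j then c else Suc c))"
proof -
  let ?s = "\<lambda>c. if c < j then c else Suc c"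
  have inj: "inj_on ?s {..<N}" by (auto simp: inj_on_def split: if_splits)
  have eq: "{..<Suc N} = insert j (?s ` {..<N})"
  proof (intro Set.set_eqI iffI)
    fix c assume c: "c \<in> {..<Suc N}"
    show "c \<in> insert j (?s ` {..<N})"
    proof (cases "c < j")
      case True
      then show ?thesis using assms by (intro insertI2 image_eqI[of _ _ c]) auto
    next
      case False
      show ?thesis
      proof (cases "c = j")
        case neq: False
        then show ?thesis using False c by (intro insertI2 image_eqI[of _ _ "c - 1"]) auto
      qed simp
    qed
  qed (use assms in auto)
  have "j \<notin> ?s ` {..<N}" by (auto split: if_splits)
  then have "(\<Sum>c<Suc N. g c) = g j + sum g (?s ` {..<N})"
    unfolding eq by (intro sum.insert finite_imageI finite_lessThan)
  also have "sum g (?s ` {..<N}) = (\<Sum>c<N. g (?s c))" using sum.reindex[OF inj, of g] by (simp only: comp_def)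
  finally show ?thesis .
qed

text \<open>Deleting the last block row except its top line and any block column leaves a matrix with a
  kernel, and these kernel vectors are all proportional.\<close>

lemma singular_descent:
  fixes z T :: "nat \<times> nat \<times> nat \<Rightarrow> complex"
  assumes n: "n > 0" and N: "n \<le> N" and sing: "\<And>T. det (bigmat m n N z T) = 0"
  shows "det (bigmat m n (Suc N) z T) = 0"
proof (rule ccontr)
  assume ns: "det (bigmat m n (Suc N) z T) \<noteq> 0"
  define row where "row b i v = (\<Sum>c<Suc N. \<Sum>l<n. (\<Sum>k<m. z (k, i, l) * T (k, b, c)) * v c l)"
    for b i and v :: "nat \<Rightarrow> nat \<Rightarrow> complex"
  have inj: "v c l = 0" if "\<And>b i. b < Suc N \<Longrightarrow> i < n \<Longrightarrow> row b i v = 0" "c < Suc N" "l < n" for v c l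
    using ns that unfolding det_bigmat_eq_0_iff[OF n] in_kernel_def row_def by blast
  have "\<exists>u. (\<forall>b<Suc N. \<forall>i<n. row b i u = (if b = N \<and> i = 0 then 1 else 0)) \<and> (\<forall>l<n. u j l = 0)" if j: "j \<le> N" for j
  proof -
    define s where "s c = (if c < j then c else Suc c)" for c
    have sN: "s c < Suc N" if "c < N" for c using that by (simp add: s_def)
    define T' where "T' = (\<lambda>(k, b, c). T (k, b, s c))"
    define B where "B r c l = (if Suc r < n then \<Sum>k<m. z (k, Suc r, l) * T (k, N, s c) else 0)" for r c l
    obtain v where v: "\<exists>c<N. \<exists>l<n. v c l \<noteq> 0" "in_kernel m n N z T' v"
      "\<And>r. r < N - 1 \<Longrightarrow> (\<Sum>c<N. \<Sum>l<n. B r c l * v c l) = 0"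
      using regularity[OF n _ sing, of T' B] n N by auto
    define v' where "v' c l = (if c < j then v c l else if c = j then 0 else v (c - 1) l)" for c l
    have v's: "v' (s c) l = v c l" for c l by (simp add: v'_def s_def)
    have row: "row b i v' = (\<Sum>c<N. \<Sum>l<n. (\<Sum>k<m. z (k, i, l) * T (k, b, s c)) * v c l)" for b i
      unfolding row_def sum_skip[OF j] s_def[symmetric] v's by (simp add: v'_def)
    have z1: "row b i v' = 0" if "b < N" "i < n" for b i
      using v(2) that by (simp add: row in_kernel_def T'_def)
    have z2: "row N i v' = 0" if "0 < i" "i < n" for i
    proof -
      have "i - 1 < N - 1" using that N by auto
      from v(3)[OF this] show ?thesis using that by (simp add: row B_def)
    qed
    have "row N 0 v' \<noteq> 0"
    proof
      assume "row N 0 v' = 0"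
      then have all0: "row b i v' = 0" if "b < Suc N" "i < n" for b i
        using that z1 z2 by (cases "b = N"; cases "i = 0") auto
      obtain c l where "c < N" "l < n" "v c l \<noteq> 0" using v(1) by blast
      then show False using inj[OF all0 sN] v's by metis
    qed
    moreover have "row b i (\<lambda>c l. a * v' c l) = a * row b i v'" for a b i
      by (simp add: row_def sum_distrib_left mult.left_commute[of a] del: sum.lessThan_Suc)
    ultimately have "\<forall>b<Suc N. \<forall>i<n. row b i (\<lambda>c l. inverse (row N 0 v') * v' c l) = (if b = N \<and> i = 0 then 1 else 0)"
      using z1 z2 by (auto simp: less_Suc_eq)
    moreover have "v' j l = 0" for l by (simp add: v'_def)
    ultimately show ?thesis by (intro exI[of _ "\<lambda>c l. inverse (row N 0 v') * v' c l"]) auto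
  qed
  then obtain u where u: "\<And>j b i. j \<le> N \<Longrightarrow> b < Suc N \<Longrightarrow> i < n \<Longrightarrow> row b i (u j) = (if b = N \<and> i = 0 then 1 else 0)"
    "\<And>j l. j \<le> N \<Longrightarrow> l < n \<Longrightarrow> u j j l = 0" by metis
  have diff: "row b i (\<lambda>c l. x c l - y c l) = row b i x - row b i y" for b i x y
    by (simp add: row_def right_diff_distrib sum_subtractf del: sum.lessThan_Suc)
  \<comment> \<open>All \<open>u j\<close> have the same image under a nonsingular matrix, so they
    coincide. Since \<open>u j\<close> is 0 in block \<open>j\<close>, the common vector is 0,
    against its image being nonzero.\<close>
  have eq: "u j c l = u 0 c l" if "j \<le> N" "c < Suc N" "l < n" for j c l
    using inj[of "\<lambda>c l. u j c l - u 0 c l" c l] that u(1) by (simp add: diff)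
  have "u 0 j l = 0" if "j \<le> N" "l < n" for j l using eq[of j j l] u(2)[of j l] that by simp
  then have "row N 0 (u 0) = 0" by (simp add: row_def del: sum.lessThan_Suc)
  then show False using u(1)[of 0 N 0] n by simp
qed

lemma singular_all:
  fixes z :: "nat \<times> nat \<times> nat \<Rightarrow> complex"
  assumes n: "n > 0" and sing: "\<And>T. det (bigmat m n n z T) = 0" and N: "n \<le> N"
  shows "det (bigmat m n N z T) = 0"
  using N
proof (induction N arbitrary: T rule: dec_induct)
  case base
  then show ?case by (rule sing)
next
  case (step N)
  then show ?case by (intro singular_descent n) auto
qed

section \<open>The first fundamental theorem\<close>

text \<open>A monomial with ordered factors. Permutations of the \<open>e\<close> positions then
  replace the combinatorics of multisets.\<close>

definition word :: "nat \<Rightarrow> (nat \<Rightarrow> 'v) \<Rightarrow> 'v multiset" where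
  "word e w = image_mset w (mset_set {..<e})"

lemma size_word [simp]: "size (word e w) = e"
  by (simp add: word_def)

lemma prod_mon: "(\<Prod>t<e. mon {#w t#} (c t)) = mon (word e w) (\<Prod>t<e. c t)"
  for c :: "nat \<Rightarrow> 'a::comm_ring_1"
  by (induction e) (auto simp: word_def lessThan_Suc mult_single)

lemma word_eq_mset: "word e w = mset (map w [0..<e])"
  by (simp add: word_def mset_map mset_upt atLeast0LessThan)

lemma ex_word: "size A = e \<Longrightarrow> \<exists>w. A = word e w"
proof -
  assume "size A = e"
  moreover obtain xs where xs: "mset xs = A" using ex_mset by blast
  ultimately have "map (\<lambda>t. xs ! t) [0..<e] = xs" by (intro nth_equalityI) auto
  then show ?thesis using xs word_eq_mset[of e "\<lambda>t. xs ! t"] by (intro exI[of _ "\<lambda>t. xs ! t"]) simp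
qed

lemma word_permute:
  assumes "\<tau> permutes {..<e}"
  shows "word e (\<lambda>t. w (\<tau> t)) = word e w"
proof -
  have "word e (\<lambda>t. w (\<tau> t)) = image_mset w (image_mset \<tau> (mset_set {..<e}))"
    by (simp add: word_def image_mset.compositionality comp_def)
  also have "image_mset \<tau> (mset_set {..<e}) = mset_set {..<e}"
    using assms by (simp add: image_mset_mset_set permutes_inj_on permutes_image)
  finally show ?thesis by (simp add: word_def)
qed

lemma word_cong: "(\<And>t. t < e \<Longrightarrow> w t = w' t) \<Longrightarrow> word e w = word e w'"
  unfolding word_def by (intro image_mset_cong) auto

text \<open>All permutations are classified by the rearrangement of \<open>w\<close> that they
  produce. The classes have equal size, and there are \<open>fact e\<close> divided by
  \<open>mfact\<close> many of them.\<close>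

lemma card_word_permutations:
  "card {\<tau>. \<tau> permutes {..<e} \<and> (\<forall>t<e. w' t = w (\<tau> t))} = (if word e w = word e w' then mfact (word e w) else 0)"
proof -
  define S where "S w' = {\<tau>. \<tau> permutes {..<e} \<and> (\<forall>t<e. w' t = w (\<tau> t))}" for w'
  have finP: "finite {\<tau>. \<tau> permutes {..<e}}" by (rule finite_permutations) simp
  have finS: "finite (S w')" for w' unfolding S_def by (rule finite_subset[OF _ finP]) auto
  show ?thesis
  proof (cases "word e w = word e w'")
    case False
    have "S w' = {}"
    proof (rule ccontr)
      assume "S w' \<noteq> {}"
      then obtain \<tau> where "\<tau> permutes {..<e}" "\<forall>t<e. w' t = w (\<tau> t)" by (auto simp: S_def)
      then have "word e w' = word e w" using word_cong[of e w' "\<lambda>t. w (\<tau> t)"] word_permute by metis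
      with False show False by simp
    qed
    then have "card (S w') = 0" by simp
    then show ?thesis using False unfolding S_def by simp
  next
    case True
    have ex: "\<exists>\<tau>. \<tau> \<in> S v" if "word e v = word e w" for v
    proof -
      have "mset (map v [0..<e]) = mset (map w [0..<e])" using that by (simp only: word_eq_mset)
      then obtain p where p: "p permutes {..<length (map w [0..<e])}" "permute_list p (map w [0..<e]) = map v [0..<e]"
        by (rule mset_eq_permutation)
      have "v t = w (p t)" if t: "t < e" for t
      proof -
        have "p t < e" using p(1) t permutes_in_image[of p "{..<e}" t] by simp
        then show ?thesis using arg_cong[OF p(2), of "\<lambda>xs. xs ! t"] p(1) t by (simp add: permute_list_nth)
      qed
      with p(1) show ?thesis by (auto simp: S_def)
    qed
    have same: "card (S v) = card (S w)" if v: "word e v = word e w" for v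
    proof -
      obtain \<tau>0 where \<tau>0: "\<tau>0 permutes {..<e}" "\<And>t. t < e \<Longrightarrow> v t = w (\<tau>0 t)" using ex[OF v] by (auto simp: S_def)
      have "bij_betw (\<lambda>\<sigma>. \<sigma> \<circ> \<tau>0) (S w) (S v)"
      proof (rule bij_betwI[where g = "\<lambda>\<tau>. \<tau> \<circ> inv_into UNIV \<tau>0"])
        show "(\<lambda>\<sigma>. \<sigma> \<circ> \<tau>0) \<in> S w \<rightarrow> S v"
          using \<tau>0 permutes_in_image[OF \<tau>0(1)] by (auto simp: S_def permutes_compose)
        have iv: "inv_into UNIV \<tau>0 permutes {..<e}" by (rule permutes_inv[OF \<tau>0(1)])
        show "(\<lambda>\<tau>. \<tau> \<circ> inv_into UNIV \<tau>0) \<in> S v \<rightarrow> S w"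
        proof
          fix \<tau> assume \<tau>: "\<tau> \<in> S v"
          have "w t = w ((\<tau> \<circ> inv_into UNIV \<tau>0) t)" if "t < e" for t
          proof -
            have "inv_into UNIV \<tau>0 t < e" using permutes_in_image[OF iv, of t] that by simp
            then have "v (inv_into UNIV \<tau>0 t) = w (\<tau> (inv_into UNIV \<tau>0 t))" "v (inv_into UNIV \<tau>0 t) = w (\<tau>0 (inv_into UNIV \<tau>0 t))"
              using \<tau> \<tau>0(2) by (auto simp: S_def)
            then show ?thesis using permutes_inverses(1)[OF \<tau>0(1)] by simp
          qed
          then show "\<tau> \<circ> inv_into UNIV \<tau>0 \<in> S w" using \<tau> iv by (auto simp: S_def permutes_compose)
        qed
      qed (use permutes_inverses[OF \<tau>0(1)] in \<open>auto simp: fun_eq_iff\<close>)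
      then show ?thesis by (rule bij_betw_same_card[symmetric])
    qed
    let ?L = "permutations_of_multiset (word e w)"
    have len: "length xs = e" if "xs \<in> ?L" for xs
      using that by (metis permutations_of_multisetD size_mset size_word)
    have part: "{\<tau>. \<tau> permutes {..<e}} = (\<Union>xs\<in>?L. S (\<lambda>t. xs ! t))"
    proof (intro Set.set_eqI iffI)
      fix \<tau> assume "\<tau> \<in> {\<tau>. \<tau> permutes {..<e}}"
      then have \<tau>: "\<tau> permutes {..<e}" by simp
      have "map (\<lambda>t. w (\<tau> t)) [0..<e] \<in> ?L"
        by (rule permutations_of_multisetI) (simp only: word_permute[OF \<tau>] word_eq_mset[symmetric])
      moreover have "\<tau> \<in> S (\<lambda>t. map (\<lambda>t. w (\<tau> t)) [0..<e] ! t)" using \<tau> by (simp add: S_def)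
      ultimately show "\<tau> \<in> (\<Union>xs\<in>?L. S (\<lambda>t. xs ! t))" by blast
    qed (auto simp: S_def)
    have disj: "S (\<lambda>t. xs ! t) \<inter> S (\<lambda>t. ys ! t) = {}" if "xs \<in> ?L" "ys \<in> ?L" "xs \<noteq> ys" for xs ys
    proof (rule ccontr)
      assume "\<not> ?thesis"
      then have "\<forall>t<e. xs ! t = ys ! t" by (auto simp: S_def)
      then have "xs = ys" using len that by (intro nth_equalityI) auto
      with that show False by simp
    qed
    have wordL: "word e (\<lambda>t. xs ! t) = word e w" if "xs \<in> ?L" for xs
    proof -
      have "map (\<lambda>t. xs ! t) [0..<e] = xs" using len[OF that] by (intro nth_equalityI) auto
      then show ?thesis using permutations_of_multisetD[OF that] by (simp add: word_eq_mset)
    qed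
    have "fact e = card {\<tau>. \<tau> permutes {..<e}}" by (simp add: card_permutations)
    also have "\<dots> = (\<Sum>xs\<in>?L. card (S (\<lambda>t. xs ! t)))"
      unfolding part by (rule card_UN_disjoint) (use finS disj in auto)
    also have "\<dots> = card ?L * card (S w)" using same[OF wordL] by simp
    finally have "fact e = card ?L * card (S w)" .
    moreover have "card ?L * mfact (word e w) = fact e"
      using card_permutations_of_multiset_aux[of "word e w"] by (simp add: mfact_def)
    ultimately have "card ?L * card (S w) = card ?L * mfact (word e w)" by simp
    moreover have "card ?L \<noteq> 0" using \<open>card ?L * mfact (word e w) = fact e\<close> by (metis fact_nonzero mult_0)
    ultimately have "card (S w) = mfact (word e w)" by simp
    then show ?thesis using same[of w'] True by (simp add: S_def)
  qed
qed

text \<open>The weight \<open>mfact\<close> in the pairing counts the permutations matching two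
  words; so pairing with a monomial becomes an unweighted sum over permutations.\<close>

lemma pair_words:
  fixes c :: "'q \<Rightarrow> 'a::comm_ring_1"
  shows "pair (\<Sum>q\<in>Q. mon (word e (w q)) (c q)) (mon (word e w') 1) =
    (\<Sum>q\<in>Q. \<Sum>\<tau> | \<tau> permutes {..<e}. if \<forall>t<e. w' t = w q (\<tau> t) then c q else 0)"
  unfolding pair_sum_left
proof (rule sum.cong[OF refl])
  fix q
  have fin: "finite {\<tau>. \<tau> permutes {..<e}}" by (rule finite_permutations) simp
  have "(\<Sum>\<tau> | \<tau> permutes {..<e}. if \<forall>t<e. w' t = w q (\<tau> t) then c q else 0) =
      of_nat (card {\<tau>. \<tau> permutes {..<e} \<and> (\<forall>t<e. w' t = w q (\<tau> t))}) * c q"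
    by (simp add: sum.If_cases[OF fin] Int_def)
  also have "\<dots> = pair (mon (word e (w q)) (c q)) (mon (word e w') 1)"
    by (simp add: card_word_permutations pair_single_left lookup_single when_def)
  finally show "pair (mon (word e (w q)) (c q)) (mon (word e w') 1) =
    (\<Sum>\<tau> | \<tau> permutes {..<e}. if \<forall>t<e. w' t = w q (\<tau> t) then c q else 0)" by simp
qed

lemma det_blockdiag:
  fixes a :: "nat \<Rightarrow> nat \<Rightarrow> 'a::idom"
  assumes n: "n > 0"
  shows "det (mat (N * n) (N * n) (\<lambda>(p, q). if p div n = q div n then a (p mod n) (q mod n) else 0)) =
    det (mat n n (\<lambda>(p, q). a p q)) ^ N"
proof (induction N)
  case (Suc N)
  let ?D = "\<lambda>N. mat (N * n) (N * n) (\<lambda>(p, q). if p div n = q div n then a (p mod n) (q mod n) else 0)"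
  let ?A = "mat n n (\<lambda>(p, q). a p q)"
  have "?D (Suc N) = four_block_mat ?A (0\<^sub>m n (N * n)) (0\<^sub>m (N * n) n) (?D N)"
  proof (rule eq_matI)
    fix p q assume pq: "p < dim_row (four_block_mat ?A (0\<^sub>m n (N * n)) (0\<^sub>m (N * n) n) (?D N))"
      "q < dim_col (four_block_mat ?A (0\<^sub>m n (N * n)) (0\<^sub>m (N * n) n) (?D N))"
    have dm: "p div n = Suc ((p - n) div n)" "p mod n = (p - n) mod n" if "\<not> p < n" for p
      using that n by (simp_all add: le_div_geq le_mod_geq)
    show "?D (Suc N) $$ (p, q) = four_block_mat ?A (0\<^sub>m n (N * n)) (0\<^sub>m (N * n) n) (?D N) $$ (p, q)"
      using pq by (cases "p < n"; cases "q < n") (auto simp: dm)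
  qed auto
  then have "det (?D (Suc N)) = det ?A * det (?D N)"
    using det_four_block_mat_lower_left_zero[of ?A n "0\<^sub>m n (N * n)" "N * n" "0\<^sub>m (N * n) n" "?D N"] by simp
  with Suc show ?case by simp
qed (simp add: det_dim_zero)

definition detpow :: "nat \<Rightarrow> nat \<Rightarrow> ((nat \<times> nat), 'a::idom) mpoly" where
  "detpow n N = det (mat n n (\<lambda>(p, q). Var (p, q))) ^ N"

lemma signof_Con: "(signof p :: ('v, 'a::comm_ring_1) mpoly) = Con (signof p)"
  by (auto simp: sign_def single_uminus)

lemma finite_perms: "finite {p. p permutes {..<e::nat} \<and> P p}"
  by (rule finite_subset[OF _ finite_permutations[of "{..<e}"]]) auto

text \<open>The power is the determinant of \<open>N\<close> equal diagonal blocks, and only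
  permutations preserving the blocks contribute to its Leibniz expansion.\<close>

lemma detpow_expand:
  assumes n: "n > 0"
  shows "detpow n N = (\<Sum>\<sigma> | \<sigma> permutes {..<N * n} \<and> (\<forall>r<N * n. \<sigma> r div n = r div n).
    mon (word (N * n) (\<lambda>r. (r mod n, \<sigma> r mod n))) (signof \<sigma> :: 'a::idom))"
proof -
  let ?D = "mat (N * n) (N * n) (\<lambda>(p, q). if p div n = q div n then Var (p mod n, q mod n) else (0 :: ((nat \<times> nat), 'a) mpoly))"
  let ?Q = "\<lambda>\<sigma>. \<forall>r<N * n. \<sigma> r div n = r div n"
  have "detpow n N = det ?D"
    using det_blockdiag[OF n, of N "\<lambda>p q. Var (p, q) :: ((nat \<times> nat), 'a) mpoly"] by (simp add: detpow_def)
  also have "\<dots> = (\<Sum>\<sigma> | \<sigma> permutes {..<N * n}. signof \<sigma> * (\<Prod>r<N * n. ?D $$ (r, \<sigma> r)))"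
    by (subst det_def'[of _ "N * n"]) (auto simp: atLeast0LessThan)
  also have "\<dots> = (\<Sum>\<sigma> | \<sigma> permutes {..<N * n}. if ?Q \<sigma> then mon (word (N * n) (\<lambda>r. (r mod n, \<sigma> r mod n))) (signof \<sigma>) else 0)"
  proof (rule sum.cong[OF refl])
    fix \<sigma> assume "\<sigma> \<in> {\<sigma>. \<sigma> permutes {..<N * n}}"
    then have \<sigma>: "\<sigma> permutes {..<N * n}" by simp
    have lt: "\<sigma> r < N * n" if "r < N * n" for r using permutes_in_image[OF \<sigma>, of r] that by simp
    show "signof \<sigma> * (\<Prod>r<N * n. ?D $$ (r, \<sigma> r)) =
      (if ?Q \<sigma> then mon (word (N * n) (\<lambda>r. (r mod n, \<sigma> r mod n))) (signof \<sigma>) else 0)"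
    proof (cases "?Q \<sigma>")
      case True
      have "(\<Prod>r<N * n. ?D $$ (r, \<sigma> r)) = (\<Prod>r<N * n. mon {#(r mod n, \<sigma> r mod n)#} 1)"
        by (rule prod.cong) (use True lt in auto)
      then show ?thesis using True by (simp add: prod_mon signof_Con mult_single)
    next
      case False
      then obtain r where "r < N * n" "\<sigma> r div n \<noteq> r div n" by blast
      then have "(\<Prod>r<N * n. ?D $$ (r, \<sigma> r)) = 0"
        using lt by (intro prod_zero) (auto intro!: bexI[of _ r])
      then show ?thesis unfolding if_not_P[OF False] by (simp only: mult_zero_right)
    qed
  qed
  also have "\<dots> = (\<Sum>\<sigma> | \<sigma> permutes {..<N * n} \<and> ?Q \<sigma>. mon (word (N * n) (\<lambda>r. (r mod n, \<sigma> r mod n))) (signof \<sigma>))"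
    by (subst sum.inter_filter[symmetric]) (auto simp: finite_permutations)
  finally show ?thesis .
qed

lemma sum_compose_perm:
  fixes F :: "(nat \<Rightarrow> nat) \<Rightarrow> 'a::comm_ring_1"
  assumes \<tau>: "\<tau> permutes {..<e}"
  shows "(\<Sum>\<sigma> | \<sigma> permutes {..<e} \<and> P (\<sigma> \<circ> \<tau>). signof \<sigma> * F (\<sigma> \<circ> \<tau>)) =
    (\<Sum>\<tau>' | \<tau>' permutes {..<e} \<and> P \<tau>'. signof \<tau> * signof \<tau>' * F \<tau>')"
proof (rule sum.reindex_bij_witness[where j = "\<lambda>\<sigma>. \<sigma> \<circ> \<tau>" and i = "\<lambda>\<tau>'. \<tau>' \<circ> inv_into UNIV \<tau>"])
  have iv: "inv_into UNIV \<tau> permutes {..<e}" by (rule permutes_inv[OF \<tau>])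
  fix \<sigma> assume \<sigma>: "\<sigma> \<in> {\<sigma>. \<sigma> permutes {..<e} \<and> P (\<sigma> \<circ> \<tau>)}"
  show "\<sigma> \<circ> \<tau> \<circ> inv_into UNIV \<tau> = \<sigma>" using permutes_inverses[OF \<tau>] by (auto simp: fun_eq_iff)
  show "\<sigma> \<circ> \<tau> \<in> {\<tau>'. \<tau>' permutes {..<e} \<and> P \<tau>'}" using \<sigma> \<tau> by (auto intro: permutes_compose)
  have "sign (\<sigma> \<circ> \<tau>) = sign \<sigma> * sign \<tau>"
    by (rule sign_compose) (use \<sigma> \<tau> in \<open>auto intro: permutes_imp_permutation[of "{..<e}"]\<close>)
  then have "sign \<tau> * sign (\<sigma> \<circ> \<tau>) = sign \<sigma>" by (simp add: mult.left_commute[of "sign \<tau>"])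
  then have "(signof \<tau> * signof (\<sigma> \<circ> \<tau>) :: 'a) = signof \<sigma>" by (metis of_int_mult)
  then show "signof \<tau> * signof (\<sigma> \<circ> \<tau>) * F (\<sigma> \<circ> \<tau>) = signof \<sigma> * F (\<sigma> \<circ> \<tau>)" by simp
next
  have iv: "inv_into UNIV \<tau> permutes {..<e}" by (rule permutes_inv[OF \<tau>])
  fix \<tau>' assume \<tau>': "\<tau>' \<in> {\<tau>'. \<tau>' permutes {..<e} \<and> P \<tau>'}"
  show eq: "\<tau>' \<circ> inv_into UNIV \<tau> \<circ> \<tau> = \<tau>'" using permutes_inverses[OF \<tau>] by (auto simp: fun_eq_iff)
  show "\<tau>' \<circ> inv_into UNIV \<tau> \<in> {\<sigma>. \<sigma> permutes {..<e} \<and> P (\<sigma> \<circ> \<tau>)}"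
    using \<tau>' iv eq by (auto intro: permutes_compose)
qed

text \<open>In the matrix with \<open>N\<close> diagonal blocks, \<open>\<tau>\<close> sends the
  factors to distinct rows with row index \<open>i t\<close> inside the block, and
  \<open>\<tau>'\<close> sends them to columns of the same blocks. The column index inside the block
  selects the coefficient of the linear form \<open>y t\<close>.\<close>

definition omega :: "nat \<Rightarrow> nat \<Rightarrow> (nat \<Rightarrow> nat) \<Rightarrow> (nat \<Rightarrow> nat \<Rightarrow> 'a) \<Rightarrow> 'a::comm_ring_1" where
  "omega n N i y = (\<Sum>\<tau> | \<tau> permutes {..<N * n} \<and> (\<forall>t<N * n. i t = \<tau> t mod n).
     \<Sum>\<tau>' | \<tau>' permutes {..<N * n} \<and> (\<forall>t<N * n. \<tau>' t div n = \<tau> t div n).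
       signof \<tau> * signof \<tau>' * (\<Prod>t<N * n. y t (\<tau>' t mod n)))"

text \<open>Cayley's omega process.\<close>

lemma pair_detpow:
  fixes y :: "nat \<Rightarrow> nat \<Rightarrow> 'a::idom"
  assumes n: "n > 0"
  shows "pair (detpow n N) (\<Prod>t<N * n. \<Sum>l<n. mon {#(i t, l)#} (y t l)) = omega n N i y"
proof -
  define e where "e = N * n"
  let ?G = "{..<e} \<rightarrow>\<^sub>E {..<n}"
  let ?P = "{\<tau>. \<tau> permutes {..<e}}"
  let ?Q = "{\<sigma>. \<sigma> permutes {..<e} \<and> (\<forall>r<e. \<sigma> r div n = r div n)}"
  have finG: "finite ?G" by (intro finite_PiE) auto
  have finP: "finite ?P" by (rule finite_permutations) simp
  have finQ: "finite ?Q" by (rule finite_perms)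
  have if_mult: "x * (if c then s else 0) = (if c then s * x else 0)" for x s :: 'a and c
    by (simp add: mult.commute)
  have sum_if: "(\<Sum>\<sigma>\<in>Q. if c then F \<sigma> else 0) = (if c then \<Sum>\<sigma>\<in>Q. F \<sigma> else 0)"
    for c and Q :: "(nat \<Rightarrow> nat) set" and F :: "_ \<Rightarrow> 'a"
    by simp
  have word: "pair (detpow n N) (mon (word e w) 1) = (\<Sum>\<sigma>\<in>?Q. \<Sum>\<tau>\<in>?P. if \<forall>t<e. w t = (\<tau> t mod n, \<sigma> (\<tau> t) mod n) then signof \<sigma> else (0::'a))" for w
    unfolding detpow_expand[OF n] e_def[symmetric] by (rule pair_words)
  have "(\<Prod>t<e. \<Sum>l<n. mon {#(i t, l)#} (y t l)) = (\<Sum>g\<in>?G. \<Prod>t<e. mon {#(i t, g t)#} (y t (g t)))"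
    by (rule prod_sum_PiE) auto
  also have "\<dots> = (\<Sum>g\<in>?G. Con (\<Prod>t<e. y t (g t)) * mon (word e (\<lambda>t. (i t, g t))) 1)"
    by (simp add: prod_mon mult_single)
  finally have "pair (detpow n N) (\<Prod>t<e. \<Sum>l<n. mon {#(i t, l)#} (y t l)) =
      (\<Sum>g\<in>?G. (\<Prod>t<e. y t (g t)) * pair (detpow n N) (mon (word e (\<lambda>t. (i t, g t))) 1))"
    by (simp only: pair_commute[of "detpow n N"] pair_sum_left pair_Con_left)
  also have "\<dots> = (\<Sum>g\<in>?G. \<Sum>\<sigma>\<in>?Q. \<Sum>\<tau>\<in>?P. (\<Prod>t<e. y t (g t)) *
      (if \<forall>t<e. (i t, g t) = (\<tau> t mod n, \<sigma> (\<tau> t) mod n) then signof \<sigma> else 0))"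
    by (simp only: word sum_distrib_left)
  also have "\<dots> = (\<Sum>\<sigma>\<in>?Q. \<Sum>g\<in>?G. \<Sum>\<tau>\<in>?P. (\<Prod>t<e. y t (g t)) *
      (if \<forall>t<e. (i t, g t) = (\<tau> t mod n, \<sigma> (\<tau> t) mod n) then signof \<sigma> else 0))"
    by (rule sum.swap)
  also have "\<dots> = (\<Sum>\<sigma>\<in>?Q. \<Sum>\<tau>\<in>?P. \<Sum>g\<in>?G. (\<Prod>t<e. y t (g t)) *
      (if \<forall>t<e. (i t, g t) = (\<tau> t mod n, \<sigma> (\<tau> t) mod n) then signof \<sigma> else 0))"
    by (intro sum.cong refl sum.swap)
  also have "\<dots> = (\<Sum>\<sigma>\<in>?Q. \<Sum>\<tau>\<in>?P. if \<forall>t<e. i t = \<tau> t mod n then signof \<sigma> * (\<Prod>t<e. y t (\<sigma> (\<tau> t) mod n)) else 0)"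
  proof (intro sum.cong refl)
    fix \<sigma> \<tau> :: "nat \<Rightarrow> nat"
    \<comment> \<open>For given \<open>\<sigma>\<close> and \<open>\<tau>\<close>, a single choice
      of summands \<open>g\<close> in the product of linear forms can match.\<close>
    define g0 where "g0 = restrict (\<lambda>t. \<sigma> (\<tau> t) mod n) {..<e}"
    have g0: "g0 \<in> ?G" using n by (auto simp: g0_def)
    have "(\<Sum>g\<in>?G. (\<Prod>t<e. y t (g t)) * (if \<forall>t<e. (i t, g t) = (\<tau> t mod n, \<sigma> (\<tau> t) mod n) then signof \<sigma> else 0)) =
      (\<Sum>g\<in>?G. if g = g0 then (\<Prod>t<e. y t (g0 t)) * (if \<forall>t<e. i t = \<tau> t mod n then signof \<sigma> else 0) else 0)"
    proof (intro sum.cong refl)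
      fix g assume g: "g \<in> ?G"
      have "g = g0 \<longleftrightarrow> (\<forall>t<e. g t = \<sigma> (\<tau> t) mod n)"
      proof
        assume "\<forall>t<e. g t = \<sigma> (\<tau> t) mod n"
        then show "g = g0" by (intro PiE_ext[OF g g0]) (simp add: g0_def)
      qed (simp add: g0_def)
      then show "(\<Prod>t<e. y t (g t)) * (if \<forall>t<e. (i t, g t) = (\<tau> t mod n, \<sigma> (\<tau> t) mod n) then signof \<sigma> else 0) =
        (if g = g0 then (\<Prod>t<e. y t (g0 t)) * (if \<forall>t<e. i t = \<tau> t mod n then signof \<sigma> else 0) else 0)"
        by auto
    qed
    also have "\<dots> = (\<Prod>t<e. y t (g0 t)) * (if \<forall>t<e. i t = \<tau> t mod n then signof \<sigma> else 0)"
      using finG g0 by simp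
    also have "(\<Prod>t<e. y t (g0 t)) = (\<Prod>t<e. y t (\<sigma> (\<tau> t) mod n))"
      by (rule prod.cong) (auto simp: g0_def)
    finally show "(\<Sum>g\<in>?G. (\<Prod>t<e. y t (g t)) * (if \<forall>t<e. (i t, g t) = (\<tau> t mod n, \<sigma> (\<tau> t) mod n) then signof \<sigma> else 0)) =
      (if \<forall>t<e. i t = \<tau> t mod n then signof \<sigma> * (\<Prod>t<e. y t (\<sigma> (\<tau> t) mod n)) else 0)"
      unfolding if_mult .
  qed
  also have "\<dots> = (\<Sum>\<tau>\<in>?P. \<Sum>\<sigma>\<in>?Q. if \<forall>t<e. i t = \<tau> t mod n then signof \<sigma> * (\<Prod>t<e. y t (\<sigma> (\<tau> t) mod n)) else 0)"
    by (rule sum.swap)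
  also have "\<dots> = (\<Sum>\<tau>\<in>?P. if \<forall>t<e. i t = \<tau> t mod n then \<Sum>\<sigma>\<in>?Q. signof \<sigma> * (\<Prod>t<e. y t (\<sigma> (\<tau> t) mod n)) else 0)"
    unfolding sum_if ..
  also have "\<dots> = (\<Sum>\<tau> | \<tau> permutes {..<e} \<and> (\<forall>t<e. i t = \<tau> t mod n). \<Sum>\<sigma>\<in>?Q. signof \<sigma> * (\<Prod>t<e. y t (\<sigma> (\<tau> t) mod n)))"
    by (subst sum.inter_filter[symmetric, OF finP]) simp
  also have "\<dots> = omega n N i y"
    unfolding omega_def e_def[symmetric]
  proof (rule sum.cong[OF refl])
    fix \<tau> assume "\<tau> \<in> {\<tau>. \<tau> permutes {..<e} \<and> (\<forall>t<e. i t = \<tau> t mod n)}"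
    then have \<tau>: "\<tau> permutes {..<e}" by simp
    let ?P' = "\<lambda>\<tau>'. \<forall>t<e. \<tau>' t div n = \<tau> t div n"
    have Q: "?Q = {\<sigma>. \<sigma> permutes {..<e} \<and> ?P' (\<sigma> \<circ> \<tau>)}"
    proof -
      have "(\<forall>r<e. \<sigma> r div n = r div n) \<longleftrightarrow> ?P' (\<sigma> \<circ> \<tau>)" for \<sigma>
      proof
        assume *: "?P' (\<sigma> \<circ> \<tau>)"
        show "\<forall>r<e. \<sigma> r div n = r div n"
        proof (intro allI impI)
          fix r assume "r < e"
          then obtain t where "t < e" "r = \<tau> t" using permutes_image[OF \<tau>] by (metis imageE lessThan_iff)
          then show "\<sigma> r div n = r div n" using * by simp
        qed
      qed (use permutes_in_image[OF \<tau>] in auto)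
      then show ?thesis by simp
    qed
    show "(\<Sum>\<sigma>\<in>?Q. signof \<sigma> * (\<Prod>t<e. y t (\<sigma> (\<tau> t) mod n))) =
      (\<Sum>\<tau>' | \<tau>' permutes {..<e} \<and> ?P' \<tau>'. signof \<tau> * signof \<tau>' * (\<Prod>t<e. y t (\<tau>' t mod n)))"
      unfolding Q using sum_compose_perm[OF \<tau>, where P = ?P' and F = "\<lambda>\<tau>'. \<Prod>t<e. y t (\<tau>' t mod n)"] by (simp only: comp_def)
  qed
  finally show ?thesis by (simp add: e_def)
qed

text \<open>The coefficients are rational, so positivity of the rational pairing applies although
  the value is needed as a complex number.\<close>

lemma pair_detpow_nonzero: "pair (detpow n N) (detpow n N) \<noteq> (0 :: complex)"
proof -
  interpret m: comm_ring_hom "mapc of_rat :: ((nat \<times> nat), rat) mpoly \<Rightarrow> ((nat \<times> nat), complex) mpoly"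
    by (rule mapc_hom) (rule of_rat_hom.comm_ring_hom_axioms)
  let ?V = "mat n n (\<lambda>(p, q). Var (p, q)) :: ((nat \<times> nat), rat) mpoly mat"
  have mV: "mapc of_rat (Var v :: ((nat \<times> nat), rat) mpoly) = (Var v :: ((nat \<times> nat), complex) mpoly)" for v
    by (rule poly_mapping_eqI) (simp add: coef_mapc lookup_single when_def)
  have mV': "map_mat (mapc of_rat) ?V = mat n n (\<lambda>(p, q). Var (p, q) :: ((nat \<times> nat), complex) mpoly)"
    by (rule eq_matI) (auto simp: mV)
  have dp: "(detpow n N :: ((nat \<times> nat), complex) mpoly) = mapc of_rat (detpow n N :: ((nat \<times> nat), rat) mpoly)"
    unfolding detpow_def m.hom_power m.hom_det[symmetric] mV' ..
  have "keys (mapc of_rat p :: ((nat \<times> nat), complex) mpoly) = keys p" for p :: "((nat \<times> nat), rat) mpoly"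
    by (auto simp: in_keys_iff coef_mapc)
  then have pr: "pair (mapc of_rat p) (mapc of_rat p) = (of_rat (pair p p) :: complex)" for p :: "((nat \<times> nat), rat) mpoly"
    by (simp add: pair_def coef_mapc of_rat_sum of_rat_mult)
  have "(detpow n N :: ((nat \<times> nat), rat) mpoly) \<noteq> 0"
  proof
    assume "(detpow n N :: ((nat \<times> nat), rat) mpoly) = 0"
    then have d0: "det ?V = 0" by (simp add: detpow_def)
    let ?z = "\<lambda>(p, q). if p = q then 1 else 0 :: rat"
    interpret ev: comm_ring_hom "ev (\<lambda>c. c) ?z" by (rule ev_hom[OF hom_id])
    have "map_mat (ev (\<lambda>c. c) ?z) ?V = 1\<^sub>m n"
      by (rule eq_matI) (auto simp: ev_Var[OF hom_id])
    then have "ev (\<lambda>c. c) ?z (det ?V) = 1" by (metis det_one ev.hom_det)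
    then show False using d0 by simp
  qed
  then have "pair (detpow n N) (detpow n N :: ((nat \<times> nat), rat) mpoly) \<noteq> 0" using pair_pos by blast
  then show ?thesis by (simp add: dp pr)
qed

text \<open>The identity in \<open>A\<close> is an identity of polynomials by
  \<open>zero_test\<close>. Pairing both sides with \<open>detpow n N\<close> isolates the constant
  \<open>C\<close>.\<close>

lemma omega_identity:
  fixes e :: "'s \<Rightarrow> complex"
  assumes n: "n > 0" and "finite S"
    and id: "\<And>A :: nat \<times> nat \<Rightarrow> complex. (\<Sum>s\<in>S. e s * (\<Prod>t<N * n. \<Sum>l<n. A (i s t, l) * y s t l)) = det (mat n n A) ^ N * C"
  shows "C * pair (detpow n N) (detpow n N) = (\<Sum>s\<in>S. e s * omega n N (i s) (y s))"
proof -
  let ?L = "\<Sum>s\<in>S. Con (e s) * (\<Prod>t<N * n. \<Sum>l<n. mon {#(i s t, l)#} (y s t l))"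
  have "?L - Con C * detpow n N = 0"
  proof (rule zero_test)
    fix A :: "nat \<times> nat \<Rightarrow> complex"
    interpret ev: comm_ring_hom "ev (\<lambda>c. c) A" by (rule ev_hom[OF hom_id])
    have evd: "ev (\<lambda>c. c) A (det (mat n n (\<lambda>(p, q). Var (p, q)))) = det (mat n n A)"
    proof -
      have "map_mat (ev (\<lambda>c. c) A) (mat n n (\<lambda>(p, q). Var (p, q))) = mat n n A"
        by (rule eq_matI) (auto simp: ev_Var[OF hom_id])
      then show ?thesis by (metis ev.hom_det)
    qed
    have "ev (\<lambda>c. c) A ?L = (\<Sum>s\<in>S. e s * (\<Prod>t<N * n. \<Sum>l<n. A (i s t, l) * y s t l))"
      by (simp add: ev.hom_sum ev.hom_mult ev.hom_prod ev_single mult.commute)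
    moreover have "ev (\<lambda>c. c) A (Con C * detpow n N) = det (mat n n A) ^ N * C"
      by (simp add: detpow_def ev.hom_mult ev.hom_power ev_single evd mult.commute)
    ultimately show "ev (\<lambda>c. c) A (?L - Con C * detpow n N) = 0"
      using id[of A] by (simp add: ev.hom_minus)
  qed
  then have "?L = Con C * detpow n N" by simp
  then have "pair ?L (detpow n N) = pair (Con C * detpow n N) (detpow n N)" by simp
  then have "C * pair (detpow n N) (detpow n N) = (\<Sum>s\<in>S. e s * pair (\<Prod>t<N * n. \<Sum>l<n. mon {#(i s t, l)#} (y s t l)) (detpow n N))"
    by (simp only: pair_sum_left pair_Con_left)
  moreover have "pair (\<Prod>t<N * n. \<Sum>l<n. mon {#(i s t, l)#} (y s t l)) (detpow n N) = omega n N (i s) (y s)" for s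
    by (subst pair_commute) (rule pair_detpow[OF n])
  ultimately show ?thesis by simp
qed

text \<open>The sum is a coefficient of the blow-up determinant as a polynomial in the entries of \<open>T\<close>.\<close>

lemma blowup_coefficient:
  fixes z :: "nat \<times> nat \<times> nat \<Rightarrow> complex"
  assumes n: "n > 0" and sing: "\<And>T. det (bigmat m n N z T) = 0" and k: "\<And>t. t < N * n \<Longrightarrow> k t < m"
  shows "(\<Sum>\<tau> | \<tau> permutes {..<N * n} \<and> (\<forall>t<N * n. \<tau> t div n = \<beta> t).
    \<Sum>\<upsilon> | \<upsilon> permutes {..<N * n} \<and> (\<forall>t<N * n. \<upsilon> t div n = \<gamma> t).
      signof \<tau> * signof \<upsilon> * (\<Prod>t<N * n. z (k t, \<tau> t mod n, \<upsilon> t mod n))) = 0"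
proof -
  define e where "e = N * n"
  let ?P = "{\<tau>. \<tau> permutes {..<e}}"
  let ?K = "{..<e} \<rightarrow>\<^sub>E {..<m}"
  let ?M = "bigmat m n N (\<lambda>v. Con (z v)) Var :: ((nat \<times> nat \<times> nat), complex) mpoly mat"
  have finK: "finite ?K" by (intro finite_PiE) auto
  have finP: "finite ?P" by (rule finite_permutations) simp
  \<comment> \<open>An index consists of a permutation from the Leibniz formula and a choice
    \<open>\<kappa>\<close> of one summand in each row.\<close>
  define w where "w = (\<lambda>(\<sigma>, \<kappa>) r. (\<kappa> r :: nat, r div n, \<sigma> r div n))"
  define c where "c = (\<lambda>(\<sigma>, \<kappa>). signof \<sigma> * (\<Prod>r<e. z (\<kappa> r, r mod n, \<sigma> r mod n)))"
  have "det ?M = 0"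
  proof (rule zero_test)
    fix T :: "nat \<times> nat \<times> nat \<Rightarrow> complex"
    show "ev (\<lambda>c. c) T (det ?M) = 0"
      using sing[of T] by (simp add: hom_bigmat[OF ev_hom[OF hom_id]] ev_Var[OF hom_id] ev_Con[OF hom_id])
  qed
  moreover have "det ?M = (\<Sum>q\<in>?P \<times> ?K. mon (word e (w q)) (c q))"
  proof -
    have "det ?M = (\<Sum>\<sigma>\<in>?P. signof \<sigma> * (\<Prod>r<e. ?M $$ (r, \<sigma> r)))"
      unfolding e_def by (subst det_def'[OF bigmat_carrier]) (simp add: atLeast0LessThan)
    also have "\<dots> = (\<Sum>\<sigma>\<in>?P. \<Sum>\<kappa>\<in>?K. mon (word e (w (\<sigma>, \<kappa>))) (c (\<sigma>, \<kappa>)))"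
    proof (rule sum.cong[OF refl])
      fix \<sigma> assume "\<sigma> \<in> ?P"
      then have \<sigma>: "\<sigma> permutes {..<e}" by simp
      have "(\<Prod>r<e. ?M $$ (r, \<sigma> r)) = (\<Prod>r<e. \<Sum>\<kappa><m. mon {#(\<kappa>, r div n, \<sigma> r div n)#} (z (\<kappa>, r mod n, \<sigma> r mod n)))"
      proof (rule prod.cong[OF refl])
        fix r assume "r \<in> {..<e}"
        then have "r < e" "\<sigma> r < e" using permutes_in_image[OF \<sigma>, of r] by auto
        then show "?M $$ (r, \<sigma> r) = (\<Sum>\<kappa><m. mon {#(\<kappa>, r div n, \<sigma> r div n)#} (z (\<kappa>, r mod n, \<sigma> r mod n)))"
          by (simp add: bigmat_def e_def mult_single)
      qed
      also have "\<dots> = (\<Sum>\<kappa>\<in>?K. \<Prod>r<e. mon {#(\<kappa> r, r div n, \<sigma> r div n)#} (z (\<kappa> r, r mod n, \<sigma> r mod n)))"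
        by (rule prod_sum_PiE) auto
      also have "\<dots> = (\<Sum>\<kappa>\<in>?K. mon (word e (w (\<sigma>, \<kappa>))) (\<Prod>r<e. z (\<kappa> r, r mod n, \<sigma> r mod n)))"
        by (simp add: prod_mon w_def)
      finally show "signof \<sigma> * (\<Prod>r<e. ?M $$ (r, \<sigma> r)) = (\<Sum>\<kappa>\<in>?K. mon (word e (w (\<sigma>, \<kappa>))) (c (\<sigma>, \<kappa>)))"
        by (simp add: sum_distrib_left signof_Con mult_single c_def)
    qed
    also have "\<dots> = (\<Sum>q\<in>?P \<times> ?K. mon (word e (w q)) (c q))" by (rule sum.cartesian_product'[symmetric])
    finally show ?thesis .
  qed
  ultimately have "pair (\<Sum>q\<in>?P \<times> ?K. mon (word e (w q)) (c q)) (mon (word e (\<lambda>t. (k t, \<beta> t, \<gamma> t))) 1) = 0" by simp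
  then have "(\<Sum>q\<in>?P \<times> ?K. \<Sum>\<tau>\<in>?P. if \<forall>t<e. (k t, \<beta> t, \<gamma> t) = w q (\<tau> t) then c q else 0) = 0"
    unfolding pair_words .
  then have "0 = (\<Sum>\<sigma>\<in>?P. \<Sum>\<kappa>\<in>?K. \<Sum>\<tau>\<in>?P. if \<forall>t<e. (k t, \<beta> t, \<gamma> t) = w (\<sigma>, \<kappa>) (\<tau> t) then c (\<sigma>, \<kappa>) else 0)"
    by (simp only: sum.cartesian_product')
  also have "\<dots> = (\<Sum>\<sigma>\<in>?P. \<Sum>\<tau>\<in>?P. \<Sum>\<kappa>\<in>?K. if \<forall>t<e. (k t, \<beta> t, \<gamma> t) = w (\<sigma>, \<kappa>) (\<tau> t) then c (\<sigma>, \<kappa>) else 0)"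
    by (intro sum.cong refl sum.swap)
  also have "\<dots> = (\<Sum>\<tau>\<in>?P. \<Sum>\<sigma>\<in>?P. \<Sum>\<kappa>\<in>?K. if \<forall>t<e. (k t, \<beta> t, \<gamma> t) = w (\<sigma>, \<kappa>) (\<tau> t) then c (\<sigma>, \<kappa>) else 0)"
    by (rule sum.swap)
  also have "\<dots> = (\<Sum>\<tau>\<in>?P. if \<forall>t<e. \<tau> t div n = \<beta> t then
      \<Sum>\<upsilon> | \<upsilon> permutes {..<e} \<and> (\<forall>t<e. \<upsilon> t div n = \<gamma> t). signof \<tau> * signof \<upsilon> * (\<Prod>t<e. z (k t, \<tau> t mod n, \<upsilon> t mod n)) else 0)"
  proof (rule sum.cong[OF refl])
    fix \<tau> assume "\<tau> \<in> ?P"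
    then have \<tau>: "\<tau> permutes {..<e}" by simp
    define iv where "iv = inv_into UNIV \<tau>"
    have ivp: "iv permutes {..<e}" unfolding iv_def by (rule permutes_inv[OF \<tau>])
    have iv1: "iv (\<tau> t) = t" "\<tau> (iv t) = t" for t unfolding iv_def using permutes_inverses[OF \<tau>] by auto
    have ltt: "\<tau> t < e" "iv t < e" if "t < e" for t
      using permutes_in_image[OF \<tau>, of t] permutes_in_image[OF ivp, of t] that by auto
    \<comment> \<open>Matching the prescribed word along \<open>\<tau>\<close> leaves exactly one
      possible \<open>\<kappa>\<close>.\<close>
    define \<kappa>0 where "\<kappa>0 = restrict (\<lambda>r. k (iv r)) {..<e}"
    have \<kappa>0: "\<kappa>0 \<in> ?K" using k ltt by (auto simp: \<kappa>0_def e_def)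
    have inner: "(\<Sum>\<kappa>\<in>?K. if \<forall>t<e. (k t, \<beta> t, \<gamma> t) = w (\<sigma>, \<kappa>) (\<tau> t) then c (\<sigma>, \<kappa>) else 0) =
      (if (\<forall>t<e. \<tau> t div n = \<beta> t) \<and> (\<forall>t<e. (\<sigma> \<circ> \<tau>) t div n = \<gamma> t)
       then signof \<sigma> * (\<Prod>t<e. z (k t, \<tau> t mod n, (\<sigma> \<circ> \<tau>) t mod n)) else 0)" (is "?l = ?r") for \<sigma>
    proof -
      let ?c = "(\<forall>t<e. \<tau> t div n = \<beta> t) \<and> (\<forall>t<e. (\<sigma> \<circ> \<tau>) t div n = \<gamma> t)"
      have "?l = (\<Sum>\<kappa>\<in>?K. if \<kappa> = \<kappa>0 then (if ?c then c (\<sigma>, \<kappa>0) else 0) else 0)"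
      proof (intro sum.cong refl)
        fix \<kappa> assume \<kappa>: "\<kappa> \<in> ?K"
        have "\<kappa> = \<kappa>0 \<longleftrightarrow> (\<forall>t<e. k t = \<kappa> (\<tau> t))"
        proof
          assume "\<kappa> = \<kappa>0"
          then show "\<forall>t<e. k t = \<kappa> (\<tau> t)" using ltt by (simp add: \<kappa>0_def iv1)
        next
          assume *: "\<forall>t<e. k t = \<kappa> (\<tau> t)"
          show "\<kappa> = \<kappa>0"
          proof (rule PiE_ext[OF \<kappa> \<kappa>0])
            fix r assume "r \<in> {..<e}"
            then show "\<kappa> r = \<kappa>0 r" using *[rule_format, of "iv r"] ltt by (simp add: \<kappa>0_def iv1)
          qed
        qed
        then show "(if \<forall>t<e. (k t, \<beta> t, \<gamma> t) = w (\<sigma>, \<kappa>) (\<tau> t) then c (\<sigma>, \<kappa>) else 0) =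
          (if \<kappa> = \<kappa>0 then (if ?c then c (\<sigma>, \<kappa>0) else 0) else 0)"
          by (auto simp: w_def)
      qed
      also have "\<dots> = (if ?c then c (\<sigma>, \<kappa>0) else 0)" using finK \<kappa>0 by simp
      also have "c (\<sigma>, \<kappa>0) = signof \<sigma> * (\<Prod>t<e. z (k t, \<tau> t mod n, (\<sigma> \<circ> \<tau>) t mod n))"
      proof -
        have "(\<Prod>r<e. z (\<kappa>0 r, r mod n, \<sigma> r mod n)) = (\<Prod>t<e. z (\<kappa>0 (\<tau> t), \<tau> t mod n, \<sigma> (\<tau> t) mod n))"
          by (rule prod.permute[OF \<tau>, unfolded comp_def])
        also have "\<dots> = (\<Prod>t<e. z (k t, \<tau> t mod n, (\<sigma> \<circ> \<tau>) t mod n))"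
          by (rule prod.cong) (use ltt in \<open>auto simp: \<kappa>0_def iv1\<close>)
        finally show ?thesis by (simp add: c_def)
      qed
      finally show ?thesis .
    qed
    let ?P' = "\<lambda>\<upsilon>. \<forall>t<e. \<upsilon> t div n = \<gamma> t"
    show "(\<Sum>\<sigma>\<in>?P. \<Sum>\<kappa>\<in>?K. if \<forall>t<e. (k t, \<beta> t, \<gamma> t) = w (\<sigma>, \<kappa>) (\<tau> t) then c (\<sigma>, \<kappa>) else 0) =
      (if \<forall>t<e. \<tau> t div n = \<beta> t then
      \<Sum>\<upsilon> | \<upsilon> permutes {..<e} \<and> ?P' \<upsilon>. signof \<tau> * signof \<upsilon> * (\<Prod>t<e. z (k t, \<tau> t mod n, \<upsilon> t mod n)) else 0)"
    proof (cases "\<forall>t<e. \<tau> t div n = \<beta> t")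
      case True
      have "(\<Sum>\<sigma>\<in>?P. \<Sum>\<kappa>\<in>?K. if \<forall>t<e. (k t, \<beta> t, \<gamma> t) = w (\<sigma>, \<kappa>) (\<tau> t) then c (\<sigma>, \<kappa>) else 0) =
        (\<Sum>\<sigma>\<in>?P. if ?P' (\<sigma> \<circ> \<tau>) then signof \<sigma> * (\<Prod>t<e. z (k t, \<tau> t mod n, (\<sigma> \<circ> \<tau>) t mod n)) else 0)"
        unfolding inner using True by simp
      also have "\<dots> = (\<Sum>\<sigma> | \<sigma> permutes {..<e} \<and> ?P' (\<sigma> \<circ> \<tau>). signof \<sigma> * (\<Prod>t<e. z (k t, \<tau> t mod n, (\<sigma> \<circ> \<tau>) t mod n)))"
        by (subst sum.inter_filter[symmetric, OF finP]) simp
      also have "\<dots> = (\<Sum>\<upsilon> | \<upsilon> permutes {..<e} \<and> ?P' \<upsilon>. signof \<tau> * signof \<upsilon> * (\<Prod>t<e. z (k t, \<tau> t mod n, \<upsilon> t mod n)))"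
        by (rule sum_compose_perm[OF \<tau>, where P = ?P' and F = "\<lambda>\<upsilon>. \<Prod>t<e. z (k t, \<tau> t mod n, \<upsilon> t mod n)"])
      finally show ?thesis using True by simp
    next
      case False
      then show ?thesis unfolding inner by (simp only: simp_thms if_False sum.neutral_const)
    qed
  qed
  also have "\<dots> = (\<Sum>\<tau> | \<tau> permutes {..<e} \<and> (\<forall>t<e. \<tau> t div n = \<beta> t).
      \<Sum>\<upsilon> | \<upsilon> permutes {..<e} \<and> (\<forall>t<e. \<upsilon> t div n = \<gamma> t). signof \<tau> * signof \<upsilon> * (\<Prod>t<e. z (k t, \<tau> t mod n, \<upsilon> t mod n)))"
    by (subst sum.inter_filter[symmetric, OF finP]) simp
  finally show ?thesis by (simp add: e_def)
qed

text \<open>Applying the omega process to both groups writes a semi-invariant as a combination of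
  coefficients of blow-up determinants.\<close>

theorem semi_invariant_vanishes:
  fixes z :: "nat \<times> nat \<times> nat \<Rightarrow> complex"
  assumes n: "n > 0" and f: "f \<in> Form (coords n m) (N * n)"
    and left: "\<And>(A :: nat \<times> nat \<Rightarrow> complex) Y. ev of_rat (\<lambda>(k, i, j). \<Sum>l<n. A (i, l) * Y (k, l, j)) f = det (mat n n A) ^ N * ev of_rat Y f"
    and right: "\<And>(A :: nat \<times> nat \<Rightarrow> complex) Y. ev of_rat (\<lambda>(k, i, j). \<Sum>l<n. A (j, l) * Y (k, i, l)) f = det (mat n n A) ^ N * ev of_rat Y f"
    and sing: "\<And>T. det (bigmat m n N z T) = 0"
  shows "ev of_rat z f = (0 :: complex)"
proof -
  define e where "e = N * n"
  have "\<exists>w. W = word e w" if "W \<in> keys f" for W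
    using f that by (intro ex_word) (auto simp: Form_def Mon_def e_def)
  then obtain w where w: "\<And>W. W \<in> keys f \<Longrightarrow> W = word e (w W)" by metis
  define k where "k W t = fst (w W t)" for W t
  define i where "i W t = fst (snd (w W t))" for W t
  define j where "j W t = snd (snd (w W t))" for W t
  have kij: "w W t = (k W t, i W t, j W t)" for W t by (simp add: k_def i_def j_def)
  have km: "k W t < m" if "W \<in> keys f" "t < e" for W t
  proof -
    have "w W t \<in># W" using that by (subst w[OF that(1)]) (auto simp: word_def)
    then have "w W t \<in> coords n m" using f that(1) by (auto simp: Form_def Mon_def)
    then show ?thesis by (auto simp: coords_def k_def)
  qed
  have evf: "ev of_rat Y f = (\<Sum>W\<in>keys f. of_rat (coef f W) * (\<Prod>t<e. Y (k W t, i W t, j W t)))" for Y :: "nat \<times> nat \<times> nat \<Rightarrow> complex"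
    unfolding ev_def
  proof (rule sum.cong[OF refl])
    fix W assume "W \<in> keys f"
    then have "(\<Prod>v\<in>#W. Y v) = (\<Prod>v\<in>#word e (w W). Y v)" using w by metis
    also have "\<dots> = (\<Prod>t<e. Y (k W t, i W t, j W t))"
      by (simp add: word_def kij image_mset.compositionality comp_def flip: prod_unfold_prod_mset)
    finally show "of_rat (coef f W) * (\<Prod>v\<in>#W. Y v) = of_rat (coef f W) * (\<Prod>t<e. Y (k W t, i W t, j W t))" by simp
  qed
  define c0 :: complex where "c0 = pair (detpow n N) (detpow n N)"
  \<comment> \<open>The omega process for the left factor, used for arbitrary \<open>Y\<close> so
    that its result can be evaluated along the right action.\<close>
  have step1: "ev of_rat Y f * c0 = (\<Sum>W\<in>keys f. of_rat (coef f W) * omega n N (i W) (\<lambda>t l. Y (k W t, l, j W t)))"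
    for Y :: "nat \<times> nat \<times> nat \<Rightarrow> complex"
    unfolding c0_def
  proof (rule omega_identity[OF n finite_keys])
    fix A :: "nat \<times> nat \<Rightarrow> complex"
    show "(\<Sum>W\<in>keys f. of_rat (coef f W) * (\<Prod>t<N * n. \<Sum>l<n. A (i W t, l) * Y (k W t, l, j W t))) =
      det (mat n n A) ^ N * ev of_rat Y f"
      using left[of A Y] by (simp add: evf e_def)
  qed
  define I where "I W = {\<tau>. \<tau> permutes {..<e} \<and> (\<forall>t<e. i W t = \<tau> t mod n)}" for W
  define I' where "I' \<tau> = {\<tau>'. \<tau>' permutes {..<e} \<and> (\<forall>t<e. \<tau>' t div n = \<tau> t div n)}" for \<tau> :: "nat \<Rightarrow> nat"
  define J where "J W = {\<upsilon>. \<upsilon> permutes {..<e} \<and> (\<forall>t<e. j W t = \<upsilon> t mod n)}" for W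
  have fin: "finite (I W)" "finite (I' \<tau>)" "finite (J W)" for W \<tau>
    unfolding I_def I'_def J_def by (rule finite_perms)+
  \<comment> \<open>The terms left after the first omega process. The second treats their sum as
    products of linear forms in the matrix acting on the right.\<close>
  define S where "S = (SIGMA W:keys f. SIGMA \<tau>:I W. I' \<tau>)"
  have finS: "finite S" unfolding S_def using fin by auto
  have sumS: "(\<Sum>s\<in>S. F s) = (\<Sum>W\<in>keys f. \<Sum>\<tau>\<in>I W. \<Sum>\<tau>'\<in>I' \<tau>. F (W, \<tau>, \<tau>'))" for F :: "_ \<Rightarrow> complex"
  proof -
    have "(\<Sum>\<tau>\<in>I W. \<Sum>\<tau>'\<in>I' \<tau>. F (W, \<tau>, \<tau>')) = (\<Sum>p\<in>Sigma (I W) I'. F (W, p))" for W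
      using fin by (subst sum.Sigma) (auto simp: case_prod_unfold)
    moreover have "(\<Sum>W\<in>keys f. \<Sum>p\<in>Sigma (I W) I'. F (W, p)) = (\<Sum>s\<in>S. F s)"
      unfolding S_def using fin by (subst sum.Sigma) (auto simp: case_prod_unfold)
    ultimately show ?thesis by simp
  qed
  define ee :: "_ \<Rightarrow> complex" where "ee = (\<lambda>(W, \<tau>, \<tau>'). of_rat (coef f W) * (signof \<tau> * signof \<tau>'))"
  have "(ev of_rat z f * c0) * c0 = (\<Sum>s\<in>S. ee s * omega n N (\<lambda>t. j (fst s) t) (\<lambda>t l. z (k (fst s) t, snd (snd s) t mod n, l)))"
    unfolding c0_def
  proof (rule omega_identity[OF n finS])
    fix A :: "nat \<times> nat \<Rightarrow> complex"
    let ?Y = "\<lambda>(k, i, j). \<Sum>l<n. A (j, l) * z (k, i, l)"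
    have "det (mat n n A) ^ N * (ev of_rat z f * c0) = ev of_rat ?Y f * c0" using right[of A z] by simp
    also have "\<dots> = (\<Sum>W\<in>keys f. \<Sum>\<tau>\<in>I W. \<Sum>\<tau>'\<in>I' \<tau>. of_rat (coef f W) * (signof \<tau> * signof \<tau>' * (\<Prod>t<e. ?Y (k W t, \<tau>' t mod n, j W t))))"
      unfolding step1 omega_def I_def I'_def e_def by (simp add: sum_distrib_left)
    also have "\<dots> = (\<Sum>s\<in>S. ee s * (\<Prod>t<N * n. \<Sum>l<n. A (j (fst s) t, l) * z (k (fst s) t, snd (snd s) t mod n, l)))"
      unfolding sumS by (simp add: ee_def e_def mult.assoc)
    finally show "(\<Sum>s\<in>S. ee s * (\<Prod>t<N * n. \<Sum>l<n. A (j (fst s) t, l) * z (k (fst s) t, snd (snd s) t mod n, l))) =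
      det (mat n n A) ^ N * (ev of_rat z f * pair (detpow n N) (detpow n N))" by (simp add: c0_def)
  qed
  also have "\<dots> = (\<Sum>W\<in>keys f. \<Sum>\<tau>\<in>I W. \<Sum>\<tau>'\<in>I' \<tau>. \<Sum>\<upsilon>\<in>J W. \<Sum>\<upsilon>'\<in>I' \<upsilon>.
      of_rat (coef f W) * signof \<tau> * signof \<upsilon> * (signof \<tau>' * signof \<upsilon>' * (\<Prod>t<e. z (k W t, \<tau>' t mod n, \<upsilon>' t mod n))))"
    unfolding sumS omega_def J_def I'_def e_def by (simp add: ee_def sum_distrib_left mult_ac)
  also have "\<dots> = (\<Sum>W\<in>keys f. \<Sum>\<tau>\<in>I W. \<Sum>\<upsilon>\<in>J W. \<Sum>\<tau>'\<in>I' \<tau>. \<Sum>\<upsilon>'\<in>I' \<upsilon>.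
      of_rat (coef f W) * signof \<tau> * signof \<upsilon> * (signof \<tau>' * signof \<upsilon>' * (\<Prod>t<e. z (k W t, \<tau>' t mod n, \<upsilon>' t mod n))))"
    by (intro sum.cong refl sum.swap)
  also have "\<dots> = (\<Sum>W\<in>keys f. \<Sum>\<tau>\<in>I W. \<Sum>\<upsilon>\<in>J W. of_rat (coef f W) * signof \<tau> * signof \<upsilon> *
      (\<Sum>\<tau>'\<in>I' \<tau>. \<Sum>\<upsilon>'\<in>I' \<upsilon>. signof \<tau>' * signof \<upsilon>' * (\<Prod>t<e. z (k W t, \<tau>' t mod n, \<upsilon>' t mod n))))"
    by (simp only: sum_distrib_left)
  also have "\<dots> = 0"
  \<comment> \<open>For fixed \<open>\<tau>\<close> and \<open>\<upsilon>\<close> the inner double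
    sum depends on them only through the blocks \<open>\<tau> t div n\<close> and
    \<open>\<upsilon> t div n\<close>. These serve as \<open>\<beta>\<close> and
    \<open>\<gamma>\<close> in \<open>blowup_coefficient\<close>.\<close>
  proof (intro sum.neutral ballI)
    fix W \<tau> \<upsilon> assume W: "W \<in> keys f"
    have "(\<Sum>\<tau>'\<in>I' \<tau>. \<Sum>\<upsilon>'\<in>I' \<upsilon>. signof \<tau>' * signof \<upsilon>' * (\<Prod>t<e. z (k W t, \<tau>' t mod n, \<upsilon>' t mod n))) = 0"
      unfolding I'_def e_def
      by (rule blowup_coefficient[OF n sing]) (use km[OF W] in \<open>simp add: e_def\<close>)
    then show "of_rat (coef f W) * signof \<tau> * signof \<upsilon> *
      (\<Sum>\<tau>'\<in>I' \<tau>. \<Sum>\<upsilon>'\<in>I' \<upsilon>. signof \<tau>' * signof \<upsilon>' * (\<Prod>t<e. z (k W t, \<tau>' t mod n, \<upsilon>' t mod n))) = (0 :: complex)"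
      by (simp only: mult_zero_right)
  qed
  finally show ?thesis using pair_detpow_nonzero[of n N] by (simp add: c0_def)
qed

section \<open>The left-right action\<close>

text \<open>\<open>b\<close> selects one factor of the group: every matrix \<open>Z\<close> of the
  tuple goes to \<open>A\<close> times \<open>Z\<close>, or to \<open>Z\<close> times the transpose
  of \<open>A\<close>. No inverse is involved, so the formula makes sense for singular
  \<open>A\<close>.\<close>

definition act :: "nat \<Rightarrow> bool \<Rightarrow> (nat \<times> nat \<Rightarrow> 'a) \<Rightarrow> (nat \<times> nat \<times> nat \<Rightarrow> 'a) \<Rightarrow> nat \<times> nat \<times> nat \<Rightarrow> 'a::comm_ring_1" where
  "act n b A z = (\<lambda>(k, i, j). \<Sum>l<n. if b then A (i, l) * z (k, l, j) else A (j, l) * z (k, i, l))"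

lemma hom_act:
  assumes "comm_ring_hom h"
  shows "h (act n b A z v) = act n b (\<lambda>q. h (A q)) (\<lambda>q. h (z q)) v"
proof -
  interpret h: comm_ring_hom h by fact
  show ?thesis by (cases v; cases b) (simp_all add: act_def h.hom_sum h.hom_mult)
qed

lemma act_scale: "act n b (\<lambda>q. c * A q) z = (\<lambda>v. c * act n b A z v)"
  by (cases b) (auto simp: act_def sum_distrib_left mult.assoc)

text \<open>The action multiplies the blow-up by the block matrix \<open>B\<close> with
  \<open>N\<close> copies of \<open>A\<close> on its diagonal, from the left or transposed from the
  right.\<close>

lemma det_bigmat_act:
  fixes A :: "nat \<times> nat \<Rightarrow> 'a::idom"
  assumes n: "n > 0"
  shows "det (bigmat m n N (act n b A z) T) = det (mat n n A) ^ N * det (bigmat m n N z T)"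
proof -
  define B where "B = mat (N * n) (N * n) (\<lambda>(p, q). if p div n = q div n then A (p mod n, q mod n) else 0)"
  have B: "B \<in> carrier_mat (N * n) (N * n)" by (simp add: B_def)
  have "mat n n (\<lambda>(p, q). A (p, q)) = mat n n A" by (rule eq_matI) auto
  then have detB: "det B = det (mat n n A) ^ N" unfolding B_def using det_blockdiag[OF n, of N "\<lambda>p q. A (p, q)"] by simp
  have lt: "p div n < N" if "p < N * n" for p using that by (simp add: less_mult_imp_div_less)
  have delta: "(\<Sum>c<N. \<Sum>j<n. (if a = c then F j else 0) * G c j) = (\<Sum>j<n. F j * G a j)"
    if "a < N" for a and F :: "nat \<Rightarrow> 'a" and G
  proof -
    have "(\<Sum>c<N. \<Sum>j<n. (if a = c then F j else 0) * G c j) = (\<Sum>c<N. if a = c then \<Sum>j<n. F j * G c j else 0)"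
      by (rule sum.cong) auto
    then show ?thesis using that by simp
  qed
  show ?thesis
  proof (cases b)
    case True
    have "bigmat m n N (act n b A z) T = B * bigmat m n N z T"
    proof (rule eq_matI)
      fix p q assume "p < dim_row (B * bigmat m n N z T)" "q < dim_col (B * bigmat m n N z T)"
      then have pq: "p < N * n" "q < N * n" by (auto simp: B_def bigmat_def)
      have "(B * bigmat m n N z T) $$ (p, q) = (\<Sum>r<N * n. (if p div n = r div n then A (p mod n, r mod n) else 0) *
        (\<Sum>k<m. z (k, r mod n, q mod n) * T (k, r div n, q div n)))"
        using pq by (simp add: B_def bigmat_def scalar_prod_def atLeast0LessThan)
      also have "\<dots> = (\<Sum>c<N. \<Sum>j<n. (if p div n = c then A (p mod n, j) else 0) *
        (\<Sum>k<m. z (k, j, q mod n) * T (k, c, q div n)))"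
        by (rule sum_blocks[OF n])
      also have "\<dots> = (\<Sum>j<n. A (p mod n, j) * (\<Sum>k<m. z (k, j, q mod n) * T (k, p div n, q div n)))"
        by (rule delta) (rule lt[OF pq(1)])
      also have "\<dots> = bigmat m n N (act n b A z) T $$ (p, q)"
        using pq True by (simp add: bigmat_def act_def sum_distrib_left sum_distrib_right mult.assoc) (rule sum.swap)
      finally show "bigmat m n N (act n b A z) T $$ (p, q) = (B * bigmat m n N z T) $$ (p, q)" ..
    qed (auto simp: bigmat_def B_def)
    then show ?thesis using det_mult[OF B bigmat_carrier] by (simp add: detB)
  next
    case False
    have "bigmat m n N (act n b A z) T = bigmat m n N z T * transpose_mat B"
    proof (rule eq_matI)
      fix p q assume "p < dim_row (bigmat m n N z T * transpose_mat B)" "q < dim_col (bigmat m n N z T * transpose_mat B)"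
      then have pq: "p < N * n" "q < N * n" by (auto simp: B_def bigmat_def)
      have "(bigmat m n N z T * transpose_mat B) $$ (p, q) = (\<Sum>r<N * n. (if q div n = r div n then A (q mod n, r mod n) else 0) *
        (\<Sum>k<m. z (k, p mod n, r mod n) * T (k, p div n, r div n)))"
        using pq by (simp add: B_def bigmat_def scalar_prod_def atLeast0LessThan mult.commute)
      also have "\<dots> = (\<Sum>c<N. \<Sum>j<n. (if q div n = c then A (q mod n, j) else 0) *
        (\<Sum>k<m. z (k, p mod n, j) * T (k, p div n, c)))"
        by (rule sum_blocks[OF n])
      also have "\<dots> = (\<Sum>j<n. A (q mod n, j) * (\<Sum>k<m. z (k, p mod n, j) * T (k, p div n, q div n)))"
        by (rule delta) (rule lt[OF pq(2)])
      also have "\<dots> = bigmat m n N (act n b A z) T $$ (p, q)"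
        using pq False by (simp add: bigmat_def act_def sum_distrib_left sum_distrib_right mult.assoc) (rule sum.swap)
      finally show "bigmat m n N (act n b A z) T $$ (p, q) = (bigmat m n N z T * transpose_mat B) $$ (p, q)" ..
    qed (auto simp: bigmat_def B_def)
    then show ?thesis using det_mult[OF bigmat_carrier, of "transpose_mat B" N n m z T] B det_transpose[OF B] by (simp add: detB)
  qed
qed

text \<open>The matrix of \<open>act\<close> on the coordinate space. Its transpose is the
  \<open>amat\<close> of the transposed \<open>A\<close>, which provides the closure under
  transposes asked for by \<open>invariants\<close>.\<close>

definition amat :: "bool \<Rightarrow> (nat \<times> nat \<Rightarrow> rat) \<Rightarrow> nat \<times> nat \<times> nat \<Rightarrow> nat \<times> nat \<times> nat \<Rightarrow> rat" where
  "amat b A = (\<lambda>(k, i, j) (k', i', j'). if b then if k = k' \<and> j = j' then A (i, i') else 0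
     else if k = k' \<and> i = i' then A (j, j') else 0)"

definition sl_mats :: "nat \<Rightarrow> (nat \<times> nat \<times> nat \<Rightarrow> nat \<times> nat \<times> nat \<Rightarrow> rat) set" where
  "sl_mats n = {amat b A | b A. det (mat n n A) = 1}"

lemma finite_coords [simp]: "finite (coords n m)" by (simp add: coords_def)

lemma ev_linsub:
  assumes v: "v \<in> coords n m" and h: "comm_ring_hom h"
  shows "ev h z (linsub (coords n m) (amat b A) v) = act n b (\<lambda>q. h (A q)) z v"
proof -
  interpret h: comm_ring_hom h by fact
  interpret e: comm_ring_hom "ev h z" by (rule ev_hom[OF h])
  obtain k i j where vk: "v = (k, i, j)" "k < m" "i < n" "j < n" using v by (auto simp: coords_def)
  let ?s = "\<lambda>l. if b then (k, l, j) else (k, i, l)"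
  have "ev h z (linsub (coords n m) (amat b A) v) = (\<Sum>w\<in>coords n m. h (amat b A v w) * z w)"
    by (simp add: linsub_def lin_def e.hom_sum ev_single)
  also have "\<dots> = (\<Sum>w\<in>?s ` {..<n}. h (amat b A v w) * z w)"
    by (rule sum.mono_neutral_right) (use vk in \<open>auto simp: coords_def amat_def image_iff split: if_splits\<close>)
  also have "\<dots> = (\<Sum>l<n. h (amat b A v (?s l)) * z (?s l))"
    by (subst sum.reindex) (auto simp: inj_on_def comp_def)
  also have "\<dots> = act n b (\<lambda>q. h (A q)) z v"
    by (auto simp: act_def vk(1) amat_def intro!: sum.cong)
  finally show ?thesis .
qed

definition Polys :: "'v set \<Rightarrow> ('v, 'a::zero) mpoly set" where
  "Polys X = {p. \<forall>A\<in>keys p. set_mset A \<subseteq> X}"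

lemma Form_Polys: "p \<in> Form X e \<Longrightarrow> p \<in> Polys X"
  by (auto simp: Form_def Mon_def Polys_def)

lemma ev_sbst_linsub:
  assumes p: "p \<in> Polys (coords n m)" and h: "comm_ring_hom h"
  shows "ev h z (sbst (linsub (coords n m) (amat b A)) p) = ev h (act n b (\<lambda>q. h (A q)) z) p"
  unfolding ev_sbst[OF h] by (rule ev_cong, rule ev_linsub[OF _ h]) (use p in \<open>auto simp: Polys_def\<close>)

locale left_right =
  fixes n m :: nat
  assumes n: "n > 0" and m: "m > 0"
begin

sublocale invariants "coords n m" "sl_mats n"
proof
  fix M assume "M \<in> sl_mats n"
  then obtain b A where M: "M = amat b A" and A: "det (mat n n A) = 1" by (auto simp: sl_mats_def)
  have "mat n n (\<lambda>(i, j). A (j, i)) = transpose_mat (mat n n A)" by (rule eq_matI) auto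
  then have "det (mat n n (\<lambda>(i, j). A (j, i))) = 1" using A det_transpose[of "mat n n A" n] by simp
  moreover have "(\<lambda>v w. M w v) = amat b (\<lambda>(i, j). A (j, i))" by (auto simp: M amat_def fun_eq_iff)
  ultimately show "(\<lambda>v w. M w v) \<in> sl_mats n" by (auto simp: sl_mats_def)
qed simp

lemma amat_sl: "det (mat n n A) = 1 \<Longrightarrow> amat b A \<in> sl_mats n"
  by (auto simp: sl_mats_def)

lemma R_ev:
  assumes "p \<in> R e" "det (mat n n A) = 1"
  shows "ev (\<lambda>c. c) (act n b A z) p = ev (\<lambda>c. c) z p"
proof -
  have "sbst (linsub (coords n m) (amat b A)) p = p" using assms amat_sl unfolding R_def by blast
  then show ?thesis using ev_sbst_linsub[OF Form_Polys[OF R_Form[OF assms(1)]] hom_id, of z b A] by simp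
qed

lemma R_I:
  assumes p: "p \<in> Form (coords n m) e"
    and inv: "\<And>b A z. det (mat n n A) = 1 \<Longrightarrow> ev (\<lambda>c. c) (act n b A z) p = ev (\<lambda>c. c) z p"
  shows "p \<in> R e"
proof -
  have "sbst (linsub (coords n m) (amat b A)) p - p = 0" if "det (mat n n A) = 1" for b A
  proof (rule zero_test)
    fix z :: "nat \<times> nat \<times> nat \<Rightarrow> rat"
    interpret e: comm_ring_hom "ev (\<lambda>c. c) z" by (rule ev_hom[OF hom_id])
    show "ev (\<lambda>c. c) z (sbst (linsub (coords n m) (amat b A)) p - p) = 0"
      using inv[OF that, of b z] ev_sbst_linsub[OF Form_Polys[OF p] hom_id, of z b A] by (simp add: e.hom_minus)
  qed
  then have "sbst (linsub (coords n m) M) p = p" if "M \<in> sl_mats n" for M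
    using that unfolding sl_mats_def by auto
  then show ?thesis using p unfolding R_def by simp
qed

lemma blowup_in_R: "det (bigmat m n n Var (\<lambda>v. Con (T v))) \<in> R (n * n)"
proof (rule R_I)
  let ?D = "bigmat m n n Var (\<lambda>v. Con (T v)) :: ((nat \<times> nat \<times> nat), rat) mpoly mat"
  have entry: "?D $$ (p, q) \<in> Form (coords n m) 1" if "p < n * n" "q < n * n" for p q
  proof -
    have "Var (k, p mod n, q mod n) * Con (T (k, p div n, q div n)) \<in> Form (coords n m) (1 + 0)" if "k < m" for k
      by (intro Form_mult Form_Var Form_Con) (use that n in \<open>simp add: coords_def\<close>)
    then show ?thesis using that by (auto simp: bigmat_def intro!: Form_sum)
  qed
  have "det ?D = (\<Sum>\<sigma> | \<sigma> permutes {..<n * n}. Con (signof \<sigma>) * (\<Prod>r<n * n. ?D $$ (r, \<sigma> r)))"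
    by (subst det_def'[OF bigmat_carrier]) (simp add: atLeast0LessThan signof_Con)
  also have "\<dots> \<in> Form (coords n m) (n * n)"
  proof (intro Form_sum Form_Con_mult)
    fix \<sigma> assume "\<sigma> \<in> {\<sigma>. \<sigma> permutes {..<n * n}}"
    then have \<sigma>: "\<sigma> permutes {..<n * n}" by simp
    have "(\<Prod>r<n * n. ?D $$ (r, \<sigma> r)) \<in> Form (coords n m) (\<Sum>r<n * n. 1)"
      using permutes_in_image[OF \<sigma>] by (intro Form_prod entry) auto
    then show "(\<Prod>r<n * n. ?D $$ (r, \<sigma> r)) \<in> Form (coords n m) (n * n)" by simp
  qed
  finally show "det ?D \<in> Form (coords n m) (n * n)" .
  fix b and A :: "nat \<times> nat \<Rightarrow> rat" and z assume "det (mat n n A) = 1"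
  then show "ev (\<lambda>c. c) (act n b A z) (det ?D) = ev (\<lambda>c. c) z (det ?D)"
    by (simp add: hom_bigmat[OF ev_hom[OF hom_id]] ev_Var[OF hom_id] ev_Con[OF hom_id] det_bigmat_act[OF n])
qed

text \<open>Dividing the first row of \<open>A\<close> by \<open>det A\<close> and clearing denominators turns invariance into a
  polynomial identity in the entries of \<open>A\<close>, which then holds over every field. The entries of \<open>A\<close>
  are the variables with first index \<open>0\<close>.\<close>

definition vdet :: "((nat \<times> nat \<times> nat), rat) mpoly" where
  "vdet = det (mat n n (\<lambda>(i, j). Var (0, i, j)))"

definition vact :: "bool \<Rightarrow> nat \<times> nat \<times> nat \<Rightarrow> ((nat \<times> nat \<times> nat), rat) mpoly" where
  "vact b = act n b (\<lambda>(i, j). if i = 0 then Var (0, i, j) else vdet * Var (0, i, j)) (\<lambda>(k, i, j). Var (Suc k, i, j))"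

lemma ev_vdet:
  assumes "comm_ring_hom h"
  shows "ev h y vdet = det (mat n n (\<lambda>(i, j). y (0, i, j)))"
proof -
  interpret e: comm_ring_hom "ev h y" by (rule ev_hom[OF assms])
  have "map_mat (ev h y) (mat n n (\<lambda>(i, j). Var (0, i, j))) = mat n n (\<lambda>(i, j). y (0, i, j))"
    by (rule eq_matI) (auto simp: ev_Var[OF assms])
  then show ?thesis unfolding vdet_def e.hom_det[symmetric] by simp
qed

lemma ev_vact:
  assumes "comm_ring_hom h"
  shows "ev h y (vact b v) = act n b (\<lambda>(i, j). if i = 0 then y (0, i, j) else det (mat n n (\<lambda>(i, j). y (0, i, j))) * y (0, i, j))
    (\<lambda>(k, i, j). y (Suc k, i, j)) v"
proof -
  interpret e: comm_ring_hom "ev h y" by (rule ev_hom[OF assms])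
  have "(\<lambda>q. ev h y (case q of (i, j) \<Rightarrow> if i = 0 then Var (0, i, j) else vdet * Var (0, i, j))) =
    (\<lambda>(i, j). if i = 0 then y (0, i, j) else det (mat n n (\<lambda>(i, j). y (0, i, j))) * y (0, i, j))"
    by (auto simp: fun_eq_iff ev_Var[OF assms] e.hom_mult ev_vdet[OF assms])
  moreover have "(\<lambda>q. ev h y (case q of (k, i, j) \<Rightarrow> Var (Suc k, i, j))) = (\<lambda>(k, i, j). y (Suc k, i, j))"
    by (auto simp: fun_eq_iff ev_Var[OF assms])
  ultimately show ?thesis unfolding vact_def hom_act[OF ev_hom[OF assms]] by (simp only:)
qed

lemma det_scale_row:
  fixes A :: "nat \<times> nat \<Rightarrow> 'a::comm_ring_1"
  shows "det (mat n n (\<lambda>(i, j). if i = 0 then c * A (i, j) else A (i, j))) = c * det (mat n n A)"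
proof -
  have "mat n n (\<lambda>(i, j). if i = 0 then c * A (i, j) else A (i, j)) = multrow 0 c (mat n n A)"
    by (rule eq_matI) (auto simp: mat_multrow_def)
  then show ?thesis using det_multrow[of 0 n "mat n n A" c] n by simp
qed

lemma R_identity:
  assumes p: "p \<in> R e"
  shows "vdet * (sbst (vact b) p - vdet ^ e * sbst (\<lambda>(k, i, j). Var (Suc k, i, j)) p) = 0"
proof (rule zero_test)
  fix y :: "nat \<times> nat \<times> nat \<Rightarrow> rat"
  interpret e: comm_ring_hom "ev (\<lambda>c. c) y" by (rule ev_hom[OF hom_id])
  define A where "A = (\<lambda>(i, j). y (0, i, j))"
  define z where "z = (\<lambda>(k, i, j). y (Suc k, i, j))"
  define \<delta> where "\<delta> = det (mat n n A)"
  have \<delta>: "ev (\<lambda>c. c) y vdet = \<delta>" by (simp add: ev_vdet[OF hom_id] \<delta>_def A_def)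
  have z: "(\<lambda>v. ev (\<lambda>c. c) y (case v of (k, i, j) \<Rightarrow> Var (Suc k, i, j))) = z"
    by (auto simp: z_def ev_Var[OF hom_id])
  show "ev (\<lambda>c. c) y (vdet * (sbst (vact b) p - vdet ^ e * sbst (\<lambda>(k, i, j). Var (Suc k, i, j)) p)) = 0"
  \<comment> \<open>The factor \<open>vdet\<close> in the identity settles the points with
    determinant 0; elsewhere the first row of \<open>A\<close> may be divided by
    \<open>\<delta>\<close>.\<close>
  proof (cases "\<delta> = 0")
    case False
    let ?A = "\<lambda>(i, j). if i = 0 then (1 / \<delta>) * A (i, j) else A (i, j)"
    have "det (mat n n ?A) = 1" using False by (simp add: det_scale_row flip: \<delta>_def)
    then have "ev (\<lambda>c. c) (act n b ?A z) p = ev (\<lambda>c. c) z p" by (rule R_ev[OF p])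
    moreover have "ev (\<lambda>c. c) (\<lambda>v. \<delta> * act n b ?A z v) p = \<delta> ^ e * ev (\<lambda>c. c) (act n b ?A z) p"
      by (rule ev_Form_scale[OF R_Form[OF p] hom_id])
    moreover have "(\<lambda>v. ev (\<lambda>c. c) y (vact b v)) = (\<lambda>v. \<delta> * act n b ?A z v)"
    proof -
      have "(\<lambda>(i, j). if i = 0 then y (0, i, j) else det (mat n n (\<lambda>(i, j). y (0, i, j))) * y (0, i, j)) = (\<lambda>q. \<delta> * ?A q)"
        using False by (auto simp: fun_eq_iff A_def \<delta>_def)
      then show ?thesis unfolding ev_vact[OF hom_id] act_scale[symmetric] by (simp add: z_def)
    qed
    ultimately show ?thesis by (simp add: e.hom_mult e.hom_minus e.hom_power \<delta> z ev_sbst[OF hom_id])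
  qed (simp add: e.hom_mult \<delta>)
qed

text \<open>A specialisation of \<open>R_identity\<close> with the variables of first index 0 set to
  \<open>A\<close> and the others to \<open>z\<close>. In this way invariance under rational
  matrices extends to every field of characteristic 0.\<close>

lemma R_ev_field:
  fixes z :: "nat \<times> nat \<times> nat \<Rightarrow> 'k::field_char_0"
  assumes p: "p \<in> R e" and A: "det (mat n n A) = 1"
  shows "ev of_rat (act n b A z) p = ev of_rat z p"
proof -
  have h: "comm_ring_hom (of_rat :: rat \<Rightarrow> 'k)" by (rule of_rat_hom.comm_ring_hom_axioms)
  define y where "y = (\<lambda>(k, i, j). case k of 0 \<Rightarrow> A (i, j) | Suc k \<Rightarrow> z (k, i, j))"
  interpret e: comm_ring_hom "ev of_rat y" by (rule ev_hom[OF h])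
  have "mat n n (\<lambda>(i, j). y (0, i, j)) = mat n n A" by (rule eq_matI) (auto simp: y_def)
  then have A': "det (mat n n (\<lambda>(i, j). y (0, i, j))) = 1" using A by simp
  have "(\<lambda>(i, j). if i = 0 then y (0, i, j) else 1 * y (0, i, j)) = A" "(\<lambda>(k, i, j). y (Suc k, i, j)) = z"
    by (auto simp: y_def fun_eq_iff)
  then have va: "(\<lambda>v. ev of_rat y (vact b v)) = act n b A z" unfolding ev_vact[OF h] A' by simp
  have vz: "(\<lambda>v. ev of_rat y (case v of (k, i, j) \<Rightarrow> Var (Suc k, i, j))) = z"
    by (auto simp: y_def fun_eq_iff ev_Var[OF h])
  have "ev of_rat y (vdet * (sbst (vact b) p - vdet ^ e * sbst (\<lambda>(k, i, j). Var (Suc k, i, j)) p)) = 0"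
    unfolding R_identity[OF p] by (rule e.hom_zero)
  then show ?thesis by (simp add: e.hom_mult e.hom_minus e.hom_power ev_vdet[OF h] A' ev_sbst[OF h] va vz)
qed

text \<open>For nonsingular \<open>A\<close>, divide by an \<open>n\<close>-th root of the
  determinant and use homogeneity. The singular case follows since the difference \<open>P\<close>,
  a polynomial in the entries of \<open>A\<close>, is killed by the nonzero determinant polynomial
  \<open>V\<close>.\<close>

lemma R_ev_det:
  fixes z :: "nat \<times> nat \<times> nat \<Rightarrow> complex"
  assumes p: "p \<in> R (N * n)"
  shows "ev of_rat (act n b A z) p = det (mat n n A) ^ N * ev of_rat z p"
proof -
  have h: "comm_ring_hom (of_rat :: rat \<Rightarrow> complex)" by (rule of_rat_hom.comm_ring_hom_axioms)
  have nz: "ev of_rat (act n b A z) p = det (mat n n A) ^ N * ev of_rat z p" if "det (mat n n A) \<noteq> 0" for A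
  proof -
    let ?\<delta> = "det (mat n n A)"
    define s where "s = rcis (root n (cmod ?\<delta>)) (Arg ?\<delta> / n)"
    have s: "s ^ n = ?\<delta>" unfolding s_def DeMoivre2 using n by (simp add: rcis_cmod_Arg)
    then have s0: "s \<noteq> 0" using that n by (metis power_0_left less_numeral_extra(3))
    let ?A = "\<lambda>q. (1 / s) * A q"
    have "mat n n ?A = (1 / s) \<cdot>\<^sub>m mat n n A" by (rule eq_matI) auto
    then have "det (mat n n ?A) = (1 / s) ^ n * ?\<delta>" by simp
    also have "\<dots> = 1" using s0 that by (simp add: power_divide s)
    finally have "ev of_rat (act n b ?A z) p = ev of_rat z p" by (rule R_ev_field[OF p])
    moreover have "ev of_rat (\<lambda>v. s * act n b ?A z v) p = s ^ (N * n) * ev of_rat (act n b ?A z) p"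
      by (rule ev_Form_scale[OF R_Form[OF p] h])
    moreover have "(\<lambda>v. s * act n b ?A z v) = act n b A z" unfolding act_scale[symmetric] using s0 by simp
    moreover have "s ^ (N * n) = ?\<delta> ^ N" by (simp add: s[symmetric] power_mult[symmetric] mult.commute)
    ultimately show ?thesis by simp
  qed
  define V where "V = (det (mat n n Var) :: ((nat \<times> nat), complex) mpoly)"
  define P where "P = ev (\<lambda>c. Con (of_rat c)) (act n b Var (\<lambda>v. Con (z v))) p - V ^ N * Con (ev of_rat z p)"
  have evV: "ev (\<lambda>c. c) A V = det (mat n n A)" for A
  proof -
    interpret e: comm_ring_hom "ev (\<lambda>c. c) A" by (rule ev_hom[OF hom_id])
    have "map_mat (ev (\<lambda>c. c) A) (mat n n Var) = mat n n A" by (rule eq_matI) (auto simp: ev_Var[OF hom_id])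
    then show ?thesis unfolding V_def e.hom_det[symmetric] by simp
  qed
  have evP: "ev (\<lambda>c. c) A P = ev of_rat (act n b A z) p - det (mat n n A) ^ N * ev of_rat z p" for A
  proof -
    have hA: "comm_ring_hom (ev (\<lambda>c. c) A)" by (rule ev_hom[OF hom_id])
    interpret e: comm_ring_hom "ev (\<lambda>c. c) A" by (rule hA)
    show ?thesis
      by (simp add: P_def e.hom_minus e.hom_mult e.hom_power evV hom_ev[OF hA] hom_act[OF hA] ev_Con[OF hom_id] ev_Var[OF hom_id])
  qed
  have "V * P = 0"
  proof (rule zero_test)
    fix A :: "nat \<times> nat \<Rightarrow> complex"
    interpret e: comm_ring_hom "ev (\<lambda>c. c) A" by (rule ev_hom[OF hom_id])
    show "ev (\<lambda>c. c) A (V * P) = 0"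
      using nz[of A] by (cases "det (mat n n A) = 0") (simp_all add: e.hom_mult evV evP)
  qed
  moreover have "V \<noteq> 0"
  proof
    assume "V = 0"
    then have "det (mat n n (\<lambda>(i, j). if i = j then 1 else 0 :: complex)) = 0" by (simp flip: evV)
    moreover have "mat n n (\<lambda>(i, j). if i = j then 1 else 0 :: complex) = 1\<^sub>m n" by (rule eq_matI) auto
    ultimately show False by simp
  qed
  ultimately have "P = 0" by simp
  then show ?thesis using evP[of A] by simp
qed

text \<open>Vanishing of \<open>R (n * n)\<close> gives vanishing of all blow-up determinants of
  size \<open>N = n\<close>, then of all larger sizes by \<open>singular_all\<close>, and
  \<open>semi_invariant_vanishes\<close> applies to a power of \<open>h\<close>.\<close>

theorem nullcone_vanishes:
  fixes z :: "nat \<times> nat \<times> nat \<Rightarrow> complex"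
  assumes z: "\<And>u. u \<in> R (n * n) \<Longrightarrow> ev of_rat z u = 0" and h: "h \<in> R e" and e: "e > 0"
  shows "ev of_rat z h = 0"
proof -
  have rh: "comm_ring_hom (of_rat :: rat \<Rightarrow> complex)" by (rule of_rat_hom.comm_ring_hom_axioms)
  interpret ev: comm_ring_hom "ev of_rat z" by (rule ev_hom[OF rh])
  have "det (bigmat m n n (\<lambda>v. Con (z v)) Var) = (0 :: ((nat \<times> nat \<times> nat), complex) mpoly)"
  proof (rule zero_test)
    \<comment> \<open>\<open>zero_test\<close> only asks for natural numbers. There the blow-up
      determinant has rational coefficients and so is one of the invariants assumed to vanish at
      \<open>z\<close>.\<close>
    fix T :: "nat \<times> nat \<times> nat \<Rightarrow> complex" assume "\<And>v. T v \<in> \<nat>"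
    then have "\<exists>k. T v = of_nat k" for v by (metis Nats_cases)
    then obtain T' :: "nat \<times> nat \<times> nat \<Rightarrow> nat" where "\<forall>v. T v = of_nat (T' v)" by metis
    then have T: "T = (\<lambda>v. of_rat (of_nat (T' v)))" by auto
    have "ev of_rat z (det (bigmat m n n Var (\<lambda>v. Con (of_nat (T' v))))) = 0" by (rule z[OF blowup_in_R])
    then have "det (bigmat m n n z T) = 0"
      unfolding T by (simp add: hom_bigmat[OF ev_hom[OF rh]] ev_Var[OF rh] ev_Con[OF rh])
    then show "ev (\<lambda>c. c) T (det (bigmat m n n (\<lambda>v. Con (z v)) Var)) = 0"
      by (simp add: hom_bigmat[OF ev_hom[OF hom_id]] ev_Var[OF hom_id] ev_Con[OF hom_id])
  qed
  then have "ev (\<lambda>c. c) T (det (bigmat m n n (\<lambda>v. Con (z v)) Var)) = 0" for T by simp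
  then have sing: "det (bigmat m n n z T) = 0" for T
    by (simp add: hom_bigmat[OF ev_hom[OF hom_id]] ev_Var[OF hom_id] ev_Con[OF hom_id])
  \<comment> \<open>The power makes the degree a multiple \<open>N * n\<close> with
    \<open>N = e * n\<close>; this \<open>N\<close> is at least \<open>n\<close>, as
    \<open>singular_all\<close> requires.\<close>
  have f: "h ^ (n * n) \<in> R ((e * n) * n)" using R_power[OF h, of "n * n"] by (simp add: ac_simps)
  have "ev of_rat z (h ^ (n * n)) = 0"
  proof (rule semi_invariant_vanishes[OF n R_Form[OF f]])
    show "det (bigmat m n (e * n) z T) = 0" for T
      by (rule singular_all[OF n sing]) (use e in simp)
  qed (use R_ev_det[OF f, of True] R_ev_det[OF f, of False] in \<open>simp_all add: act_def\<close>)
  then show ?thesis by (simp add: ev.hom_power)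
qed

end

sublocale left_right \<subseteq> nullcone "coords n m" "sl_mats n" "n * n"
proof
  show "coords n m \<noteq> {}" using n m by (auto simp: coords_def)
qed (use n nullcone_vanishes in auto)

section \<open>From rational invariants to fields of characteristic zero\<close>

lemma Polys_add: "p \<in> Polys X \<Longrightarrow> q \<in> Polys X \<Longrightarrow> p + q \<in> Polys X"
  for p q :: "('v, 'a::comm_monoid_add) mpoly"
  using keys_add[of p q] unfolding Polys_def by blast

lemma Polys_mult: "p \<in> Polys X \<Longrightarrow> q \<in> Polys X \<Longrightarrow> p * q \<in> Polys X"
  for p q :: "('v, 'a::comm_ring_1) mpoly"
  using keys_mult[of p q] unfolding Polys_def by fastforce

lemma Polys_Con: "Con c \<in> Polys X"
  by (simp add: Polys_def)

lemma Polys_sum: "(\<And>i. i \<in> I \<Longrightarrow> f i \<in> Polys X) \<Longrightarrow> sum f I \<in> Polys X"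
  for f :: "'i \<Rightarrow> ('v, 'a::comm_monoid_add) mpoly"
proof (induction I rule: infinite_finite_induct)
  case (insert i I)
  then show ?case by (simp add: Polys_add)
qed (simp_all add: Polys_def)

lemma homogeneous_split:
  assumes "p \<in> Polys X" "\<And>A. A \<in> keys p \<Longrightarrow> size A \<le> D"
  shows "p = (\<Sum>d\<le>D. restr (Mon X d) p)"
proof (rule poly_mapping_eqI)
  fix A
  have "coef (\<Sum>d\<le>D. restr (Mon X d) p) A = (\<Sum>d\<le>D. if d = size A then (if set_mset A \<subseteq> X then coef p A else 0) else 0)"
    unfolding lookup_sum coef_restr by (rule sum.cong) (auto simp: Mon_def)
  also have "\<dots> = coef p A"
    using assms by (auto simp: Polys_def in_keys_iff)
  finally show "coef p A = coef (\<Sum>d\<le>D. restr (Mon X d) p) A" ..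
qed

lemma ex_degree_bound:
  obtains D :: nat where "\<And>A. A \<in> keys p \<Longrightarrow> size A \<le> D"
  by (rule that[of "Max (insert 0 (size ` keys p))"]) auto

lemma restr_Form_id: "p \<in> Form X e \<Longrightarrow> restr (Mon X d) p = (if e = d then p else 0)"
  by (rule poly_mapping_eqI) (auto simp: coef_restr Form_def Mon_def in_keys_iff)

text \<open>Linear substitutions preserve degrees. Hence homogeneous components of an invariant
  polynomial are invariant.\<close>

lemma restr_sbst_linsub:
  fixes p :: "('v, rat) mpoly"
  assumes "p \<in> Polys X"
  shows "restr (Mon X d) (sbst (linsub X M) p) = sbst (linsub X M) (restr (Mon X d) p)"
proof -
  interpret s: comm_ring_hom "sbst (linsub X M)" by (rule sbst_hom)
  obtain D0 where "\<And>A. A \<in> keys p \<Longrightarrow> size A \<le> D0" using ex_degree_bound by blast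
  then have p: "p = (\<Sum>e\<le>max D0 d. restr (Mon X e) p)"
    by (intro homogeneous_split[OF assms]) force
  have "restr (Mon X d) (sbst (linsub X M) p) = (\<Sum>e\<le>max D0 d. restr (Mon X d) (sbst (linsub X M) (restr (Mon X e) p)))"
    by (subst p) (simp add: s.hom_sum restr_sum)
  also have "\<dots> = (\<Sum>e\<le>max D0 d. if e = d then sbst (linsub X M) (restr (Mon X e) p) else 0)"
    by (simp only: restr_Form_id[OF sbst_linsub_Form[OF restr_Form]])
  also have "\<dots> = sbst (linsub X M) (restr (Mon X d) p)" by simp
  finally show ?thesis .
qed

section \<open>Polynomial functions on matrix tuples as values of formal polynomials\<close>

definition point :: "(nat \<Rightarrow> 'a mat) \<Rightarrow> nat \<times> nat \<times> nat \<Rightarrow> 'a" where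
  "point Y = (\<lambda>(k, i, j). Y k $$ (i, j))"

definition poly_fun :: "nat \<Rightarrow> nat \<Rightarrow> ((nat \<times> nat \<times> nat), 'k) mpoly \<Rightarrow> (nat \<Rightarrow> 'k::field mat) \<Rightarrow> 'k" where
  "poly_fun n m p = (\<lambda>Y\<in>mat_tuples n m. ev (\<lambda>c. c) (point Y) p)"

definition exponent_of :: "nat \<Rightarrow> nat \<Rightarrow> (nat \<times> nat \<times> nat) multiset \<Rightarrow> nat \<times> nat \<times> nat \<Rightarrow> nat" where
  "exponent_of n m A = restrict (count A) (coords n m)"

lemma bij_exponent_of: "bij_betw (exponent_of n m) (Mon (coords n m) d) (exponents n m d)"
proof (rule bij_betw_byWitness[where f' = "\<lambda>a. \<Sum>v\<in>coords n m. replicate_mset (a v) v"])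
  have cnt: "count (\<Sum>v\<in>coords n m. replicate_mset (a v) v) w = (if w \<in> coords n m then a w else 0)" for a w
    by (simp add: count_sum)
  show "\<forall>A\<in>Mon (coords n m) d. (\<Sum>v\<in>coords n m. replicate_mset (exponent_of n m A v) v) = A"
    by (intro ballI multiset_eqI) (auto simp: cnt exponent_of_def Mon_def not_in_iff)
  show "\<forall>a\<in>exponents n m d. exponent_of n m (\<Sum>v\<in>coords n m. replicate_mset (a v) v) = a"
    by (auto simp: exponent_of_def exponents_def cnt fun_eq_iff PiE_def extensional_def)
  show "exponent_of n m ` Mon (coords n m) d \<subseteq> exponents n m d"
  proof
    fix a assume "a \<in> exponent_of n m ` Mon (coords n m) d"
    then obtain A where A: "a = exponent_of n m A" "set_mset A \<subseteq> coords n m" "size A = d" by (auto simp: Mon_def)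
    have "sum (count A) (coords n m) = sum (count A) (set_mset A)"
      by (rule sum.mono_neutral_right) (use A in \<open>auto simp: not_in_iff\<close>)
    then show "a \<in> exponents n m d" using A by (auto simp: exponents_def exponent_of_def size_multiset_overloaded_eq)
  qed
  show "(\<lambda>a. \<Sum>v\<in>coords n m. replicate_mset (a v) v) ` exponents n m d \<subseteq> Mon (coords n m) d"
    by (auto simp: Mon_def exponents_def size_multiset_sum set_mset_sum split: if_splits)
qed

lemma monomial_fun_exponent_of:
  assumes "A \<in> Mon (coords n m) d"
  shows "monomial_fun n m (exponent_of n m A) Y = (\<Prod>v\<in>#A. point Y v)"
proof -
  have "(\<Prod>v\<in>#A. point Y v) = (\<Prod>v\<in>set_mset A. point Y v ^ count A v)"
    by (rule image_prod_mset_multiplicity)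
  also have "\<dots> = (\<Prod>v\<in>coords n m. point Y v ^ count A v)"
    by (rule prod.mono_neutral_left) (use assms in \<open>auto simp: Mon_def not_in_iff\<close>)
  also have "\<dots> = monomial_fun n m (exponent_of n m A) Y"
    unfolding monomial_fun_def by (rule prod.cong) (auto simp: point_def exponent_of_def)
  finally show ?thesis ..
qed

lemma homogeneous_funs_eq: "homogeneous_funs n m d = poly_fun n m ` Form (coords n m) d"
proof -
  have sums: "(\<Sum>a\<in>exponents n m d. c a * monomial_fun n m a Y) =
    (\<Sum>A\<in>Mon (coords n m) d. c (exponent_of n m A) * (\<Prod>v\<in>#A. point Y v))" for c and Y :: "nat \<Rightarrow> 'a mat"
    by (subst sum.reindex_bij_betw[OF bij_exponent_of, symmetric]) (simp add: monomial_fun_exponent_of)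
  show ?thesis
  proof (intro equalityI subsetI)
    fix f :: "(nat \<Rightarrow> 'a mat) \<Rightarrow> 'a" assume "f \<in> homogeneous_funs n m d"
    then obtain c where f: "f = (\<lambda>Y\<in>mat_tuples n m. \<Sum>a\<in>exponents n m d. c a * monomial_fun n m a Y)"
      by (auto simp: homogeneous_funs_def)
    let ?p = "\<Sum>A\<in>Mon (coords n m) d. mon A (c (exponent_of n m A))"
    have "f = poly_fun n m ?p"
      unfolding f poly_fun_def sums by (simp add: ev_sum ev_single)
    moreover have "?p \<in> Form (coords n m) d" by (intro Form_sum Form_single)
    ultimately show "f \<in> poly_fun n m ` Form (coords n m) d" by blast
  next
    fix f :: "(nat \<Rightarrow> 'a mat) \<Rightarrow> 'a" assume "f \<in> poly_fun n m ` Form (coords n m) d"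
    then obtain p where f: "f = poly_fun n m p" and p: "p \<in> Form (coords n m) d" by auto
    define c where "c a = coef p (inv_into (Mon (coords n m) d) (exponent_of n m) a)" for a
    have "c (exponent_of n m A) = coef p A" if "A \<in> Mon (coords n m) d" for A
      using that bij_exponent_of[of n m d] by (simp add: c_def bij_betw_def)
    then have "f = (\<lambda>Y\<in>mat_tuples n m. \<Sum>a\<in>exponents n m d. c a * monomial_fun n m a Y)"
      unfolding f poly_fun_def sums using p
      by (subst ev_superset[OF finite_Mon[OF finite_coords], of _ n m d]) (auto simp: Form_def)
    then show "f \<in> homogeneous_funs n m d" by (auto simp: homogeneous_funs_def)
  qed
qed

lemma poly_fun_sum:
  assumes "finite I"
  shows "poly_fun n m (sum p I) = (\<lambda>Y\<in>mat_tuples n m. \<Sum>i\<in>I. poly_fun n m (p i) Y)"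
  by (auto simp: poly_fun_def fun_eq_iff ev_sum)

lemma polynomial_funs_eq: "polynomial_funs n m = poly_fun n m ` Polys (coords n m)"
proof (intro equalityI subsetI)
  fix f :: "(nat \<Rightarrow> 'a mat) \<Rightarrow> 'a" assume "f \<in> polynomial_funs n m"
  then obtain g D where g: "\<And>d. g d \<in> homogeneous_funs n m d" and f: "f = (\<lambda>X\<in>mat_tuples n m. \<Sum>d\<le>D. g d X)"
    by (auto simp: polynomial_funs_def)
  from g have "\<exists>p. p \<in> Form (coords n m) d \<and> g d = poly_fun n m p" for d
    unfolding homogeneous_funs_eq by (auto simp: image_iff)
  then obtain p where p: "\<And>d. p d \<in> Form (coords n m) d" "\<And>d. g d = poly_fun n m (p d)" by metis
  have "f = poly_fun n m (\<Sum>d\<le>D. p d)" by (simp add: f p(2) poly_fun_sum)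
  moreover have "(\<Sum>d\<le>D. p d) \<in> Polys (coords n m)" by (intro Polys_sum Form_Polys[OF p(1)])
  ultimately show "f \<in> poly_fun n m ` Polys (coords n m)" by blast
next
  fix f :: "(nat \<Rightarrow> 'a mat) \<Rightarrow> 'a" assume "f \<in> poly_fun n m ` Polys (coords n m)"
  then obtain p where f: "f = poly_fun n m p" and p: "p \<in> Polys (coords n m)" by auto
  obtain D where "\<And>A. A \<in> keys p \<Longrightarrow> size A \<le> D" using ex_degree_bound by blast
  then have "f = (\<lambda>Y\<in>mat_tuples n m. \<Sum>d\<le>D. poly_fun n m (restr (Mon (coords n m) d) p) Y)"
    unfolding f using homogeneous_split[OF p] poly_fun_sum[of "{..D}" n m "\<lambda>d. restr (Mon (coords n m) d) p"] by simp
  moreover have "poly_fun n m (restr (Mon (coords n m) d) p) \<in> homogeneous_funs n m d" for d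
    unfolding homogeneous_funs_eq by (intro imageI restr_Form)
  ultimately show "f \<in> polynomial_funs n m" 
    unfolding polynomial_funs_def
    by (intro CollectI exI[of _ "\<lambda>d. poly_fun n m (restr (Mon (coords n m) d) p)"] exI[of _ D]) simp
qed

section \<open>The generated subalgebra\<close>

lemma generated_subset_invariant_ring:
  "generated_algebra (mat_tuples n m) (\<Union>e\<le>d. invariants_of_degree n m e) \<subseteq> invariant_ring n m"
proof
  fix f :: "(nat \<Rightarrow> 'a mat) \<Rightarrow> 'a"
  let ?P = "\<lambda>f. f \<in> polynomial_funs n m \<and> (\<forall>A\<in>special_linear n. \<forall>B\<in>special_linear n. \<forall>X\<in>mat_tuples n m.
    f (left_right_act m (A, B) X) = f X)"
  assume "f \<in> generated_algebra (mat_tuples n m) (\<Union>e\<le>d. invariants_of_degree n m e)"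
  then have "?P f"
  proof induction
    case (const c)
    have "(\<lambda>X\<in>mat_tuples n m. c) = poly_fun n m (Con c)" by (simp add: poly_fun_def ev_single)
    then have "(\<lambda>X\<in>mat_tuples n m. c) \<in> polynomial_funs n m" unfolding polynomial_funs_eq using Polys_Con by blast
    then show ?case by (intro conjI ballI; (assumption | simp add: left_right_act_closed))
  next
    case (gen f)
    then show ?case by (auto simp: invariants_of_degree_def invariant_ring_def)
  next
    case (add f g)
    then obtain p q where "f = poly_fun n m p" "g = poly_fun n m q" "p \<in> Polys (coords n m)" "q \<in> Polys (coords n m)"
      unfolding polynomial_funs_eq by blast
    then have "(\<lambda>X\<in>mat_tuples n m. f X + g X) = poly_fun n m (p + q)" "p + q \<in> Polys (coords n m)"
      by (auto simp: poly_fun_def ev_add fun_eq_iff Polys_add)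
    then have "(\<lambda>X\<in>mat_tuples n m. f X + g X) \<in> polynomial_funs n m" unfolding polynomial_funs_eq by blast
    moreover have "\<forall>A\<in>special_linear n. \<forall>B\<in>special_linear n. \<forall>X\<in>mat_tuples n m.
      (\<lambda>X\<in>mat_tuples n m. f X + g X) (left_right_act m (A, B) X) = (\<lambda>X\<in>mat_tuples n m. f X + g X) X"
      using add.IH by (simp add: left_right_act_closed)
    ultimately show ?case by (rule conjI)
  next
    case (mult f g)
    interpret e: comm_ring_hom "ev (\<lambda>c. c) z" for z :: "nat \<times> nat \<times> nat \<Rightarrow> 'a" by (rule ev_hom[OF hom_id])
    from mult obtain p q where "f = poly_fun n m p" "g = poly_fun n m q" "p \<in> Polys (coords n m)" "q \<in> Polys (coords n m)"
      unfolding polynomial_funs_eq by blast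
    then have "(\<lambda>X\<in>mat_tuples n m. f X * g X) = poly_fun n m (p * q)" "p * q \<in> Polys (coords n m)"
      by (auto simp: poly_fun_def e.hom_mult fun_eq_iff Polys_mult)
    then have "(\<lambda>X\<in>mat_tuples n m. f X * g X) \<in> polynomial_funs n m" unfolding polynomial_funs_eq by blast
    moreover have "\<forall>A\<in>special_linear n. \<forall>B\<in>special_linear n. \<forall>X\<in>mat_tuples n m.
      (\<lambda>X\<in>mat_tuples n m. f X * g X) (left_right_act m (A, B) X) = (\<lambda>X\<in>mat_tuples n m. f X * g X) X"
      using mult.IH by (simp add: left_right_act_closed)
    ultimately show ?case by (rule conjI)
  qed
  then show "f \<in> invariant_ring n m" by (auto simp: invariant_ring_def)
qed

lemma generated_sum:
  assumes "finite I" "\<And>i. i \<in> I \<Longrightarrow> f i \<in> generated_algebra V S"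
  shows "(\<lambda>X\<in>V. \<Sum>i\<in>I. f i X) \<in> generated_algebra V S"
  using assms
proof (induction I)
  case empty
  show ?case unfolding sum.empty by (rule generated_algebra.const)
next
  case (insert i I)
  then have "(\<lambda>X\<in>V. f i X + (\<lambda>X\<in>V. \<Sum>i\<in>I. f i X) X) \<in> generated_algebra V S" by (intro generated_algebra.add) auto
  also have "(\<lambda>X\<in>V. f i X + (\<lambda>X\<in>V. \<Sum>i\<in>I. f i X) X) = (\<lambda>X\<in>V. \<Sum>i\<in>insert i I. f i X)"
    using insert by (auto simp: fun_eq_iff)
  finally show ?case .
qed

lemma generated_scale: "f \<in> generated_algebra V S \<Longrightarrow> (\<lambda>X\<in>V. c * f X) \<in> generated_algebra V S"
proof -
  assume "f \<in> generated_algebra V S"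
  then have "(\<lambda>X\<in>V. (\<lambda>X\<in>V. c) X * f X) \<in> generated_algebra V S"
    by (intro generated_algebra.mult generated_algebra.const)
  also have "(\<lambda>X\<in>V. (\<lambda>X\<in>V. c) X * f X) = (\<lambda>X\<in>V. c * f X)" by (auto simp: fun_eq_iff)
  finally show ?thesis .
qed

section \<open>The group action in coordinates\<close>

lemma act_cong:
  assumes "v \<in> coords n m" "\<And>i j. i < n \<Longrightarrow> j < n \<Longrightarrow> A (i, j) = A' (i, j)" "\<And>w. w \<in> coords n m \<Longrightarrow> z w = z' w"
  shows "act n b A z v = act n b A' z' v"
  using assms(1) by (auto simp: act_def coords_def intro!: sum.cong arg_cong2[where f = "(*)"] assms(2,3))

lemma act_one: "v \<in> coords n m \<Longrightarrow> act n b (\<lambda>(i, j). if i = j then 1 else 0) z v = z v"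
proof -
  have *: "(\<Sum>l<n. (if i = l then 1 else 0) * g l) = g i" if "i < n" for i and g :: "nat \<Rightarrow> 'a"
    using that by (simp add: if_distrib[of "\<lambda>x. x * _"] cong: if_cong)
  assume "v \<in> coords n m"
  then show ?thesis by (cases b) (auto simp: act_def coords_def *)
qed

text \<open>Both group factors become instances of \<open>act\<close>: rows are acted on by
  \<open>A\<close>, columns by the transposed inverse of \<open>B\<close>.\<close>

lemma point_left_right_act:
  assumes "A \<in> special_linear n" "B \<in> special_linear n" "Y \<in> mat_tuples n m" "v \<in> coords n m"
  shows "point (left_right_act m (A, B) Y) v =
    act n True (\<lambda>q. A $$ q) (act n False (\<lambda>(i, j). the (mat_inverse B) $$ (j, i)) (point Y)) v"
proof -
  obtain k i j where v: "v = (k, i, j)" "k < m" "i < n" "j < n" using assms(4) by (auto simp: coords_def)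
  let ?C = "the (mat_inverse B)"
  have cm: "A \<in> carrier_mat n n" "Y k \<in> carrier_mat n n" "?C \<in> carrier_mat n n"
    using assms v mat_inverse_special_linear(1) by (auto simp: special_linear_def mat_tuples_def)
  then have "A * Y k * ?C = A * (Y k * ?C)" by (rule assoc_mult_mat)
  then show ?thesis
    using v cm by (simp add: left_right_act_def point_def act_def scalar_prod_def atLeast0LessThan mult.commute)
qed

text \<open>The group acts on the right through inverses; this realises right multiplication by a
  prescribed \<open>C\<close>.\<close>

lemma special_linear_ex_inverse:
  assumes "C \<in> special_linear n"
  obtains B where "B \<in> special_linear n" "the (mat_inverse B) = C"
proof -
  let ?B = "the (mat_inverse C)"
  note i = mat_inverse_special_linear[OF assms]
  have C: "C \<in> carrier_mat n n" "det C = 1" using assms by (auto simp: special_linear_def)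
  have "det (C * ?B) = 1" by (simp add: i)
  then have "det ?B = 1" using det_mult[OF C(1) i(1)] C(2) by simp
  then have B: "?B \<in> special_linear n" using i(1) by (simp add: special_linear_def)
  note j = mat_inverse_special_linear[OF B]
  have "the (mat_inverse ?B) = (C * ?B) * the (mat_inverse ?B)" using j(1) by (simp add: i)
  also have "\<dots> = C * (?B * the (mat_inverse ?B))" by (rule assoc_mult_mat[OF C(1) i(1) j(1)])
  also have "\<dots> = C" using C by (simp add: j)
  finally show thesis using B that by blast
qed

context left_right
begin

lemma R_invariants_of_degree:
  assumes r: "r \<in> R e"
  shows "poly_fun n m (mapc of_rat r) \<in> (invariants_of_degree n m e :: ((nat \<Rightarrow> 'k::field_char_0 mat) \<Rightarrow> 'k) set)"
proof -
  have F: "mapc of_rat r \<in> (Form (coords n m) e :: ((nat \<times> nat \<times> nat), 'k) mpoly set)"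
    using R_Form[OF r] keys_mapc[of "of_rat :: rat \<Rightarrow> 'k" r] by (auto simp: Form_def)
  have evr: "ev (\<lambda>c. c) z (mapc of_rat r) = ev of_rat z r" for z :: "_ \<Rightarrow> 'k" by (simp add: ev_mapc)
  have "poly_fun n m (mapc of_rat r) (left_right_act m (A, B) Y) = poly_fun n m (mapc of_rat r) Y"
    if A: "A \<in> special_linear n" and B: "B \<in> special_linear n" and Y: "Y \<in> mat_tuples n m"
    for A B :: "'k mat" and Y
  proof -
    let ?C = "the (mat_inverse B)"
    note i = mat_inverse_special_linear[OF B]
    have Bc: "B \<in> carrier_mat n n" "det B = 1" "A \<in> carrier_mat n n" "det A = 1"
      using A B by (auto simp: special_linear_def)
    have "det (B * ?C) = 1" by (simp add: i)
    then have "det ?C = 1" using det_mult[OF Bc(1) i(1)] Bc(2) by simp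
    moreover have "mat n n (\<lambda>(i, j). ?C $$ (j, i)) = transpose_mat ?C" using i(1) by (intro eq_matI) auto
    ultimately have dC: "det (mat n n (\<lambda>(i, j). ?C $$ (j, i))) = 1" using det_transpose[OF i(1)] by simp
    have "mat n n (\<lambda>q. A $$ q) = A" using Bc by (intro eq_matI) auto
    then have dA: "det (mat n n (\<lambda>q. A $$ q)) = 1" using Bc by simp
    have "ev of_rat (point (left_right_act m (A, B) Y)) r =
      ev of_rat (act n True (\<lambda>q. A $$ q) (act n False (\<lambda>(i, j). ?C $$ (j, i)) (point Y))) r"
      by (rule ev_cong, rule point_left_right_act[OF A B Y]) (use Form_Polys[OF R_Form[OF r]] in \<open>auto simp: Polys_def\<close>)
    also have "\<dots> = ev of_rat (point Y) r" by (simp only: R_ev_field[OF r dA] R_ev_field[OF r dC])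
    finally show ?thesis using left_right_act_closed[OF A B Y] Y by (simp add: poly_fun_def evr)
  qed
  then show ?thesis
    using F Form_Polys[OF F]
    by (auto simp: invariants_of_degree_def invariant_ring_def polynomial_funs_eq homogeneous_funs_eq)
qed

text \<open>Above the bound, \<open>decomposition\<close> expresses \<open>r\<close> through
  invariants of degrees \<open>n * n\<close> and \<open>e - n * n\<close>, both of which are smaller
  than \<open>e\<close>.\<close>

lemma R_generated:
  assumes "r \<in> R e"
  shows "poly_fun n m (mapc of_rat r) \<in> generated_algebra (mat_tuples n m :: (nat \<Rightarrow> 'k::field_char_0 mat) set)
    (\<Union>e\<le>m * n ^ 4. invariants_of_degree n m e)"
  using assms
proof (induction e arbitrary: r rule: less_induct)
  case (less e)
  show ?case
  proof (cases "e \<le> m * n ^ 4")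
    case True
    then show ?thesis using R_invariants_of_degree[OF less.prems] by (intro generated_algebra.gen) auto
  next
    case False
    have c: "card (coords n m) * (n * n) = m * n ^ 4"
      by (simp add: coords_def card_cartesian_product power4_eq_xxxx ac_simps)
    \<comment> \<open>Ensures that the members of \<open>F\<close>, of degree \<open>n * n\<close>,
      fall under the induction hypothesis when \<open>e\<close> exceeds the bound.\<close>
    then have d: "n * n \<le> m * n ^ 4" using m n by (metis card_0_eq finite_coords le_add1 mult_eq_0_iff mult_le_mono1 nat_mult_1 Suc_leI neq0_conv One_nat_def Xne)
    obtain F where F: "finite F" "F \<subseteq> R (n * n)"
      "\<And>f e. f \<in> R e \<Longrightarrow> card (coords n m) * (n * n) \<le> e \<Longrightarrow> \<exists>r. f = (\<Sum>h\<in>F. h * r h) \<and> (\<forall>h\<in>F. r h \<in> R (e - n * n))"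
      using decomposition by blast
    obtain s where s: "r = (\<Sum>h\<in>F. h * s h)" "\<And>h. h \<in> F \<Longrightarrow> s h \<in> R (e - n * n)"
      using F(3)[OF less.prems] False c by auto
    let ?f = "\<lambda>p. poly_fun n m (mapc of_rat p) :: (nat \<Rightarrow> 'k mat) \<Rightarrow> 'k"
    interpret ev: comm_ring_hom "ev (of_rat :: rat \<Rightarrow> 'k) z" for z
      by (rule ev_hom) (rule of_rat_hom.comm_ring_hom_axioms)
    have "?f r = (\<lambda>Y\<in>mat_tuples n m. \<Sum>h\<in>F. (\<lambda>Y\<in>mat_tuples n m. ?f h Y * ?f (s h) Y) Y)"
      by (auto simp: fun_eq_iff poly_fun_def ev_mapc s(1) ev.hom_sum ev.hom_mult)
    also have "\<dots> \<in> generated_algebra (mat_tuples n m) (\<Union>e\<le>m * n ^ 4. invariants_of_degree n m e)"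
    proof (intro generated_sum F generated_algebra.mult)
      fix h assume h: "h \<in> F"
      have "n * n > 0" using n by simp
      then show "?f (s h) \<in> generated_algebra (mat_tuples n m) (\<Union>e\<le>m * n ^ 4. invariants_of_degree n m e)"
        using False by (intro less.IH[OF _ s(2)[OF h]]) simp
      show "?f h \<in> generated_algebra (mat_tuples n m) (\<Union>e\<le>m * n ^ 4. invariants_of_degree n m e)"
        using False d h F(2) by (intro less.IH[of "n * n"]) auto
    qed
    finally show ?thesis .
  qed
qed

text \<open>A rational matrix acting on one side is realised by a group element over the field whose
  other component acts as the identity.\<close>

lemma invariant_ring_rational:
  fixes p :: "((nat \<times> nat \<times> nat), 'k::field_char_0) mpoly"
  assumes f: "poly_fun n m p \<in> invariant_ring n m" and p: "p \<in> Polys (coords n m)"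
    and A: "det (mat n n A) = 1"
  shows "ev (\<lambda>c. c) (\<lambda>v. of_rat (act n b A z v)) p = ev (\<lambda>c. c) (\<lambda>v. of_rat (z v)) p"
proof -
  have h: "comm_ring_hom (of_rat :: rat \<Rightarrow> 'k)" by (rule of_rat_hom.comm_ring_hom_axioms)
  define Y where "Y = (\<lambda>k\<in>{..<m}. mat n n (\<lambda>(i, j). of_rat (z (k, i, j)) :: 'k))"
  have Y: "Y \<in> mat_tuples n m" by (auto simp: Y_def mat_tuples_def)
  have pY: "point Y v = of_rat (z v)" if "v \<in> coords n m" for v
    using that by (auto simp: Y_def point_def coords_def)
  define M where "M = mat n n (\<lambda>q. of_rat (A q) :: 'k)"
  have "M = map_mat of_rat (mat n n A)" by (rule eq_matI) (auto simp: M_def)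
  then have M: "M \<in> special_linear n" by (simp add: special_linear_def M_def A of_rat_hom.hom_det)
  then have Mt: "transpose_mat M \<in> special_linear n" using det_transpose[of M n] by (simp add: special_linear_def)
  have I: "1\<^sub>m n \<in> (special_linear n :: 'k mat set)" by (simp add: special_linear_def)
  obtain C D where CD: "C \<in> special_linear n" "D \<in> special_linear n"
    "\<And>v. v \<in> coords n m \<Longrightarrow> point (left_right_act m (C, D) Y) v = act n b (\<lambda>q. of_rat (A q)) (\<lambda>v. of_rat (z v)) v"
  proof (cases b)
    case True
    obtain D :: "'k mat" where D: "D \<in> special_linear n" "the (mat_inverse D) = 1\<^sub>m n" using special_linear_ex_inverse[OF I] by blast
    have inner: "act n False (\<lambda>(i, j). 1\<^sub>m n $$ (j, i)) (point Y) v = of_rat (z v)" if "v \<in> coords n m" for v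
    proof -
      have "act n False (\<lambda>(i, j). 1\<^sub>m n $$ (j, i)) (point Y) v = act n False (\<lambda>(i, j). if i = j then 1 else 0) (point Y) v"
        by (rule act_cong[OF that]) auto
      then show ?thesis using that by (simp add: act_one pY)
    qed
    have b: "b = True" using True by simp
    have "act n True (\<lambda>q. M $$ q) (act n False (\<lambda>(i, j). 1\<^sub>m n $$ (j, i)) (point Y)) v =
      act n b (\<lambda>q. of_rat (A q)) (\<lambda>v. of_rat (z v)) v" if "v \<in> coords n m" for v
      unfolding b by (rule act_cong[OF that]) (auto simp: M_def intro: inner)
    then show thesis using that[OF M D(1)] point_left_right_act[OF M D(1) Y] D(2) by simp
  next
    case False
    obtain D :: "'k mat" where D: "D \<in> special_linear n" "the (mat_inverse D) = transpose_mat M"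
      using special_linear_ex_inverse[OF Mt] by blast
    have "act n True (\<lambda>q. 1\<^sub>m n $$ q) (act n False (\<lambda>(i, j). transpose_mat M $$ (j, i)) (point Y)) v =
      act n b (\<lambda>q. of_rat (A q)) (\<lambda>v. of_rat (z v)) v" if "v \<in> coords n m" for v
    proof -
      have "act n True (\<lambda>q. 1\<^sub>m n $$ q) (act n False (\<lambda>(i, j). transpose_mat M $$ (j, i)) (point Y)) v =
        act n True (\<lambda>(i, j). if i = j then 1 else 0) (act n False (\<lambda>(i, j). transpose_mat M $$ (j, i)) (point Y)) v"
        by (rule act_cong[OF that]) auto
      also have "\<dots> = act n False (\<lambda>(i, j). transpose_mat M $$ (j, i)) (point Y) v" by (rule act_one[OF that])
      also have "\<dots> = act n b (\<lambda>q. of_rat (A q)) (\<lambda>v. of_rat (z v)) v"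
        using False by (simp only:) (rule act_cong[OF that], auto simp: M_def pY)
      finally show ?thesis .
    qed
    then show thesis using that[OF I D(1)] point_left_right_act[OF I D(1) Y] D(2) by simp
  qed
  have cong: "ev (\<lambda>c. c) x p = ev (\<lambda>c. c) y p" if "\<And>v. v \<in> coords n m \<Longrightarrow> x v = y v" for x y
    by (rule ev_cong, rule that) (use p in \<open>auto simp: Polys_def\<close>)
  have "poly_fun n m p (left_right_act m (C, D) Y) = poly_fun n m p Y"
    using f CD(1,2) Y by (auto simp: invariant_ring_def)
  then have "ev (\<lambda>c. c) (point (left_right_act m (C, D) Y)) p = ev (\<lambda>c. c) (point Y) p"
    using Y left_right_act_closed[OF CD(1,2) Y] by (simp add: poly_fun_def)
  then show ?thesis by (simp only: cong[OF CD(3)] cong[OF pY] hom_act[OF h])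
qed

lemma ev_mapc_rational:
  fixes phi :: "'k::field_char_0 \<Rightarrow> rat"
  assumes add: "\<And>x y. phi (x + y) = phi x + phi y" and scale: "\<And>q x. phi (of_rat q * x) = q * phi x"
  shows "ev (\<lambda>c. c) z (mapc phi p) = phi (ev (\<lambda>c. c) (\<lambda>v. of_rat (z v)) p)"
proof -
  have phi0: "phi 0 = 0" using add[of 0 0] by simp
  have phis: "phi (sum f I) = (\<Sum>i\<in>I. phi (f i))" for f :: "'v multiset \<Rightarrow> 'k" and I
    by (induction I rule: infinite_finite_induct) (auto simp: phi0 add)
  have pr: "(\<Prod>v\<in>#A. of_rat (z v)) = (of_rat (\<Prod>v\<in>#A. z v) :: 'k)" for A
    by (induction A) (auto simp: of_rat_mult)
  have "phi (ev (\<lambda>c. c) (\<lambda>v. of_rat (z v)) p) = (\<Sum>A\<in>keys p. phi (of_rat (\<Prod>v\<in>#A. z v) * coef p A))"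
    unfolding ev_def phis pr by (simp add: mult.commute)
  then show ?thesis by (simp add: ev_mapc phi0 scale) (simp add: ev_def mult.commute)
qed

text \<open>Expand the coefficients of \<open>p\<close> in a basis over the rationals. At rational
  points the coordinate polynomial \<open>q b\<close> takes the values \<open>phi b\<close> of those
  of \<open>p\<close>, so it inherits invariance; its homogeneous components lie in
  \<open>R d\<close> and \<open>R_generated\<close> applies.\<close>

lemma invariant_ring_generated:
  fixes f :: "(nat \<Rightarrow> 'k::field_char_0 mat) \<Rightarrow> 'k"
  assumes "f \<in> invariant_ring n m"
  shows "f \<in> generated_algebra (mat_tuples n m) (\<Union>e\<le>m * n ^ 4. invariants_of_degree n m e)"
proof -
  obtain p where f: "f = poly_fun n m p" and p: "p \<in> Polys (coords n m)"
    using assms unfolding invariant_ring_def polynomial_funs_eq by auto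
  obtain phi :: "'k \<Rightarrow> 'k \<Rightarrow> rat" where phi: "\<And>b x y. phi b (x + y) = phi b x + phi b y"
    "\<And>b q x. phi b (of_rat q * x) = q * phi b x" "\<And>x. finite {b. phi b x \<noteq> 0}"
    "\<And>x. (\<Sum>b | phi b x \<noteq> 0. of_rat (phi b x) * b) = x" "phi 1 1 = 1"
    by (rule rat_coordinates, rule that)
  have phi0: "phi b 0 = 0" for b using phi(1)[of b 0 0] by simp
  define q where "q b = mapc (phi b) p" for b
  have kq: "keys (q b) \<subseteq> keys p" for b unfolding q_def by (rule keys_mapc) (rule phi0)
  then have q: "q b \<in> Polys (coords n m)" for b using p by (auto simp: Polys_def)
  have inv: "sbst (linsub (coords n m) (amat s A)) (q b) - q b = 0" if A: "det (mat n n A) = 1" for s A b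
  proof (rule zero_test)
    fix z :: "nat \<times> nat \<times> nat \<Rightarrow> rat"
    interpret e: comm_ring_hom "ev (\<lambda>c. c) z" by (rule ev_hom[OF hom_id])
    show "ev (\<lambda>c. c) z (sbst (linsub (coords n m) (amat s A)) (q b) - q b) = 0"
      using invariant_ring_rational[OF assms[unfolded f] p A, of s z]
      unfolding e.hom_minus ev_sbst_linsub[OF q hom_id] by (simp add: q_def ev_mapc_rational[of "phi b", OF phi(1,2)])
  qed
  have R: "restr (Mon (coords n m) d) (q b) \<in> R d" for b d
  proof -
    have "sbst (linsub (coords n m) M) (restr (Mon (coords n m) d) (q b)) = restr (Mon (coords n m) d) (q b)"
      if "M \<in> sl_mats n" for M
    proof -
      have "sbst (linsub (coords n m) M) (q b) = q b" using that inv unfolding sl_mats_def by auto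
      then show ?thesis unfolding restr_sbst_linsub[OF q, symmetric] by simp
    qed
    then show ?thesis using restr_Form unfolding R_def by blast
  qed
  obtain D where D: "\<And>A. A \<in> keys p \<Longrightarrow> size A \<le> D" using ex_degree_bound by blast
  \<comment> \<open>The finitely many basis elements that occur in some coefficient of
    \<open>p\<close>.\<close>
  define B where "B = (\<Union>A\<in>keys p. {b. phi b (coef p A) \<noteq> 0})"
  have finB: "finite B" unfolding B_def using phi(3) by auto
  have cB: "coef p A = (\<Sum>b\<in>B. of_rat (phi b (coef p A)) * b)" if "A \<in> keys p" for A
    by (subst phi(4)[symmetric], rule sum.mono_neutral_left) (use that finB in \<open>auto simp: B_def\<close>)
  interpret ev: comm_ring_hom "ev (of_rat :: rat \<Rightarrow> 'k) z" for z
    by (rule ev_hom) (rule of_rat_hom.comm_ring_hom_axioms)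
  have "ev (\<lambda>c. c) z p = (\<Sum>b\<in>B. b * (\<Sum>d\<le>D. ev of_rat z (restr (Mon (coords n m) d) (q b))))" for z
  proof -
    have "ev (\<lambda>c. c) z p = (\<Sum>A\<in>keys p. \<Sum>b\<in>B. of_rat (phi b (coef p A)) * b * (\<Prod>v\<in>#A. z v))"
      unfolding ev_def by (rule sum.cong) (auto simp: sum_distrib_right[symmetric] cB[symmetric])
    also have "\<dots> = (\<Sum>b\<in>B. b * (\<Sum>A\<in>keys p. of_rat (phi b (coef p A)) * (\<Prod>v\<in>#A. z v)))"
      by (subst sum.swap) (simp add: sum_distrib_left mult_ac)
    also have "\<dots> = (\<Sum>b\<in>B. b * ev of_rat z (q b))"
      by (simp add: q_def ev_mapc phi0) (simp add: ev_def)
    also have "\<dots> = (\<Sum>b\<in>B. b * (\<Sum>d\<le>D. ev of_rat z (restr (Mon (coords n m) d) (q b))))"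
    proof (rule sum.cong[OF refl])
      fix b
      have "q b = (\<Sum>d\<le>D. restr (Mon (coords n m) d) (q b))" using kq D by (intro homogeneous_split[OF q]) auto
      then have "ev of_rat z (q b) = (\<Sum>d\<le>D. ev of_rat z (restr (Mon (coords n m) d) (q b)))" by (metis ev.hom_sum)
      then show "b * ev of_rat z (q b) = b * (\<Sum>d\<le>D. ev of_rat z (restr (Mon (coords n m) d) (q b)))" by simp
    qed
    finally show ?thesis .
  qed
  then have "f = (\<lambda>Y\<in>mat_tuples n m. \<Sum>b\<in>B. (\<lambda>Y\<in>mat_tuples n m. b * (\<lambda>Y\<in>mat_tuples n m. \<Sum>d\<le>D.
      poly_fun n m (mapc of_rat (restr (Mon (coords n m) d) (q b))) Y) Y) Y)"
    by (auto simp: f poly_fun_def fun_eq_iff ev_mapc)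
  also have "\<dots> \<in> generated_algebra (mat_tuples n m) (\<Union>e\<le>m * n ^ 4. invariants_of_degree n m e)"
    by (intro generated_sum generated_scale R_generated[OF R] finB) simp
  finally show ?thesis .
qed

end

theorem theorem1p2:
  fixes n m :: nat
  assumes "n \<ge> 1" and "m \<ge> 1"
  shows "beta TYPE('k::field_char_0) n m \<le> m * n ^ 4 \<and>
    generated_in_degree_le TYPE('k) n m (m * n ^ 4)"
proof -
  interpret left_right n m by unfold_locales (use assms in auto)
  have "generated_in_degree_le TYPE('k) n m (m * n ^ 4)"
    unfolding generated_in_degree_le_def using generated_subset_invariant_ring invariant_ring_generated by blast
  then show ?thesis unfolding beta_def by (auto intro: Least_le)
qed

end
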